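(* Let $c_0$ be a smooth background sound speed on $Y=\mathbb{R}^3_+=\{x_3\ge 0\}$ for which no single ray connects a source to a receiver and no ray originating in the subsurface grazes the surface $\{x_3=0\}$. Suppose that fold caustics, and no worse, appear for $c_0$ in the marine data acquisition geometry, i.e. that, with $s_1$ regarded as a variable, the spatial projection $\pi_Y:\Lambda_{s_2}\to\mathbb{R}^3$ is a submersion with folds. Let $C\subset T^*(\Sigma_{r,s}\times(0,T))\times T^*\mathbb{R}^3_+$ be the canonical relation of the linearized scattering operator $F$ for the marine geometry, parametrized as in the context. Then $\pi_R:C\to T^*\mathbb{R}^3\setminus 0$ is a submersion with folds and $\pi_L:C\to T^*(\Sigma_{r,s}\times(0,T))\setminus0$ is a cross cap.
   Context: Linearized scattering. $c_0$ is a smooth known sound speed. With $p_0$ the solution of $c_0^{-2}\partial_t^2p_0-\triangle p_0=\delta(t)\delta(x-s)$, $p_0=0$ for $t<0$, the operator $F:\delta c\mapsto\delta p|_{\Sigma_{r,s}\times(0,T)}$ is defined by $c_0^{-2}\partial_t^2\delta p-\triangle\delta p=\frac{2\delta c}{c_0^3}\partial_t^2p_0$, $\delta p=0$ for $t<0$. In the marine geometry $\Sigma_{r,s}=\{(r_1,r_2;s_1,s_2): s_2=r_2\}$ (sources $(s_1,s_2,0)$, receivers $(r_1,r_2,0)$, in open bounded sets of the surface), with coordinates $(s_1,r_1,r_2)$, and $F$ is a Fourier integral operator associated to $C$. Incident rays and fold caustics. Let $H(x,p)=\frac12(c_0(x)^{-2}-|p|^2)$. For a source $s$, $\Lambda_s\subset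 T^*\mathbb{R}^3\setminus0$ is the Lagrangian swept out by the bicharacteristics of $H$ (in $H=0$) issuing from the fiber over $s$. Fix $s_2$ (a single pass of the vessel; $s_2$ is suppressed from the notation) and let $\Lambda_{s_2}$ be the union of $\Lambda_{(s_1,s_2,0)}$, $s_1\in\mathbb{R}$, with $\pi_Y$ the projection $(x,p)\mapsto x$. On $\Lambda_{s_2}$, with $s_1$ as an extra variable, $(x_1,x_2,s_1,p_3)$ are used as local coordinates near the points considered (for suitable coordinates $x_1,x_2,x_3$), so that $x_3=f(x_1,x_2,s_1,p_3)$ and $p_j=g_j(x_1,x_2,s_1,p_3)$, $j=1,2$. In these coordinates $\pi_Y$ is a submersion with folds iff, on $\{\partial f/\partial p_3=\partial f/\partial s_1=0\}$, the $2\times2$ Hessian of $f$ in $(p_3,s_1)$ is nonsingular. The canonical relation. $C$ is parametrized by $(s_1,x_1,x_2,p_3,\alpha_1,\alpha_2,\tau)$, where $(\alpha_1,\alpha_2,\sqrt{1-|\alpha|^2})$ (suitable branch of the square root) is the takeoff direction at $x=(x_1,x_2,f)$ of the reflected ray and $\tau\neq0$ is dual to time: $$C=\big\{(s_1,r_1,r_2,t_{inc}+t_{ref},\sigma,\rho_1,\rho_2,\tau;\ x_1,x_2,f,\,-\tau(c_0^{-1}\alpha_1+g_1),-\tau(c_0^{-1}\alpha_2+g_2),-\tau(c_0^{-1}\sqrt{1-|\alpha|^2}+p_3))\big\},$$ with $c_0^{-1}$ evaluated at $x$. Here $t_{inc}$ is the travel time along the incident ray from the source to $x$; $(r_1,r_2,0)$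 and $t_{ref}$ are the arrival point on the surface and the travel time of the reflected ray; and $\sigma,\rho_1,\rho_2$ are the covariables dual to $s_1,r_1,r_2$ determined by the incident ray at the source and the reflected ray at the receiver (so that $C$ is Lagrangian for the difference of the symplectic forms). $\pi_L,\pi_R$ are the projections from $C$ to the left and right factors. Singularity classes. For $\dim V=N>\dim W=M$, a smooth map $h:V\to W$ is a submersion with folds if $dh$ drops rank by at most 1, the set $\mathcal S_1(h)$ where it drops rank is a smooth submanifold, and in local coordinates with $h(x)=(x_1,\dots,x_{M-1},h_1(x))$ one has $\det[\partial^2h_1/\partial x_i\partial x_j]_{M\le i,j\le N}\ne0$ on $\mathcal S_1(h)$. For $\dim V=N<\dim W=M$, $g:V\to W$ is a cross cap if $dg$ drops rank by at most 1 and, with $\mathcal S_1(g)$ the set where it drops rank: (i) $\mathcal S_1(g)$ is smooth of codimension $M-N+1$; (ii) the $N\times N$ minors of $dg$ generate the ideal of $\mathcal S_1(g)$; (iii) $\ker dg\cap T\mathcal S_1(g)=(0)$. *)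

theory Defs
  imports "HOL-Analysis.Analysis"
begin

section \<open>Smooth maps, local coordinates, submanifolds of open subsets of \<open>\<real>\<^sup>n\<close>\<close>

primrec differentiable_upto :: "nat \<Rightarrow> 'a::real_normed_vector set \<Rightarrow> ('a \<Rightarrow> 'b::real_normed_vector) \<Rightarrow> bool"
  where
    "differentiable_upto 0 S f \<longleftrightarrow> continuous_on S f"
  | "differentiable_upto (Suc k) S f \<longleftrightarrow>
       (\<forall>x\<in>S. f differentiable (at x)) \<and>
       (\<forall>v. differentiable_upto k S (\<lambda>x. frechet_derivative f (at x) v))"

text \<open>Only meant for open sets.\<close>

definition smooth_on :: "'a::real_normed_vector set \<Rightarrow> ('a \<Rightarrow> 'b::real_normed_vector) \<Rightarrow> bool"
  where "smooth_on S f \<longleftrightarrow> (\<forall>k. differentiable_upto k S f)"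

definition partial_deriv :: "'n::finite \<Rightarrow> (real^'n \<Rightarrow> real) \<Rightarrow> real^'n \<Rightarrow> real"
  where "partial_deriv i f x = frechet_derivative f (at x) (axis i 1)"

definition gradient :: "(real^'n::finite \<Rightarrow> real) \<Rightarrow> real^'n \<Rightarrow> real^'n"
  where "gradient f x = (\<chi> i. partial_deriv i f x)"

definition local_coordinates :: "(real^'n::finite) set \<Rightarrow> (real^'n \<Rightarrow> real^'n) \<Rightarrow> bool"
  where "local_coordinates V \<phi> \<longleftrightarrow>
    open V \<and> smooth_on V \<phi> \<and> inj_on \<phi> V \<and> open (\<phi> ` V) \<and> smooth_on (\<phi> ` V) (inv_into V \<phi>)"

definition smooth_submanifold :: "nat \<Rightarrow> (real^'n::finite) set \<Rightarrow> bool"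
  where \<comment> \<open>the first argument is the codimension\<close>
    "smooth_submanifold k S \<longleftrightarrow>
      (\<forall>x\<in>S. \<exists>V \<phi> K. x \<in> V \<and> local_coordinates V \<phi> \<and> card K = k \<and>
         \<phi> ` (S \<inter> V) = {y \<in> \<phi> ` V. \<forall>i\<in>K. y $ i = 0})"

definition tangent_space :: "(real^'n::finite) set \<Rightarrow> real^'n \<Rightarrow> (real^'n) set"
  where "tangent_space S x =
    {v. \<exists>\<gamma> e. 0 < e \<and> smooth_on {-e<..<e} \<gamma> \<and> \<gamma> ` {-e<..<e} \<subseteq> S \<and> \<gamma> 0 = x \<and>
          (\<gamma> has_vector_derivative v) (at (0::real))}"


section \<open>Submersions with folds and cross caps\<close>

text \<open>The source manifold is an open subset of \<open>\<real>\<^sup>n\<close>, i.e. a coordinate patch.\<close>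

definition rank_drop_set :: "(real^'n::finite) set \<Rightarrow> (real^'n \<Rightarrow> real^'m::finite) \<Rightarrow> (real^'n) set"
  where "rank_drop_set V h =
    {x \<in> V. rank (jacobian h (at x)) < min CARD('n) CARD('m)}"

definition rank_drops_at_most_1 :: "(real^'n::finite) set \<Rightarrow> (real^'n \<Rightarrow> real^'m::finite) \<Rightarrow> bool"
  where "rank_drops_at_most_1 V h \<longleftrightarrow>
    (\<forall>x\<in>V. min CARD('n) CARD('m) \<le> rank (jacobian h (at x)) + 1)"

text \<open>The determinant of the principal submatrix of the Hessian with index set \<open>K\<close>
  (the Hessian is padded by the identity outside \<open>K \<times> K\<close>).\<close>

definition hessian_det :: "'n::finite set \<Rightarrow> (real^'n \<Rightarrow> real) \<Rightarrow> real^'n \<Rightarrow> real"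
  where "hessian_det K f x =
    det (\<chi> i j. if i \<in> K \<and> j \<in> K then partial_deriv i (partial_deriv j f) x
                else if i = j then 1 else (0::real))"

text \<open>In the coordinates \<open>\<phi>\<close> on \<open>O\<close> and \<open>\<psi>\<close> on \<open>W\<close>, \<open>h\<close> has the form
  \<open>(x\<^sub>1,\<dots>,x\<^sub>m\<^sub>-\<^sub>1,h\<^sub>1(x))\<close> up to the numbering of the coordinates: \<open>l\<close> is the
  index of the component \<open>h\<^sub>1\<close>, and \<open>\<iota>\<close> enumerates the coordinates \<open>x\<^sub>1,\<dots>,x\<^sub>m\<^sub>-\<^sub>1\<close>
  of the source, so that the remaining ones are those outside the range of \<open>\<iota>\<close>.\<close>

definition submersion_with_folds :: "(real^'n::finite) set \<Rightarrow> (real^'n \<Rightarrow> real^'m::finite) \<Rightarrow> bool"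
  where "submersion_with_folds V h \<longleftrightarrow>
    CARD('m) < CARD('n) \<and> open V \<and> smooth_on V h \<and>
    rank_drops_at_most_1 V h \<and>
    (\<exists>k. smooth_submanifold k (rank_drop_set V h)) \<and>
    (\<forall>x \<in> rank_drop_set V h. \<exists>O' W \<phi> \<psi> l \<iota>.
        x \<in> O' \<and> O' \<subseteq> V \<and> h ` O' \<subseteq> W \<and> local_coordinates O' \<phi> \<and> local_coordinates W \<psi> \<and>
        inj_on \<iota> (- {l}) \<and>
        (\<forall>y\<in>O'. \<forall>i. i \<noteq> l \<longrightarrow> \<psi> (h y) $ i = \<phi> y $ \<iota> i) \<and>
        (\<forall>y \<in> rank_drop_set V h \<inter> O'.
           hessian_det (- \<iota> ` (- {l})) (\<lambda>z. \<psi> (h (inv_into O' \<phi> z)) $ l) (\<phi> y) \<noteq> 0))"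

definition maximal_minor :: "(real^'n::finite \<Rightarrow> real^'m::finite) \<Rightarrow> ('n \<Rightarrow> 'm) \<Rightarrow> real^'n \<Rightarrow> real"
  where \<comment> \<open>the rows of the differential are selected by the injection \<open>\<kappa>\<close>\<close>
    "maximal_minor g \<kappa> x = det (\<chi> i j. jacobian g (at x) $ \<kappa> i $ j)"

text \<open>Equality of the ideal (sheaf) generated by the maximal minors with the ideal of smooth functions
  vanishing on \<open>S\<close>; the inclusion of the former in the latter is the first conjunct.\<close>

definition minors_generate_ideal_of ::
    "(real^'n::finite) set \<Rightarrow> (real^'n \<Rightarrow> real^'m::finite) \<Rightarrow> (real^'n) set \<Rightarrow> bool"
  where "minors_generate_ideal_of V g S \<longleftrightarrow>
    (\<forall>\<kappa>. inj \<kappa> \<longrightarrow> (\<forall>x\<in>S. maximal_minor g \<kappa> x = 0)) \<and>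
    (\<forall>x\<in>V. \<forall>O' u. open O' \<and> x \<in> O' \<and> O' \<subseteq> V \<and> smooth_on O' u \<and> (\<forall>y\<in>O' \<inter> S. u y = 0) \<longrightarrow>
       (\<exists>O'' a. open O'' \<and> x \<in> O'' \<and> O'' \<subseteq> O' \<and>
          (\<forall>\<kappa>. smooth_on O'' (a \<kappa>)) \<and>
          (\<forall>y\<in>O''. u y = (\<Sum>\<kappa> | inj \<kappa>. a \<kappa> y * maximal_minor g \<kappa> y))))"

definition cross_cap :: "(real^'n::finite) set \<Rightarrow> (real^'n \<Rightarrow> real^'m::finite) \<Rightarrow> bool"
  where "cross_cap V g \<longleftrightarrow>
    CARD('n) < CARD('m) \<and> open V \<and> smooth_on V g \<and>
    rank_drops_at_most_1 V g \<and>
    smooth_submanifold (CARD('m) - CARD('n) + 1) (rank_drop_set V g) \<and>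
    minors_generate_ideal_of V g (rank_drop_set V g) \<and>
    (\<forall>x \<in> rank_drop_set V g.
       {v. frechet_derivative g (at x) v = 0} \<inter> tangent_space (rank_drop_set V g) x = {0})"


section \<open>Rays\<close>

definition half_space :: "(real^3) set"
  where "half_space = {x. 0 \<le> x $ 3}"

definition subsurface :: "(real^3) set"
  where "subsurface = {x. 0 < x $ 3}"

definition surface_point :: "real \<times> real \<Rightarrow> real^3"
  where "surface_point a = vector [fst a, snd a, 0]"

text \<open>A smooth function on the closed half space is the restriction of a smooth function on a
  neighbourhood; \<open>c\<^sub>0\<close> denotes such an extension. Rays stay in the half space, so
  only the values there (and the one-sided derivatives at the surface) matter.\<close>

definition sound_speed :: "(real^3 \<Rightarrow> real) \<Rightarrow> bool"
  where "sound_speed c0 \<longleftrightarrow>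
    (\<exists>V. open V \<and> half_space \<subseteq> V \<and> smooth_on V c0) \<and> (\<forall>x\<in>half_space. 0 < c0 x)"

definition hamiltonian :: "(real^3 \<Rightarrow> real) \<Rightarrow> real^3 \<Rightarrow> real^3 \<Rightarrow> real"
  where "hamiltonian c0 x p = (1/2) * (1 / (c0 x)\<^sup>2 - (norm p)\<^sup>2)"

definition bicharacteristic ::
    "(real^3 \<Rightarrow> real) \<Rightarrow> real \<Rightarrow> (real \<Rightarrow> real^3) \<Rightarrow> (real \<Rightarrow> real^3) \<Rightarrow> bool"
  where "bicharacteristic c0 L X P \<longleftrightarrow>
    0 < L \<and>
    (\<forall>l\<in>{0..L}.
       X l \<in> half_space \<and> hamiltonian c0 (X l) (P l) = 0 \<and>
       (X has_vector_derivative gradient (\<lambda>p. hamiltonian c0 (X l) p) (P l)) (at l within {0..L}) \<and>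
       (P has_vector_derivative - gradient (\<lambda>x. hamiltonian c0 x (P l)) (X l)) (at l within {0..L}))"

definition travel_time :: "(real^3 \<Rightarrow> real) \<Rightarrow> real \<Rightarrow> (real \<Rightarrow> real^3) \<Rightarrow> real"
  where "travel_time c0 L X =
    integral {0..L} (\<lambda>l. norm (vector_derivative X (at l within {0..L})) / c0 (X l))"

text \<open>\<open>ray c0 (x,p) t (y,q)\<close>: a bicharacteristic leads from \<open>(x,p)\<close> to \<open>(y,q)\<close> in travel time \<open>t\<close>.
  Since \<open>dX/dl = \<partial>H/\<partial>p = -P\<close>, the covector \<open>p\<close> is minus the slowness vector: the ray leaves \<open>x\<close> in the
  direction \<open>-c\<^sub>0(x) p\<close>.\<close>

definition ray :: "(real^3 \<Rightarrow> real) \<Rightarrow> (real^3) \<times> (real^3) \<Rightarrow> real \<Rightarrow> (real^3) \<times> (real^3) \<Rightarrow> bool"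
  where "ray c0 a t b \<longleftrightarrow>
    (\<exists>L X P. bicharacteristic c0 L X P \<and> (X 0, P 0) = a \<and> (X L, P L) = b \<and> t = travel_time c0 L X)"

definition no_ray_grazes_surface :: "(real^3 \<Rightarrow> real) \<Rightarrow> bool"
  where "no_ray_grazes_surface c0 \<longleftrightarrow>
    (\<forall>x p t y q. x \<in> subsurface \<and> ray c0 (x,p) t (y,q) \<and> y $ 3 = 0 \<longrightarrow> q $ 3 \<noteq> 0)"

text \<open>Only single rays through the subsurface are excluded; for constant \<open>c\<^sub>0\<close>
  the straight rays inside the surface are harmless.\<close>

definition no_ray_connects ::
    "(real^3 \<Rightarrow> real) \<Rightarrow> (real \<times> real) set \<Rightarrow> (real \<times> real) set \<Rightarrow> bool"
  where "no_ray_connects c0 Src Rec \<longleftrightarrow>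
    \<not> (\<exists>s\<in>Src. \<exists>r\<in>Rec. \<exists>x\<in>subsurface. \<exists>p0 p q t t'.
         ray c0 (surface_point s, p0) t (x, p) \<and> ray c0 (x, p) t' (surface_point r, q))"


section \<open>The incident Lagrangian and the canonical relation\<close>

definition incident_Lagrangian :: "(real^3 \<Rightarrow> real) \<Rightarrow> real^3 \<Rightarrow> ((real^3) \<times> (real^3)) set"
  where "incident_Lagrangian c0 s = {b. \<exists>p0 t. ray c0 (s, p0) t b}"

text \<open>The suitable spatial coordinates \<open>x\<^sub>1,x\<^sub>2,x\<^sub>3\<close> are orthonormal coordinates, obtained from the
  original ones (in which the surface is \<open>{x\<^sub>3 = 0}\<close>) by an orthogonal matrix \<open>A\<close>; points and
  covectors then transform in the same way, and \<open>|p|\<close> is unchanged. This is the inverse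
  transformation.\<close>

definition original :: "real^3^3 \<Rightarrow> real^3 \<Rightarrow> real^3"
  where "original A x = transpose A *v x"

text \<open>Coordinates \<open>v = (x\<^sub>1,x\<^sub>2,s\<^sub>1,p\<^sub>3)\<close> of points of \<open>\<Lambda>\<close> for fixed \<open>s\<^sub>2\<close>, with \<open>s\<^sub>1\<close> as an extra variable.\<close>

definition source_point :: "real \<Rightarrow> real^4 \<Rightarrow> real \<times> real"
  where "source_point s2 v = (v $ 3, s2)"

definition base_point :: "(real^4 \<Rightarrow> real) \<Rightarrow> real^4 \<Rightarrow> real^3"
  where "base_point f v = vector [v $ 1, v $ 2, f v]"

definition incident_covector :: "(real^4 \<Rightarrow> real) \<Rightarrow> (real^4 \<Rightarrow> real) \<Rightarrow> real^4 \<Rightarrow> real^3"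
  where "incident_covector g1 g2 v = vector [g1 v, g2 v, v $ 4]"

definition incident_coordinates ::
    "(real^3 \<Rightarrow> real) \<Rightarrow> (real \<times> real) set \<Rightarrow> real \<Rightarrow> real^3^3 \<Rightarrow> (real^4) set \<Rightarrow>
     (real^4 \<Rightarrow> real) \<Rightarrow> (real^4 \<Rightarrow> real) \<Rightarrow> (real^4 \<Rightarrow> real) \<Rightarrow> bool"
  where "incident_coordinates c0 Src s2 A D f g1 g2 \<longleftrightarrow>
    open D \<and> smooth_on D f \<and> smooth_on D g1 \<and> smooth_on D g2 \<and>
    (\<forall>v\<in>D. source_point s2 v \<in> Src \<and> original A (base_point f v) \<in> subsurface \<and>
       (original A (base_point f v), original A (incident_covector g1 g2 v))
         \<in> incident_Lagrangian c0 (surface_point (source_point s2 v)))"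

text \<open>The travel time \<open>t_inc\<close> and the covector at the source of the incident ray
  (unique, by uniqueness of solutions of Hamilton's equations and absence of grazing).\<close>

definition incident_data ::
    "(real^3 \<Rightarrow> real) \<Rightarrow> real \<Rightarrow> real^3^3 \<Rightarrow> (real^4) set \<Rightarrow>
     (real^4 \<Rightarrow> real) \<Rightarrow> (real^4 \<Rightarrow> real) \<Rightarrow> (real^4 \<Rightarrow> real) \<Rightarrow>
     (real^4 \<Rightarrow> real) \<Rightarrow> (real^4 \<Rightarrow> real^3) \<Rightarrow> bool"
  where "incident_data c0 s2 A D f g1 g2 t_inc p0 \<longleftrightarrow>
    (\<forall>v\<in>D. ray c0 (surface_point (source_point s2 v), p0 v) (t_inc v)
              (original A (base_point f v), original A (incident_covector g1 g2 v)))"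

text \<open>Parameters \<open>u = (s\<^sub>1,x\<^sub>1,x\<^sub>2,p\<^sub>3,\<alpha>\<^sub>1,\<alpha>\<^sub>2,\<tau>)\<close> of the canonical relation; \<open>br = \<plusminus>1\<close> is the branch of the
  square root.\<close>

definition incident_part :: "real^7 \<Rightarrow> real^4"
  where "incident_part u = vector [u $ 2, u $ 3, u $ 1, u $ 4]"

definition takeoff :: "real \<Rightarrow> real^7 \<Rightarrow> real^3"
  where "takeoff br u = vector [u $ 5, u $ 6, br * sqrt (1 - ((u $ 5)\<^sup>2 + (u $ 6)\<^sup>2))]"

text \<open>The reflected ray from \<open>x\<close> in the direction \<open>takeoff br u\<close>: its arrival point \<open>(r1,r2,0)\<close>, its travel
  time, and its slowness vector \<open>q\<close> at the arrival point. Covectors along bicharacteristics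
  are minus the slowness, whence the signs.\<close>

definition reflected_data ::
    "(real^3 \<Rightarrow> real) \<Rightarrow> real^3^3 \<Rightarrow> real \<Rightarrow> (real^4 \<Rightarrow> real) \<Rightarrow> (real^7) set \<Rightarrow>
     (real^7 \<Rightarrow> real) \<Rightarrow> (real^7 \<Rightarrow> real) \<Rightarrow> (real^7 \<Rightarrow> real) \<Rightarrow> (real^7 \<Rightarrow> real^3) \<Rightarrow> bool"
  where "reflected_data c0 A br f U r1 r2 t_ref q \<longleftrightarrow>
    (\<forall>u\<in>U. let x = original A (base_point f (incident_part u)) in
       ray c0 (x, - (1 / c0 x) *\<^sub>R original A (takeoff br u)) (t_ref u)
              (surface_point (r1 u, r2 u), - q u))"

text \<open>Since the travel time from \<open>s\<close> to \<open>x\<close> to \<open>r\<close> has the derivatives \<open>p0\<close> in \<open>s\<close> (minus the initial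
  slowness) and \<open>q\<close> in \<open>r\<close> (the final slowness), the covariables dual to \<open>s\<^sub>1,r\<^sub>1,r\<^sub>2\<close>, for the
  phase \<open>\<tau> (t - t_inc - t_ref)\<close>, are \<open>\<sigma> = -\<tau> p0\<^sub>1\<close>, \<open>\<rho>\<^sub>j = -\<tau> q\<^sub>j\<close>. The left factor is
  \<open>(s\<^sub>1,r\<^sub>1,r\<^sub>2,t,\<sigma>,\<rho>\<^sub>1,\<rho>\<^sub>2,\<tau>)\<close>, the right one \<open>(x\<^sub>1,x\<^sub>2,x\<^sub>3,\<xi>\<^sub>1,\<xi>\<^sub>2,\<xi>\<^sub>3)\<close>.\<close>

definition canonical_left ::
    "(real^4 \<Rightarrow> real) \<Rightarrow> (real^4 \<Rightarrow> real^3) \<Rightarrow>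
     (real^7 \<Rightarrow> real) \<Rightarrow> (real^7 \<Rightarrow> real) \<Rightarrow> (real^7 \<Rightarrow> real) \<Rightarrow> (real^7 \<Rightarrow> real^3) \<Rightarrow> real^7 \<Rightarrow> real^8"
  where "canonical_left t_inc p0 r1 r2 t_ref q u =
    (let v = incident_part u; \<tau> = u $ 7 in
      vector [u $ 1, r1 u, r2 u, t_inc v + t_ref u, - \<tau> * p0 v $ 1, - \<tau> * q u $ 1, - \<tau> * q u $ 2, \<tau>])"

definition canonical_right ::
    "(real^3 \<Rightarrow> real) \<Rightarrow> real^3^3 \<Rightarrow> real \<Rightarrow>
     (real^4 \<Rightarrow> real) \<Rightarrow> (real^4 \<Rightarrow> real) \<Rightarrow> (real^4 \<Rightarrow> real) \<Rightarrow> real^7 \<Rightarrow> real^6"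
  where "canonical_right c0 A br f g1 g2 u =
    (let v = incident_part u; \<tau> = u $ 7; x = base_point f v; p = incident_covector g1 g2 v;
         \<xi> = - \<tau> *\<^sub>R ((1 / c0 (original A x)) *\<^sub>R takeoff br u + p)
     in vector [x $ 1, x $ 2, x $ 3, \<xi> $ 1, \<xi> $ 2, \<xi> $ 3])"

definition canonical_point ::
    "(real^3 \<Rightarrow> real) \<Rightarrow> real^3^3 \<Rightarrow> real \<Rightarrow>
     (real^4 \<Rightarrow> real) \<Rightarrow> (real^4 \<Rightarrow> real) \<Rightarrow> (real^4 \<Rightarrow> real) \<Rightarrow>
     (real^4 \<Rightarrow> real) \<Rightarrow> (real^4 \<Rightarrow> real^3) \<Rightarrow>
     (real^7 \<Rightarrow> real) \<Rightarrow> (real^7 \<Rightarrow> real) \<Rightarrow> (real^7 \<Rightarrow> real) \<Rightarrow> (real^7 \<Rightarrow> real^3) \<Rightarrow>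
     real^7 \<Rightarrow> (real^8) \<times> (real^6)"
  where "canonical_point c0 A br f g1 g2 t_inc p0 r1 r2 t_ref q u =
    (canonical_left t_inc p0 r1 r2 t_ref q u, canonical_right c0 A br f g1 g2 u)"

definition cotangent_data :: "(real \<times> real) set \<Rightarrow> (real \<times> real) set \<Rightarrow> real \<Rightarrow> real \<Rightarrow> (real^8) set"
  where \<comment> \<open>\<open>T\<^sup>*(\<Sigma> \<times> (0,T)) \<setminus> 0\<close>\<close>
    "cotangent_data Src Rec s2 T =
      {w. (w $ 1, s2) \<in> Src \<and> (w $ 2, w $ 3) \<in> Rec \<and> w $ 4 \<in> {0<..<T} \<and>
          (\<exists>i\<in>{5,6,7,8}. w $ i \<noteq> 0)}"

definition cotangent_space :: "real^3^3 \<Rightarrow> (real^6) set"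
  where \<comment> \<open>\<open>T\<^sup>*\<real>\<^sup>3\<^sub>+ \<setminus> 0\<close> in the coordinates given by \<open>A\<close>\<close>
    "cotangent_space A =
      {w. original A (vector [w $ 1, w $ 2, w $ 3]) \<in> subsurface \<and> (\<exists>i\<in>{4,5,6}. w $ i \<noteq> 0)}"

text \<open>\<open>U\<close> is an open set of admissible parameters. Its image under \<open>canonical_point\<close> is (a coordinate patch of)
  the canonical relation \<open>C\<close> for one pass of the vessel: \<open>s\<^sub>2\<close> is fixed, so that \<open>f\<close>, \<open>g1\<close>, \<open>g2\<close> depend on
  \<open>(x\<^sub>1,x\<^sub>2,s\<^sub>1,p\<^sub>3)\<close> only and \<open>(s\<^sub>1,r\<^sub>1,r\<^sub>2)\<close> are independent. As a canonical relation, \<open>C\<close> is a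
  smooth manifold, and the parametrization is smooth.\<close>

definition marine_parametrization ::
    "real \<Rightarrow> (real \<times> real) set \<Rightarrow> (real^4) set \<Rightarrow> (real^4 \<Rightarrow> real) \<Rightarrow>
     (real^7 \<Rightarrow> real) \<Rightarrow> (real^7 \<Rightarrow> real) \<Rightarrow> (real^7 \<Rightarrow> real) \<Rightarrow>
     (real^7) set \<Rightarrow> (real^7 \<Rightarrow> (real^8) \<times> (real^6)) \<Rightarrow> bool"
  where "marine_parametrization T Rec D t_inc r1 r2 t_ref U \<Gamma> \<longleftrightarrow>
    open U \<and> smooth_on U \<Gamma> \<and>
    (\<forall>u\<in>U. incident_part u \<in> D \<and> (u $ 5)\<^sup>2 + (u $ 6)\<^sup>2 < 1 \<and> u $ 7 \<noteq> 0 \<and>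
       (r1 u, r2 u) \<in> Rec \<and> t_inc (incident_part u) + t_ref u < T)"

end

(* Write f_s, f_p for the derivatives of f in s1 and p3. The right projection is (x1,x2,f,xi), and
   xi = -tau (w/c0 + p) is a local coordinate system in the directions (alpha, tau): its differential
   there is singular only if p = -w/c0, i.e. if the reflected ray continues the incident one. So
   the right projection inherits its fold structure from f, with critical set f_s = f_p = 0.

   No smooth dependence of rays on initial data is needed. Gronwall's inequality and transversal
   arrival give Lipschitz bounds and the first variation formula for the travel time, hence the
   equality of the canonical one-forms on both factors, and of the symplectic forms after
   differentiation. With these the kernel of the differential of the left projection is at most the
   p3-direction, and is nonzero exactly where f_s = f_p = 0. There, Hadamard's lemma writes the p3-column
   as f_s a + f_p b, and the symplectic form shows that a and b are independent modulo the other
   columns, so that the maximal minors generate the ideal (f_s, f_p). *)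

theory Submission
  imports Defs
begin

section \<open>Calculus of smooth maps\<close>

text \<open>The parametrization is assumed smooth, so the derivatives of both factors exist; the
  rays only have to tell which directions are stationary. Lipschitz bounds suffice for that: a
  differentiable map whose increments are dominated by those of another is stationary wherever the
  other is. The obstacle is the boundary. Rays are confined to the half space, so a reference ray
  cannot be prolonged beyond its arrival, perturbed rays have other parameter lengths, and the
  control of these lengths must come from the absence of grazing. Moreover the left factor records
  only tangential components of the covectors at the surface. At the receiver the missing component
  is recovered from the eikonal equation. At the source only the component dual to s1 is recorded,
  and there the symplectic form replaces an estimate: directions that change \<xi> while x stays
  fixed detect any motion of x. Finally, the fold hypothesis is given in unknown coordinates, so the
  nondegeneracy of the Hessian of f has to be extracted from an arbitrary normal form.\<close>

lemma differentiable_upto_cong: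
  assumes "open S" "\<And>x. x \<in> S \<Longrightarrow> f x = g x" "differentiable_upto k S f"
  shows "differentiable_upto k S g"
  using assms(2,3)
proof (induction k arbitrary: f g)
  case 0
  then show ?case by (simp cong: continuous_on_cong)
next
  case (Suc k)
  have g: "(g has_derivative frechet_derivative f (at x)) (at x)" if "x \<in> S" for x
  proof (rule has_derivative_transform_within_open[OF _ \<open>open S\<close> that Suc.prems(1)])
    show "(f has_derivative frechet_derivative f (at x)) (at x)"
      using Suc.prems(2) that by (simp add: frechet_derivative_works)
  qed
  then have eq: "frechet_derivative g (at x) = frechet_derivative f (at x)" if "x \<in> S" for x
    using frechet_derivative_at[OF g[OF that]] by simp
  show ?case
    using Suc.prems(2) g eq Suc.IH[of "\<lambda>x. frechet_derivative f (at x) v" "\<lambda>x. frechet_derivative g (at x) v" for v]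
    by (auto simp: differentiable_def)
qed

text \<open>\<open>frechet_derivative\<close> is defined by choice and awkward to compute with. On
  an open set any known derivative may stand in for it, so each closure property below amounts to
  naming the derivative and applying the induction hypothesis to it.\<close>

lemma differentiable_upto_SucI:
  assumes "open S" "\<And>x. x \<in> S \<Longrightarrow> (f has_derivative f' x) (at x)"
    and "\<And>v. differentiable_upto k S (\<lambda>x. f' x v)"
  shows "differentiable_upto (Suc k) S f"
proof -
  have "frechet_derivative f (at x) = f' x" if "x \<in> S" for x
    using frechet_derivative_at[OF assms(2)[OF that]] by simp
  then have "differentiable_upto k S (\<lambda>x. frechet_derivative f (at x) v)" for v
    by (intro differentiable_upto_cong[OF assms(1) _ assms(3)]) simp
  then show ?thesis
    using assms(2) by (auto simp: differentiable_def)
qed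

lemma differentiable_upto_SucD: "differentiable_upto (Suc k) S f \<Longrightarrow> differentiable_upto k S f"
proof (induction k arbitrary: f)
  case 0
  then show ?case
    by (auto simp: continuous_on_eq_continuous_within differentiable_imp_continuous_within
        intro: continuous_at_imp_continuous_at_within)
next
  case (Suc k)
  then show ?case by (metis differentiable_upto.simps(2))
qed

lemma differentiable_upto_subset:
  "differentiable_upto k S f \<Longrightarrow> T \<subseteq> S \<Longrightarrow> differentiable_upto k T f"
  by (induction k arbitrary: f) (auto intro: continuous_on_subset)

lemma differentiable_upto_has_derivative:
  "differentiable_upto (Suc k) S f \<Longrightarrow> x \<in> S \<Longrightarrow> (f has_derivative frechet_derivative f (at x)) (at x)"
  by (auto simp: frechet_derivative_works)

lemma differentiable_upto_const: "open S \<Longrightarrow> differentiable_upto k S (\<lambda>x. c)"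
  by (induction k arbitrary: c) (auto intro!: differentiable_upto_SucI[where f' = "\<lambda>x v. 0"] simp del: differentiable_upto.simps(2))

lemma differentiable_upto_bounded_linear:
  assumes "open S" "bounded_linear h" "differentiable_upto k S f"
  shows "differentiable_upto k S (\<lambda>x. h (f x))"
  using assms(3)
proof (induction k arbitrary: f)
  case 0
  then show ?case using assms(2) by (simp add: bounded_linear.continuous_on)
next
  case (Suc k)
  show ?case
    using Suc.prems Suc.IH
    by (intro differentiable_upto_SucI[where f' = "\<lambda>x v. h (frechet_derivative f (at x) v)"] assms(1)
        bounded_linear.has_derivative[OF assms(2)] differentiable_upto_has_derivative[OF Suc.prems]) auto
qed

lemma differentiable_upto_id: "open S \<Longrightarrow> differentiable_upto k S (\<lambda>x. x)"
  by (cases k) (auto intro!: differentiable_upto_SucI[where f' = "\<lambda>x v. v"] differentiable_upto_const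
      simp del: differentiable_upto.simps(2))

lemma differentiable_upto_add:
  assumes "open S" "differentiable_upto k S f" "differentiable_upto k S g"
  shows "differentiable_upto k S (\<lambda>x. f x + g x)"
  using assms(2,3)
proof (induction k arbitrary: f g)
  case 0
  then show ?case by (simp add: continuous_on_add)
next
  case (Suc k)
  show ?case
    using Suc.prems Suc.IH
    by (intro differentiable_upto_SucI[where f' = "\<lambda>x v. frechet_derivative f (at x) v + frechet_derivative g (at x) v"]
        assms(1) has_derivative_add differentiable_upto_has_derivative[OF Suc.prems(1)]
        differentiable_upto_has_derivative[OF Suc.prems(2)]) auto
qed

lemma differentiable_upto_sum:
  assumes "open S" "\<And>i. i \<in> I \<Longrightarrow> differentiable_upto k S (f i)"
  shows "differentiable_upto k S (\<lambda>x. \<Sum>i\<in>I. f i x)"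
  using assms(2)
  by (induction I rule: infinite_finite_induct)
     (auto intro: differentiable_upto_add differentiable_upto_const assms(1))

lemma differentiable_upto_scaleR:
  fixes f :: "'a::real_normed_vector \<Rightarrow> real"
  assumes "open S" "differentiable_upto k S f" "differentiable_upto k S g"
  shows "differentiable_upto k S (\<lambda>x. f x *\<^sub>R g x)"
  using assms(2,3)
proof (induction k arbitrary: f g)
  case 0
  then show ?case by (simp add: continuous_on_scaleR)
next
  case (Suc k)
  have *: "differentiable_upto k S (\<lambda>x. f x *\<^sub>R frechet_derivative g (at x) v + frechet_derivative f (at x) v *\<^sub>R g x)" for v
    using Suc.prems by (intro differentiable_upto_add assms(1) Suc.IH) (auto intro: differentiable_upto_SucD)
  show ?case
    using *
    by (intro differentiable_upto_SucI[where f' = "\<lambda>x v. f x *\<^sub>R frechet_derivative g (at x) v + frechet_derivative f (at x) v *\<^sub>R g x"]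
        assms(1) has_derivative_scaleR differentiable_upto_has_derivative[OF Suc.prems(1)]
        differentiable_upto_has_derivative[OF Suc.prems(2)])
qed

lemma differentiable_upto_mult:
  fixes f g :: "'a::real_normed_vector \<Rightarrow> real"
  assumes "open S" "differentiable_upto k S f" "differentiable_upto k S g"
  shows "differentiable_upto k S (\<lambda>x. f x * g x)"
  using differentiable_upto_scaleR[OF assms] by simp

lemma differentiable_upto_prod:
  fixes f :: "'i \<Rightarrow> 'a::real_normed_vector \<Rightarrow> real"
  assumes "open S" "\<And>i. i \<in> I \<Longrightarrow> differentiable_upto k S (f i)"
  shows "differentiable_upto k S (\<lambda>x. \<Prod>i\<in>I. f i x)"
  using assms(2)
  by (induction I rule: infinite_finite_induct)
     (auto intro: differentiable_upto_mult differentiable_upto_const assms(1))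

text \<open>The derivative of the reciprocal contains the reciprocal again, but with one order less
  to prove, which is what the induction provides.\<close>

lemma differentiable_upto_inverse:
  fixes f :: "'a::real_normed_vector \<Rightarrow> real"
  assumes "open S" "differentiable_upto k S f" "\<And>x. x \<in> S \<Longrightarrow> f x \<noteq> 0"
  shows "differentiable_upto k S (\<lambda>x. inverse (f x))"
  using assms(2)
proof (induction k)
  case 0
  then show ?case using assms(3) by (auto intro: continuous_on_inverse)
next
  case (Suc k)
  have i: "differentiable_upto k S (\<lambda>x. inverse (f x))"
    using Suc.prems Suc.IH differentiable_upto_SucD by blast
  have *: "differentiable_upto k S (\<lambda>x. - (inverse (f x) * frechet_derivative f (at x) v * inverse (f x)))" for v
    using Suc.prems
    by (intro differentiable_upto_bounded_linear[OF assms(1) bounded_linear_minus[OF bounded_linear_ident]]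
       differentiable_upto_mult i assms(1)) auto
  show ?case
    using *
    by (intro differentiable_upto_SucI[where f' = "\<lambda>x v. - (inverse (f x) * frechet_derivative f (at x) v * inverse (f x))"]
        assms(1) Deriv.has_derivative_inverse assms(3) differentiable_upto_has_derivative[OF Suc.prems])
qed

lemma differentiable_upto_compose:
  fixes f :: "'a::real_normed_vector \<Rightarrow> 'b::euclidean_space"
  assumes "open S" "open T" "f ` S \<subseteq> T" "differentiable_upto k S f" "differentiable_upto k T g"
  shows "differentiable_upto k S (\<lambda>x. g (f x))"
  using assms(4,5)
proof (induction k arbitrary: g)
  case 0
  then show ?case using continuous_on_compose2[of T g S f] assms(3) by auto
next
  case (Suc k)
  let ?g' = "\<lambda>x v. frechet_derivative g (at (f x)) (frechet_derivative f (at x) v)"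
  have f: "(f has_derivative frechet_derivative f (at x)) (at x)"
    and g: "(g has_derivative frechet_derivative g (at (f x))) (at (f x))" if "x \<in> S" for x
    using that assms(3) differentiable_upto_has_derivative[OF Suc.prems(1)]
      differentiable_upto_has_derivative[OF Suc.prems(2)] by blast+
  \<comment> \<open>The induction hypothesis covers the derivative of g in a fixed direction,
    whereas the chain rule applies it to a direction that moves with x. Expansion in a basis of the
    Euclidean middle space separates the two dependences.\<close>
  have 1: "differentiable_upto k S (\<lambda>x. \<Sum>b\<in>Basis. (frechet_derivative f (at x) v \<bullet> b) *\<^sub>R frechet_derivative g (at (f x)) b)" for v
    using Suc.prems
    by (intro differentiable_upto_sum differentiable_upto_scaleR assms(1) Suc.IH
        differentiable_upto_bounded_linear[OF assms(1) bounded_linear_inner_left])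
      (auto intro: differentiable_upto_SucD)
  have 2: "(\<Sum>b\<in>Basis. (frechet_derivative f (at x) v \<bullet> b) *\<^sub>R frechet_derivative g (at (f x)) b) = ?g' x v"
    if "x \<in> S" for x v
  proof -
    have l: "linear (frechet_derivative g (at (f x)))"
      using g[OF that] has_derivative_linear by blast
    have "?g' x v = frechet_derivative g (at (f x)) (\<Sum>b\<in>Basis. (frechet_derivative f (at x) v \<bullet> b) *\<^sub>R b)"
      by (simp add: euclidean_representation)
    then show ?thesis by (simp add: linear_sum[OF l] linear_cmul[OF l])
  qed
  have "differentiable_upto k S (\<lambda>x. ?g' x v)" for v
    using differentiable_upto_cong[OF assms(1) 2 1] .
  then show ?case
    using f g by (intro differentiable_upto_SucI[where f' = ?g'] assms(1)) (auto intro: has_derivative_compose)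
qed

section \<open>Smooth maps: operations, components, determinants\<close>

lemma smooth_on_cong:
  "open S \<Longrightarrow> (\<And>x. x \<in> S \<Longrightarrow> f x = g x) \<Longrightarrow> smooth_on S f \<Longrightarrow> smooth_on S g"
  unfolding smooth_on_def using differentiable_upto_cong by blast

lemma smooth_on_subset: "smooth_on S f \<Longrightarrow> T \<subseteq> S \<Longrightarrow> smooth_on T f"
  unfolding smooth_on_def using differentiable_upto_subset by blast

lemma smooth_on_has_derivative:
  "smooth_on S f \<Longrightarrow> x \<in> S \<Longrightarrow> (f has_derivative frechet_derivative f (at x)) (at x)"
  unfolding smooth_on_def using differentiable_upto_has_derivative by blast

lemma smooth_on_differentiable: "smooth_on S f \<Longrightarrow> x \<in> S \<Longrightarrow> f differentiable (at x)"
  using smooth_on_has_derivative by (auto simp: differentiable_def)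

lemma smooth_on_frechet_derivative: "smooth_on S f \<Longrightarrow> smooth_on S (\<lambda>x. frechet_derivative f (at x) v)"
  unfolding smooth_on_def by (metis differentiable_upto.simps(2))

lemma smooth_on_partial_deriv: "smooth_on S f \<Longrightarrow> smooth_on S (partial_deriv i f)"
  unfolding partial_deriv_def[abs_def] by (rule smooth_on_frechet_derivative)

lemma smooth_on_continuous_on: "smooth_on S f \<Longrightarrow> continuous_on S f"
  unfolding smooth_on_def by (metis differentiable_upto.simps(1))

lemma smooth_on_const: "open S \<Longrightarrow> smooth_on S (\<lambda>x. c)"
  unfolding smooth_on_def using differentiable_upto_const by blast

lemma smooth_on_id: "open S \<Longrightarrow> smooth_on S (\<lambda>x. x)"
  unfolding smooth_on_def using differentiable_upto_id by blast

lemma smooth_on_bounded_linear: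
  "open S \<Longrightarrow> bounded_linear h \<Longrightarrow> smooth_on S f \<Longrightarrow> smooth_on S (\<lambda>x. h (f x))"
  unfolding smooth_on_def using differentiable_upto_bounded_linear by blast

lemma smooth_on_add: "open S \<Longrightarrow> smooth_on S f \<Longrightarrow> smooth_on S g \<Longrightarrow> smooth_on S (\<lambda>x. f x + g x)"
  unfolding smooth_on_def using differentiable_upto_add by blast

lemma smooth_on_minus: "open S \<Longrightarrow> smooth_on S f \<Longrightarrow> smooth_on S (\<lambda>x. - f x)"
  by (rule smooth_on_bounded_linear[OF _ bounded_linear_minus[OF bounded_linear_ident]])

lemma smooth_on_diff: "open S \<Longrightarrow> smooth_on S f \<Longrightarrow> smooth_on S g \<Longrightarrow> smooth_on S (\<lambda>x. f x - g x)"
  using smooth_on_add[OF _ _ smooth_on_minus, of S f g] by simp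

lemma smooth_on_sum:
  "open S \<Longrightarrow> (\<And>i. i \<in> I \<Longrightarrow> smooth_on S (f i)) \<Longrightarrow> smooth_on S (\<lambda>x. \<Sum>i\<in>I. f i x)"
  by (simp add: smooth_on_def differentiable_upto_sum)

lemma smooth_on_mult:
  fixes f :: "'a::real_normed_vector \<Rightarrow> real"
  shows "open S \<Longrightarrow> smooth_on S f \<Longrightarrow> smooth_on S g \<Longrightarrow> smooth_on S (\<lambda>x. f x * g x)"
  unfolding smooth_on_def using differentiable_upto_mult by blast

lemma smooth_on_inverse:
  fixes f :: "'a::real_normed_vector \<Rightarrow> real"
  shows "open S \<Longrightarrow> smooth_on S f \<Longrightarrow> (\<And>x. x \<in> S \<Longrightarrow> f x \<noteq> 0) \<Longrightarrow> smooth_on S (\<lambda>x. inverse (f x))"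
  by (simp add: smooth_on_def differentiable_upto_inverse)

lemma smooth_on_divide:
  fixes f :: "'a::real_normed_vector \<Rightarrow> real"
  shows "open S \<Longrightarrow> smooth_on S f \<Longrightarrow> smooth_on S g \<Longrightarrow> (\<And>x. x \<in> S \<Longrightarrow> g x \<noteq> 0) \<Longrightarrow> smooth_on S (\<lambda>x. f x / g x)"
  unfolding divide_inverse by (intro smooth_on_mult smooth_on_inverse)

lemma smooth_on_compose:
  fixes f :: "'a::real_normed_vector \<Rightarrow> 'b::euclidean_space"
  shows "open S \<Longrightarrow> open T \<Longrightarrow> f ` S \<subseteq> T \<Longrightarrow> smooth_on S f \<Longrightarrow> smooth_on T g \<Longrightarrow> smooth_on S (\<lambda>x. g (f x))"
  unfolding smooth_on_def using differentiable_upto_compose by blast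

lemma differentiable_upto_vecI:
  fixes f :: "'a::real_normed_vector \<Rightarrow> real^'n::finite"
  assumes "open S" "\<And>i. differentiable_upto k S (\<lambda>x. f x $ i)"
  shows "differentiable_upto k S f"
proof -
  have "differentiable_upto k S (\<lambda>x. \<Sum>i\<in>UNIV. (f x $ i) *\<^sub>R axis i (1::real))"
    by (intro differentiable_upto_sum differentiable_upto_scaleR differentiable_upto_const assms)
  moreover have "(\<Sum>i\<in>UNIV. (f x $ i) *\<^sub>R axis i (1::real)) = f x" for x
    by (simp add: vec_eq_iff axis_def if_distrib cong: if_cong)
  ultimately show ?thesis by simp
qed

lemma smooth_on_vecI:
  fixes f :: "'a::real_normed_vector \<Rightarrow> real^'n::finite"
  shows "open S \<Longrightarrow> (\<And>i. smooth_on S (\<lambda>x. f x $ i)) \<Longrightarrow> smooth_on S f"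
  unfolding smooth_on_def using differentiable_upto_vecI by blast

lemma smooth_on_vec_nth:
  fixes f :: "'a::real_normed_vector \<Rightarrow> real^'n::finite"
  shows "open S \<Longrightarrow> smooth_on S f \<Longrightarrow> smooth_on S (\<lambda>x. f x $ i)"
  by (rule smooth_on_bounded_linear[OF _ bounded_linear_vec_nth])

lemma differentiable_upto_det:
  fixes M :: "'a::real_normed_vector \<Rightarrow> real^'n^'n::finite"
  assumes "open S" "\<And>i j. differentiable_upto k S (\<lambda>x. M x $ i $ j)"
  shows "differentiable_upto k S (\<lambda>x. det (M x))"
  unfolding det_def
  by (intro differentiable_upto_sum differentiable_upto_mult differentiable_upto_prod differentiable_upto_const assms)

lemma smooth_on_det:
  fixes M :: "'a::real_normed_vector \<Rightarrow> real^'n^'n::finite"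
  shows "open S \<Longrightarrow> (\<And>i j. smooth_on S (\<lambda>x. M x $ i $ j)) \<Longrightarrow> smooth_on S (\<lambda>x. det (M x))"
  unfolding smooth_on_def using differentiable_upto_det by blast

lemma frechet_derivative_vec_nth:
  fixes f :: "'a::real_normed_vector \<Rightarrow> real^'n::finite"
  assumes "f differentiable (at x)"
  shows "frechet_derivative (\<lambda>y. f y $ i) (at x) w = frechet_derivative f (at x) w $ i"
proof -
  have "((\<lambda>y. f y $ i) has_derivative (\<lambda>w. frechet_derivative f (at x) w $ i)) (at x)"
    using assms bounded_linear.has_derivative[OF bounded_linear_vec_nth] frechet_derivative_works by blast
  then show ?thesis by (simp add: frechet_derivative_at[symmetric])
qed

lemma jacobian_nth:
  fixes f :: "real^'n::finite \<Rightarrow> real^'m::finite"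
  shows "jacobian f (at x) $ i $ j = frechet_derivative f (at x) (axis j 1) $ i"
  by (simp add: jacobian_def matrix_def)

subsection \<open>The inverse function theorem\<close>

text \<open>The inverse function theorem gives a differentiable local inverse \<open>G\<close>,
  continuous because it is part of a homeomorphism. Its derivative at y inverts the matrix
  \<open>M y\<close>, and by Cramer's rule is a quotient of determinants in the derivatives of g at
  \<open>G y\<close>. Hence each order of differentiability of \<open>G\<close> yields the
  next.\<close>

lemma local_coordinates_inverse_function:
  fixes g :: "real^'n::finite \<Rightarrow> real^'n"
  assumes U: "open U" "smooth_on U g" "x0 \<in> U"
    and inj: "\<And>w. frechet_derivative g (at x0) w = 0 \<Longrightarrow> w = 0"
  shows "\<exists>O'. x0 \<in> O' \<and> O' \<subseteq> U \<and> local_coordinates O' g"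
proof -
  define g' where "g' x = Blinfun (frechet_derivative g (at x))" for x
  have D: "(g has_derivative frechet_derivative g (at x)) (at x)" if "x \<in> U" for x
    using that U smooth_on_has_derivative by blast
  then have g': "blinfun_apply (g' x) = frechet_derivative g (at x)" if "x \<in> U" for x
    using has_derivative_bounded_linear[OF D[OF that]] by (simp add: g'_def bounded_linear_Blinfun_apply)
  have cont: "continuous_on U g'"
  proof (rule continuous_on_blinfun_componentwise)
    show "continuous_on U (\<lambda>x. g' x i)" for i
      using smooth_on_continuous_on[OF smooth_on_frechet_derivative[OF U(2), of i]]
      by (simp add: g' cong: continuous_on_cong)
  qed
  have lin: "linear (frechet_derivative g (at x0))"
    using D U has_derivative_linear by blast
  then obtain h where h: "linear h" "h \<circ> frechet_derivative g (at x0) = id"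
    using linear_injective_left_inverse linear_injective_0 inj by metis
  have "Blinfun h o\<^sub>L g' x0 = id_blinfun"
    using h U by (intro blinfun_eqI) (simp add: g' bounded_linear_Blinfun_apply linear_linear pointfree_idE)
  then obtain U' V G G' where *: "open U'" "U' \<subseteq> U" "x0 \<in> U'" "open V" "homeomorphism U' V g G"
    and G: "\<And>y. y \<in> V \<Longrightarrow> (G has_derivative (G' y)) (at y)"
    and G': "\<And>y. y \<in> V \<Longrightarrow> G' y = inv (blinfun_apply (g' (G y)))"
      "\<And>y. y \<in> V \<Longrightarrow> bij (blinfun_apply (g' (G y)))"
    using inverse_function_theorem[OF U(1) _ cont U(3), of g "Blinfun h"] D g' by metis
  have GU: "G y \<in> U" if "y \<in> V" for y
    using * that by (auto simp: homeomorphism_def)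
  define M where "M y = (\<chi> i j. frechet_derivative g (at (G y)) (axis j 1) $ i)" for y
  have M: "M y *v w = frechet_derivative g (at (G y)) w" if "y \<in> V" for y w
  proof -
    have "M y = matrix (frechet_derivative g (at (G y)))"
      by (simp add: M_def matrix_def)
    then show ?thesis
      using has_derivative_linear[OF D[OF GU[OF that]]] by simp
  qed
  have inv: "G' y v = (\<chi> k. det (\<chi> i j. if j = k then v $ i else M y $ i $ j) / det (M y))"
    and det: "det (M y) \<noteq> 0" if "y \<in> V" for y v
  proof -
    have bij: "bij (frechet_derivative g (at (G y)))"
      using G'(2)[OF that] g'[OF GU[OF that]] by simp
    then have "inj ((*v) (M y))"
      using M[OF that] by (simp add: bij_def inj_on_def)
    then show det: "det (M y) \<noteq> 0"
      by (simp add: invertible_det_nz[symmetric] invertible_left_inverse matrix_left_invertible_injective)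
    have "M y *v G' y v = v"
      using bij G'(1)[OF that] g'[OF GU[OF that]] M[OF that] by (simp add: bij_is_surj surj_f_inv_f)
    then show "G' y v = (\<chi> k. det (\<chi> i j. if j = k then v $ i else M y $ i $ j) / det (M y))"
      using cramer[OF det] by auto
  qed
  have "differentiable_upto k V G" for k
  proof (induction k)
    case 0
    then show ?case using * by (auto simp: homeomorphism_def)
  next
    case (Suc k)
    have Mij: "differentiable_upto k V (\<lambda>y. M y $ i $ j)" for i j
    proof -
      have "differentiable_upto k U (\<lambda>x. frechet_derivative g (at x) (axis j 1) $ i)"
        using smooth_on_vec_nth[OF U(1) smooth_on_frechet_derivative[OF U(2)]] by (auto simp: smooth_on_def)
      from differentiable_upto_compose[OF *(4) U(1) _ Suc this]
      show ?thesis using GU by (auto simp: M_def)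
    qed
    have "differentiable_upto k V (\<lambda>y. \<chi> k. det (\<chi> i j. if j = k then v $ i else M y $ i $ j) / det (M y))" for v
    proof (rule differentiable_upto_vecI[OF *(4)])
      fix l
      have 1: "differentiable_upto k V (\<lambda>y. (\<chi> i j. if j = l then v $ i else M y $ i $ j) $ a $ b)" for a b
        by (cases "b = l") (auto simp: Mij differentiable_upto_const[OF *(4)])
      show "differentiable_upto k V (\<lambda>y. (\<chi> k. det (\<chi> i j. if j = k then v $ i else M y $ i $ j) / det (M y)) $ l)"
        unfolding divide_inverse vec_lambda_beta
        by (intro differentiable_upto_mult differentiable_upto_inverse differentiable_upto_det *(4) 1 det Mij)
    qed
    then have G'k: "differentiable_upto k V (\<lambda>y. G' y v)" for v
      by (rule differentiable_upto_cong[OF *(4), rotated]) (simp add: inv)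
    show ?case
      by (rule differentiable_upto_SucI[OF *(4) G G'k])
  qed
  then have "smooth_on V G" by (simp add: smooth_on_def)
  moreover have V: "g ` U' = V" and inj: "inj_on g U'"
    using * by (auto simp: homeomorphism_def intro: inj_on_inverseI)
  moreover have "inv_into U' g y = G y" if "y \<in> V" for y
    using * that inj by (auto simp: homeomorphism_def intro!: inv_into_f_eq)
  ultimately have "local_coordinates U' g"
    unfolding local_coordinates_def
    using * smooth_on_subset[OF U(2) *(2)] smooth_on_cong[OF *(4), of G "inv_into U' g"] by simp
  then show ?thesis using * by blast
qed

subsection \<open>Symmetry of second derivatives\<close>

lemma mean_value_directional:
  fixes g :: "'a::real_normed_vector \<Rightarrow> real"
  assumes "0 < h" "\<And>s. s \<in> {0..h} \<Longrightarrow> (g has_derivative g' (x + s *\<^sub>R v)) (at (x + s *\<^sub>R v))"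
  shows "\<exists>s\<in>{0<..<h}. g (x + h *\<^sub>R v) - g x = h * g' (x + s *\<^sub>R v) v"
proof -
  have d: "((\<lambda>s. g (x + s *\<^sub>R v)) has_derivative (\<lambda>r. g' (x + s *\<^sub>R v) (r *\<^sub>R v))) (at s within {0..h})"
    if "s \<in> {0..h}" for s
    by (rule has_derivative_compose[where f = "\<lambda>s. x + s *\<^sub>R v", OF _ assms(2)[OF that]])
       (auto intro!: derivative_eq_intros)
  have "g' (x + s *\<^sub>R v) (h *\<^sub>R v) = h * g' (x + s *\<^sub>R v) v" if "s \<in> {0..h}" for s
    using linear_cmul[OF has_derivative_linear[OF assms(2)[OF that]]] by simp
  then show ?thesis
    using mvt_simple[OF assms(1), of "\<lambda>s. g (x + s *\<^sub>R v)" "\<lambda>s r. g' (x + s *\<^sub>R v) (r *\<^sub>R v)"] d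
    by fastforce
qed

text \<open>The second difference of f over a small parallelogram is symmetric in its two sides. Two
  applications of the mean value theorem express it by either mixed derivative at some nearby point,
  and continuity of both finishes the argument.\<close>

lemma second_derivative_symmetric:
  fixes f :: "'a::real_normed_vector \<Rightarrow> real"
  assumes S: "open S" "x \<in> S" and f: "smooth_on S f"
  shows "frechet_derivative (\<lambda>y. frechet_derivative f (at y) v) (at x) w
       = frechet_derivative (\<lambda>y. frechet_derivative f (at y) w) (at x) v"
proof -
  define D where "D a y = frechet_derivative f (at y) a" for a y
  define H where "H a b y = frechet_derivative (D a) (at y) b" for a b y
  have sD: "smooth_on S (D a)" for a
    unfolding D_def by (rule smooth_on_frechet_derivative[OF f])
  have dD: "(D a has_derivative (\<lambda>b. H a b y)) (at y)" if "y \<in> S" for a y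
    using smooth_on_has_derivative[OF sD that] by (simp add: H_def)
  have df: "(f has_derivative (\<lambda>a. D a y)) (at y)" if "y \<in> S" for y
    using smooth_on_has_derivative[OF f that] by (simp add: D_def)
  have cH: "isCont (H a b) x" for a b
    using smooth_on_continuous_on[OF smooth_on_frechet_derivative[OF sD[of a], of b]] S
    by (simp add: H_def[abs_def] continuous_on_eq_continuous_at)
  obtain r where r: "0 < r" "ball x r \<subseteq> S"
    using S open_contains_ball by blast
  \<comment> \<open>The summand 1 keeps \<open>M\<close> positive even if v = w = 0. The
    parallelogram with sides h v and h w lies within distance 2 M h of x.\<close>
  define M where "M = norm v + norm w + 1"
  have M: "M > 0" by (simp add: M_def add_nonneg_pos)
  have near: "x + s *\<^sub>R a + t *\<^sub>R b \<in> ball x \<delta>"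
    if "0 \<le> s" "s \<le> \<delta> / (2 * M)" "0 \<le> t" "t \<le> \<delta> / (2 * M)" "a = v \<and> b = w \<or> a = w \<and> b = v" "0 < \<delta>" for s t a b \<delta>
  proof -
    have "norm (s *\<^sub>R a + t *\<^sub>R b) \<le> s * norm a + t * norm b"
      using norm_triangle_ineq[of "s *\<^sub>R a" "t *\<^sub>R b"] that by simp
    also have "\<dots> \<le> \<delta> / (2 * M) * norm a + \<delta> / (2 * M) * norm b"
      using that by (intro add_mono mult_right_mono) auto
    also have "\<dots> = \<delta> / (2 * M) * (M - 1)"
      using that(5) by (auto simp: M_def algebra_simps add_divide_distrib)
    also have "\<dots> < \<delta>"
      using M that(6) by (simp add: field_simps add_pos_pos)
    finally show ?thesis by (simp add: dist_norm norm_minus_commute add_ac)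
  qed
  have double: "\<exists>z \<in> ball x (2 * M * h). f (x + h *\<^sub>R a + h *\<^sub>R b) - f (x + h *\<^sub>R a) - f (x + h *\<^sub>R b) + f x = h * h * H b a z"
    if h: "0 < h" "2 * M * h < r" and ab: "a = v \<and> b = w \<or> a = w \<and> b = v" for h a b
  proof -
    have in_ball: "x + s *\<^sub>R a + t *\<^sub>R b \<in> ball x (2 * M * h)" if "0 \<le> s" "s \<le> h" "0 \<le> t" "t \<le> h" for s t
      using near[of s "2 * M * h" t a b] that h M ab by simp
    then have in_S: "x + s *\<^sub>R a + t *\<^sub>R b \<in> S" if "0 \<le> s" "s \<le> h" "0 \<le> t" "t \<le> h" for s t
      using that h r by (force simp: subset_eq)
    \<comment> \<open>The increment in direction a is first treated by the mean value theorem in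
      direction b, and the resulting increment of \<open>D b\<close> then by the same theorem in
      direction a; this fixes which mixed derivative appears.\<close>
    define k where "k y = f (y + h *\<^sub>R a) - f y" for y
    have dk: "(k has_derivative (\<lambda>c. D c (x + t *\<^sub>R b + h *\<^sub>R a) - D c (x + t *\<^sub>R b))) (at (x + t *\<^sub>R b))"
      if "t \<in> {0..h}" for t
      unfolding k_def
      using in_S[of h t] in_S[of 0 t] that h
      by (auto intro!: derivative_eq_intros has_derivative_compose[where f = "\<lambda>y. y + h *\<^sub>R a", OF _ df] df simp: algebra_simps)
    obtain t where t: "t \<in> {0<..<h}" "k (x + h *\<^sub>R b) - k x = h * (D b (x + t *\<^sub>R b + h *\<^sub>R a) - D b (x + t *\<^sub>R b))"
      using mean_value_directional[OF h(1), of k "\<lambda>y c. D c (y + h *\<^sub>R a) - D c y" x b] dk by blast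
    have "\<exists>s\<in>{0<..<h}. D b ((x + t *\<^sub>R b) + h *\<^sub>R a) - D b (x + t *\<^sub>R b) = h * H b a ((x + t *\<^sub>R b) + s *\<^sub>R a)"
      using t in_S by (intro mean_value_directional[OF h(1), of "D b" "\<lambda>y c. H b c y"] dD) (auto simp: algebra_simps)
    then obtain s where s: "s \<in> {0<..<h}" "D b ((x + t *\<^sub>R b) + h *\<^sub>R a) - D b (x + t *\<^sub>R b) = h * H b a ((x + t *\<^sub>R b) + s *\<^sub>R a)"
      by blast
    show ?thesis
      using s t in_ball[of s t] by (intro bexI[of _ "x + s *\<^sub>R a + t *\<^sub>R b"]) (auto simp: k_def algebra_simps)
  qed
  have "\<bar>H v w x - H w v x\<bar> \<le> e" if e: "0 < e" for e
  proof -
    have "0 < e / 2" using e by simp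
    then obtain d1 d2 where d: "0 < d1" "\<And>z. dist z x < d1 \<Longrightarrow> dist (H v w z) (H v w x) < e / 2"
      "0 < d2" "\<And>z. dist z x < d2 \<Longrightarrow> dist (H w v z) (H w v x) < e / 2"
      using cH[of v w] cH[of w v] unfolding continuous_at_eps_delta by metis
    define h where "h = min r (min d1 d2) / (4 * M)"
    have h: "0 < h" "2 * M * h < r" "2 * M * h \<le> d1" "2 * M * h \<le> d2"
      using d r M by (auto simp: h_def min_def field_simps)
    obtain z1 where z1: "z1 \<in> ball x (2 * M * h)" "f (x + h *\<^sub>R w + h *\<^sub>R v) - f (x + h *\<^sub>R w) - f (x + h *\<^sub>R v) + f x = h * h * H v w z1"
      using double[OF h(1,2), of w v] by auto
    obtain z2 where z2: "z2 \<in> ball x (2 * M * h)" "f (x + h *\<^sub>R v + h *\<^sub>R w) - f (x + h *\<^sub>R v) - f (x + h *\<^sub>R w) + f x = h * h * H w v z2"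
      using double[OF h(1,2), of v w] by auto
    have "h * h * H v w z1 = h * h * H w v z2"
      using z1(2) z2(2) unfolding add.assoc[of x] add.commute[of "h *\<^sub>R w"] by linarith
    then have "H v w z1 = H w v z2" using h(1) by simp
    moreover have "dist (H v w z1) (H v w x) < e / 2" "dist (H w v z2) (H w v x) < e / 2"
      using z1(1) z2(1) h(3,4) by (intro d; simp add: dist_commute[of _ x])+
    ultimately show ?thesis unfolding dist_real_def by linarith
  qed
  then have "H v w x = H w v x"
    using field_le_epsilon[of "\<bar>H v w x - H w v x\<bar>" 0] by simp
  then show ?thesis by (simp add: H_def D_def[abs_def])
qed

subsection \<open>Hadamard's lemma\<close>

text \<open>The weight t^m closes the induction: the derivative of the point on the segment in
  direction v is \<pi> v + t (v - \<pi> v), so differentiation produces one integral with the same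
  weight and one with an additional factor t.\<close>

lemma differentiable_upto_segment_integral:
  fixes g :: "real^'n::finite \<Rightarrow> real" and \<pi> :: "real^'n \<Rightarrow> real^'n"
  assumes B: "open B" "convex B" and \<pi>: "linear \<pi>"
    and segB: "\<And>z t. z \<in> B \<Longrightarrow> t \<in> {0..1} \<Longrightarrow> \<pi> z + t *\<^sub>R (z - \<pi> z) \<in> B"
    and "smooth_on B g"
  shows "differentiable_upto k B (\<lambda>z. integral {0..1} (\<lambda>t. t ^ m * g (\<pi> z + t *\<^sub>R (z - \<pi> z))))"
  using \<open>smooth_on B g\<close>
proof (induction k arbitrary: g m)
  case 0
  have cont\<pi>: "continuous_on A \<pi>" for A
    using \<pi> linear_continuous_on linear_conv_bounded_linear by blast
  have "continuous_on (B \<times> {0..1}) (\<lambda>(z,t). t ^ m * g (\<pi> z + t *\<^sub>R (z - \<pi> z)))"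
    unfolding case_prod_unfold
    by (intro continuous_intros continuous_on_compose2[OF smooth_on_continuous_on[OF 0]] continuous_on_compose2[OF cont\<pi>[of UNIV]])
       (auto simp: segB)
  then show ?case
    using integral_continuous_on_param[of B 0 "1::real"] by (simp add: cbox_interval)
next
  case (Suc k)
  have cont\<pi>: "continuous_on A \<pi>" for A
    using \<pi> linear_continuous_on linear_conv_bounded_linear by blast
  define seg where "seg t z = \<pi> z + t *\<^sub>R (z - \<pi> z)" for t z
  define g' where "g' v x = frechet_derivative g (at x) v" for v x
  have sg': "smooth_on B (g' v)" for v
    unfolding g'_def by (rule smooth_on_frechet_derivative[OF Suc.prems])
  have dg: "(g has_derivative (\<lambda>v. g' v x)) (at x)" if "x \<in> B" for x
    using smooth_on_has_derivative[OF Suc.prems that] by (simp add: g'_def)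
  have bl: "bounded_linear (seg t)" for t
    unfolding seg_def using \<pi>
    by (intro bounded_linear_add bounded_linear_scaleR_right[THEN bounded_linear_compose] bounded_linear_sub bounded_linear_ident)
       (auto simp: linear_conv_bounded_linear)
  \<comment> \<open>Differentiation under the integral sign asks for a jointly continuous family of
    bounded linear maps; continuity is then checked on each fixed vector v.\<close>
  define fx where "fx z t = Blinfun (\<lambda>v. t ^ m * g' (seg t v) (seg t z))" for z t
  have d: "((\<lambda>z. t ^ m * g (seg t z)) has_derivative (\<lambda>v. t ^ m * g' (seg t v) (seg t z))) (at z)"
    if "z \<in> B" "t \<in> {0..1}" for z t
    using segB[OF that]
    by (intro has_derivative_mult_right has_derivative_compose[OF bounded_linear_imp_has_derivative[OF bl] dg]) (simp add: seg_def)
  then have fx: "blinfun_apply (fx z t) v = t ^ m * g' (seg t v) (seg t z)" if "z \<in> B" "t \<in> {0..1}" for z t v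
    unfolding fx_def using that has_derivative_bounded_linear by (subst bounded_linear_Blinfun_apply) blast+
  have split: "g' (seg t v) y = g' (\<pi> v) y + t * g' (v - \<pi> v) y" if "y \<in> B" for t v y
    using linear_add[OF has_derivative_linear[OF dg[OF that]], of "\<pi> v" "t *\<^sub>R (v - \<pi> v)"]
      linear_cmul[OF has_derivative_linear[OF dg[OF that]], of t "v - \<pi> v"]
    by (simp add: seg_def)
  have seg_in: "seg t z \<in> B" if "z \<in> B" "t \<in> {0..1}" for t z
    using segB[OF that] by (simp add: seg_def)
  have cont: "continuous_on (B \<times> {0..1}) (\<lambda>(z,t). t ^ j * G (seg t z))" if "smooth_on B G" for G :: "real^'n \<Rightarrow> real" and j
    unfolding case_prod_unfold seg_def
    by (intro continuous_intros continuous_on_compose2[OF smooth_on_continuous_on[OF that]] continuous_on_compose2[OF cont\<pi>[of UNIV]])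
       (auto simp: segB)
  have fxcont: "continuous_on (B \<times> cbox 0 1) (\<lambda>(z,t). fx z t)"
  proof (rule continuous_on_blinfun_componentwise)
    fix v
    have "continuous_on (B \<times> {0..1}) (\<lambda>p. (case p of (z,t) \<Rightarrow> t ^ m * g' (\<pi> v) (seg t z)) + (case p of (z,t) \<Rightarrow> t ^ Suc m * g' (v - \<pi> v) (seg t z)))"
      by (intro continuous_on_add cont sg')
    then show "continuous_on (B \<times> cbox 0 1) (\<lambda>p. blinfun_apply (case p of (z,t) \<Rightarrow> fx z t) v)"
      unfolding cbox_interval by (rule continuous_on_eq) (auto simp: fx split seg_in algebra_simps)
  qed
  have int: "(\<lambda>t. t ^ j * G (seg t z)) integrable_on {0..1}" if "smooth_on B G" "z \<in> B" for G j z
  proof (rule integrable_continuous_real)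
    have "continuous_on {0..1} ((\<lambda>(z,t). t ^ j * G (seg t z)) \<circ> Pair z)"
      using that by (intro continuous_on_compose continuous_intros continuous_on_subset[OF cont]) auto
    then show "continuous_on {0..1} (\<lambda>t. t ^ j * G (seg t z))" by (simp add: o_def)
  qed
  have D: "((\<lambda>z. integral {0..1} (\<lambda>t. t ^ m * g (seg t z))) has_derivative integral {0..1} (fx z)) (at z)" if "z \<in> B" for z
  proof -
    have "((\<lambda>z. integral (cbox 0 1) (\<lambda>t. t ^ m * g (seg t z))) has_derivative integral (cbox 0 1) (fx z)) (at z within B)"
    proof (rule leibniz_rule[OF _ _ fxcont that B(2)])
      show "((\<lambda>z. t ^ m * g (seg t z)) has_derivative blinfun_apply (fx x t)) (at x within B)"
        if "x \<in> B" "t \<in> cbox 0 1" for x t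
      proof -
        have "blinfun_apply (fx x t) = (\<lambda>v. t ^ m * g' (seg t v) (seg t x))"
          using fx that by auto
        then show ?thesis using d[of x t] that by (simp add: has_derivative_at_withinI)
      qed
    qed (use int[OF Suc.prems] in auto)
    then show ?thesis using at_within_open[OF that B(1)] by simp
  qed
  have app: "blinfun_apply (integral {0..1} (fx z)) v =
      integral {0..1} (\<lambda>t. t ^ m * g' (\<pi> v) (seg t z)) + integral {0..1} (\<lambda>t. t ^ Suc m * g' (v - \<pi> v) (seg t z))"
    if "z \<in> B" for z v
  proof -
    have "continuous_on {0..1} ((\<lambda>(z,t). fx z t) \<circ> Pair z)"
      using that fxcont by (intro continuous_on_compose continuous_intros) (auto elim!: continuous_on_subset)
    then have i: "fx z integrable_on {0..1}"
      by (intro integrable_continuous_real) (simp add: o_def)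
    have "blinfun_apply (integral {0..1} (fx z)) v = integral {0..1} (\<lambda>t. blinfun_apply (fx z t) v)"
      using integral_linear[OF i blinfun.bounded_linear_left[of v]] by (simp add: o_def)
    also have "\<dots> = integral {0..1} (\<lambda>t. t ^ m * g' (\<pi> v) (seg t z) + t ^ Suc m * g' (v - \<pi> v) (seg t z))"
      by (rule integral_cong) (auto simp: fx split seg_in that algebra_simps)
    also have "\<dots> = integral {0..1} (\<lambda>t. t ^ m * g' (\<pi> v) (seg t z)) + integral {0..1} (\<lambda>t. t ^ Suc m * g' (v - \<pi> v) (seg t z))"
      by (intro integral_add int sg' that)
    finally show ?thesis .
  qed
  have "differentiable_upto (Suc k) B (\<lambda>z. integral {0..1} (\<lambda>t. t ^ m * g (seg t z)))"
  proof (rule differentiable_upto_SucI[OF B(1) D])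
    fix v
    have "differentiable_upto k B (\<lambda>z. integral {0..1} (\<lambda>t. t ^ m * g' (\<pi> v) (seg t z)) + integral {0..1} (\<lambda>t. t ^ Suc m * g' (v - \<pi> v) (seg t z)))"
      unfolding seg_def by (intro differentiable_upto_add B(1) Suc.IH sg')
    then show "differentiable_upto k B (\<lambda>z. blinfun_apply (integral {0..1} (fx z)) v)"
      by (rule differentiable_upto_cong[OF B(1), rotated]) (simp add: app)
  qed
  then show ?case by (simp add: seg_def)
qed

text \<open>Fundamental theorem of calculus along the segment from \<pi> z, where the coordinates in
  K are set to zero, to z. The centre has vanishing K-coordinates, so \<pi> maps the ball into
  itself and the segment stays inside by convexity.\<close>

lemma Hadamard:
  fixes g :: "real^'n::finite \<Rightarrow> real"
  assumes z0: "\<And>i. i \<in> K \<Longrightarrow> z0 $ i = 0" and g: "smooth_on (ball z0 r) g"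
    and vanish: "\<And>z. z \<in> ball z0 r \<Longrightarrow> (\<And>i. i \<in> K \<Longrightarrow> z $ i = 0) \<Longrightarrow> g z = 0"
  shows "\<exists>a. (\<forall>i. smooth_on (ball z0 r) (a i)) \<and> (\<forall>z\<in>ball z0 r. g z = (\<Sum>i\<in>K. z $ i * a i z))"
proof -
  define \<pi> :: "real^'n \<Rightarrow> real^'n" where "\<pi> z = (\<chi> i. if i \<in> K then 0 else z $ i)" for z
  have lin: "linear \<pi>"
    by (rule linearI) (auto simp: \<pi>_def vec_eq_iff)
  have \<pi>B: "\<pi> z \<in> ball z0 r" if "z \<in> ball z0 r" for z
  proof -
    have "norm (z0 - \<pi> z) \<le> norm (z0 - z)"
      by (rule norm_le_componentwise_cart) (auto simp: \<pi>_def z0)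
    then show ?thesis using that by (auto simp: dist_norm)
  qed
  have seg: "\<pi> z + t *\<^sub>R (z - \<pi> z) \<in> ball z0 r" if "z \<in> ball z0 r" "t \<in> {0..1}" for z t
  proof -
    have "(1 - t) *\<^sub>R \<pi> z + t *\<^sub>R z \<in> ball z0 r"
      using convex_ball[of z0 r] \<pi>B[OF that(1)] that by (intro convexD) auto
    then show ?thesis by (simp add: algebra_simps)
  qed
  define a where "a i z = integral {0..1} (\<lambda>t. partial_deriv i g (\<pi> z + t *\<^sub>R (z - \<pi> z)))" for i z
  have "smooth_on (ball z0 r) (a i)" for i
    unfolding smooth_on_def a_def[abs_def]
    using differentiable_upto_segment_integral[OF _ _ lin seg smooth_on_partial_deriv[OF g], of _ 0 i] by simp
  moreover have "g z = (\<Sum>i\<in>K. z $ i * a i z)" if z: "z \<in> ball z0 r" for z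
  proof -
    let ?c = "\<lambda>t. \<pi> z + t *\<^sub>R (z - \<pi> z)"
    let ?S = "\<lambda>t. \<Sum>i\<in>K. z $ i * partial_deriv i g (?c t)"
    have D: "((\<lambda>t. g (?c t)) has_vector_derivative ?S t) (at t within {0..1})"
      if t: "t \<in> {0..1}" for t
    proof -
      have dg: "(g has_derivative frechet_derivative g (at (?c t))) (at (?c t))"
        using smooth_on_has_derivative[OF g seg[OF z t]] .
      have "((\<lambda>t. g (?c t)) has_derivative (\<lambda>h. frechet_derivative g (at (?c t)) (h *\<^sub>R (z - \<pi> z)))) (at t within {0..1})"
        by (rule has_derivative_compose[where f = ?c, OF _ dg]) (auto intro!: derivative_eq_intros)
      moreover have l: "linear (frechet_derivative g (at (?c t)))"
        using dg has_derivative_linear by blast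
      have zk: "z - \<pi> z = (\<Sum>i\<in>K. z $ i *\<^sub>R axis i 1)"
        by (simp add: vec_eq_iff \<pi>_def axis_def if_distrib cong: if_cong)
      have "frechet_derivative g (at (?c t)) (z - \<pi> z) = ?S t"
        using arg_cong[OF zk, of "frechet_derivative g (at (?c t))"]
        by (simp add: linear_sum[OF l] linear_cmul[OF l] partial_deriv_def)
      then have "(\<lambda>h. frechet_derivative g (at (?c t)) (h *\<^sub>R (z - \<pi> z))) = (\<lambda>h. h *\<^sub>R ?S t)"
        by (simp only: linear_cmul[OF l])
      ultimately show ?thesis by (simp add: has_vector_derivative_def)
    qed
    have "(?S has_integral g (?c 1) - g (?c 0)) {0..1}"
      by (rule fundamental_theorem_of_calculus) (use D in auto)
    moreover have "g (\<pi> z) = 0"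
      using vanish[OF \<pi>B[OF z]] by (simp add: \<pi>_def)
    ultimately have "integral {0..1} ?S = g z" by (simp add: integral_unique)
    moreover have "integral {0..1} ?S = (\<Sum>i\<in>K. integral {0..1} (\<lambda>t. z $ i * partial_deriv i g (?c t)))"
    proof (rule integral_sum)
      show "(\<lambda>t. z $ i * partial_deriv i g (?c t)) integrable_on {0..1}" for i
        by (intro integrable_continuous_real continuous_intros
            continuous_on_compose2[OF smooth_on_continuous_on[OF smooth_on_partial_deriv[OF g]]]) (use seg z in auto)
    qed simp
    ultimately show ?thesis by (simp add: a_def)
  qed
  ultimately show ?thesis by blast
qed

section \<open>Stability of rays\<close>

text \<open>The squared slowness. With it H = (slow2 - |p|^2)/2, so that Hamilton's equations read
  X' = -P and P' = -(1/2) grad slow2.\<close>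

definition slow2 :: "(real^3 \<Rightarrow> real) \<Rightarrow> real^3 \<Rightarrow> real"
  where "slow2 c0 x = 1 / (c0 x)\<^sup>2"

text \<open>Unlike a bicharacteristic, such a curve may be parametrized by any interval, even a
  degenerate one. Rays can thus be cut, shifted and reversed without reparametrization.\<close>

definition hamiltonian_curve ::
    "(real^3 \<Rightarrow> real) \<Rightarrow> real \<Rightarrow> real \<Rightarrow> (real \<Rightarrow> real^3) \<Rightarrow> (real \<Rightarrow> real^3) \<Rightarrow> bool"
  where "hamiltonian_curve c0 a b X P \<longleftrightarrow>
    (\<forall>l\<in>{a..b}. X l \<in> half_space \<and> (norm (P l))\<^sup>2 = slow2 c0 (X l) \<and>
       (X has_vector_derivative - P l) (at l within {a..b}) \<and>
       (P has_vector_derivative - (1/2) *\<^sub>R gradient (slow2 c0) (X l)) (at l within {a..b}))"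

lemma gradient_has_derivative:
  fixes f :: "real^'n::finite \<Rightarrow> real"
  assumes "f differentiable (at x)"
  shows "(f has_derivative (\<lambda>h. gradient f x \<bullet> h)) (at x)"
proof -
  have d: "(f has_derivative frechet_derivative f (at x)) (at x)"
    using assms frechet_derivative_works by blast
  then have l: "linear (frechet_derivative f (at x))" using has_derivative_linear by blast
  have "frechet_derivative f (at x) = (\<lambda>h. gradient f x \<bullet> h)"
  proof
    fix h :: "real^'n"
    have "h = (\<Sum>i\<in>UNIV. h $ i *\<^sub>R axis i 1)"
      by (simp add: vec_eq_iff axis_def if_distrib cong: if_cong)
    then have "frechet_derivative f (at x) h = (\<Sum>i\<in>UNIV. h $ i * frechet_derivative f (at x) (axis i 1))"
      using linear_sum[OF l, of "\<lambda>i. h $ i *\<^sub>R axis i 1" UNIV] by (simp add: linear_cmul[OF l])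
    then show "frechet_derivative f (at x) h = gradient f x \<bullet> h"
      by (simp add: gradient_def partial_deriv_def inner_vec_def mult.commute)
  qed
  then show ?thesis using d by simp
qed

lemma gradient_eqI:
  fixes f :: "real^'n::finite \<Rightarrow> real"
  assumes "(f has_derivative (\<lambda>h. g \<bullet> h)) (at x)"
  shows "gradient f x = g"
  using frechet_derivative_at[OF assms]
  by (simp add: gradient_def partial_deriv_def vec_eq_iff inner_axis flip: fun_eq_iff)
     (metis inner_axis inner_real_def mult.right_neutral)

lemma slow2_smooth:
  assumes "sound_speed c0"
  obtains V where "open V" "half_space \<subseteq> V" "smooth_on V (slow2 c0)" "\<And>x. x \<in> V \<Longrightarrow> 0 < c0 x" "smooth_on V c0"
proof -
  obtain V where V: "open V" "half_space \<subseteq> V" "smooth_on V c0" and pos: "\<And>x. x \<in> half_space \<Longrightarrow> 0 < c0 x"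
    using assms by (auto simp: sound_speed_def)
  \<comment> \<open>Positivity of \<open>c0\<close> is given on the half space only; by continuity
    it persists on an open neighbourhood, on which the quotient is smooth.\<close>
  define W where "W = V \<inter> c0 -` {0<..}"
  have W: "open W"
    unfolding W_def using smooth_on_continuous_on[OF V(3)] V(1) open_greaterThan
    by (rule continuous_open_preimage)
  have s: "smooth_on W c0" by (rule smooth_on_subset[OF V(3)]) (simp add: W_def)
  have "smooth_on W (slow2 c0)"
    unfolding slow2_def[abs_def] power2_eq_square
    by (intro smooth_on_divide smooth_on_mult smooth_on_const W s) (auto simp: W_def)
  then show thesis using that[OF W _ _ _ s] V(2) pos by (auto simp: W_def)
qed

lemma slow2_has_derivative:
  assumes "sound_speed c0" "x \<in> half_space"
  shows "(slow2 c0 has_derivative (\<lambda>h. gradient (slow2 c0) x \<bullet> h)) (at x)"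
  using slow2_smooth[OF assms(1)] smooth_on_differentiable assms(2)
  by (metis gradient_has_derivative subsetD)

lemma slow2_pos: "sound_speed c0 \<Longrightarrow> x \<in> half_space \<Longrightarrow> 0 < slow2 c0 x"
  by (force simp: sound_speed_def slow2_def)

lemma bicharacteristic_iff:
  assumes "sound_speed c0"
  shows "bicharacteristic c0 L X P \<longleftrightarrow> 0 < L \<and> hamiltonian_curve c0 0 L X P"
proof -
  have 1: "gradient (\<lambda>p. hamiltonian c0 x p) p = - p" for x p
    unfolding hamiltonian_def power2_norm_eq_inner
    by (rule gradient_eqI) (auto intro!: derivative_eq_intros simp: inner_commute)
  have 2: "gradient (\<lambda>x. hamiltonian c0 x p) x = (1/2) *\<^sub>R gradient (slow2 c0) x" if "x \<in> half_space" for x p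
  proof -
    have "(\<lambda>x. hamiltonian c0 x p) = (\<lambda>x. (1/2) * (slow2 c0 x - (norm p)\<^sup>2))"
      by (simp add: hamiltonian_def slow2_def fun_eq_iff)
    then show ?thesis
      by (auto intro!: gradient_eqI derivative_eq_intros slow2_has_derivative[OF assms that])
  qed
  have 3: "hamiltonian c0 x p = 0 \<longleftrightarrow> (norm p)\<^sup>2 = slow2 c0 x" for x p
    by (auto simp: hamiltonian_def slow2_def)
  show ?thesis
    unfolding bicharacteristic_def hamiltonian_curve_def 1 3 using 2 by (auto simp del: scaleR_scaleR)
qed

lemma hamiltonian_curve_subinterval:
  "hamiltonian_curve c0 a b X P \<Longrightarrow> a \<le> a' \<Longrightarrow> b' \<le> b \<Longrightarrow> hamiltonian_curve c0 a' b' X P"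
  unfolding hamiltonian_curve_def
  by (meson atLeastAtMost_iff atLeastatMost_subset_iff has_vector_derivative_within_subset order_trans)

text \<open>H is even in p: reversing the parameter and the sign of the covector preserves both
  equations.\<close>

lemma hamiltonian_curve_reverse:
  assumes "hamiltonian_curve c0 a b X P"
  shows "hamiltonian_curve c0 (s - b) (s - a) (\<lambda>l. X (s - l)) (\<lambda>l. - P (s - l))"
  unfolding hamiltonian_curve_def
proof (intro ballI conjI)
  fix l assume l: "l \<in> {s - b..s - a}"
  then have sl: "s - l \<in> {a..b}" by auto
  have im: "(\<lambda>l. s - l) ` {s - b..s - a} = {a..b}" by auto
  have d: "((\<lambda>l. s - l) has_vector_derivative (-1)) (at l within {s - b..s - a})"
    by (auto intro!: derivative_eq_intros simp: has_vector_derivative_def)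
  note h = assms[unfolded hamiltonian_curve_def, rule_format, OF sl]
  show "X (s - l) \<in> half_space" "(norm (- P (s - l)))\<^sup>2 = slow2 c0 (X (s - l))"
    using h by auto
  show "((\<lambda>l. X (s - l)) has_vector_derivative - (- P (s - l))) (at l within {s - b..s - a})"
    using vector_diff_chain_within[OF d, of X "- P (s - l)"] h im by (simp add: o_def)
  show "((\<lambda>l. - P (s - l)) has_vector_derivative - (1/2) *\<^sub>R gradient (slow2 c0) (X (s - l))) (at l within {s - b..s - a})"
    using has_vector_derivative_minus[OF vector_diff_chain_within[OF d, of P "- (1/2) *\<^sub>R gradient (slow2 c0) (X (s - l))"]] h im
    by (simp add: o_def)
qed

section \<open>Travel times and reversed rays\<close>

lemma hamiltonian_curve_continuous:
  assumes "hamiltonian_curve c0 a b X P"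
  shows "continuous_on {a..b} X" "continuous_on {a..b} P"
  using assms unfolding hamiltonian_curve_def continuous_on_eq_continuous_within
  by (blast intro: has_vector_derivative_continuous)+

lemma slow2_continuous_on: "sound_speed c0 \<Longrightarrow> continuous_on half_space (slow2 c0)"
  using slow2_smooth smooth_on_continuous_on continuous_on_subset by metis

lemma hamiltonian_curve_slow2_continuous:
  assumes "sound_speed c0" "hamiltonian_curve c0 a b X P"
  shows "continuous_on {a..b} (\<lambda>l. slow2 c0 (X l))"
  using assms(2)
  by (intro continuous_on_compose2[OF slow2_continuous_on[OF assms(1)]] hamiltonian_curve_continuous[OF assms(2)])
     (auto simp: hamiltonian_curve_def)

text \<open>The speed in the parameter l is |P| = 1/c0, so the time element |dX|/c0 is
  dl/c0^2.\<close>

lemma travel_time_eq: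
  assumes "sound_speed c0" "bicharacteristic c0 L X P"
  shows "travel_time c0 L X = integral {0..L} (\<lambda>l. slow2 c0 (X l))"
  unfolding travel_time_def
proof (rule integral_cong)
  fix l assume l: "l \<in> {0..L}"
  have h: "0 < L" "hamiltonian_curve c0 0 L X P"
    using assms by (auto simp: bicharacteristic_iff)
  then have x: "X l \<in> half_space" and p: "(norm (P l))\<^sup>2 = slow2 c0 (X l)"
    and d: "(X has_vector_derivative - P l) (at l within {0..L})"
    using l by (auto simp: hamiltonian_curve_def)
  have c: "0 < c0 (X l)" using assms(1) x by (auto simp: sound_speed_def)
  have "norm (P l) = 1 / c0 (X l)"
    using p c by (simp add: slow2_def power_one_over[symmetric] power2_eq_iff_nonneg)
  moreover have "vector_derivative X (at l within {0..L}) = - P l"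
    using vector_derivative_within_cbox[of 0 L l X] h(1) l d by simp
  ultimately show "norm (vector_derivative X (at l within {0..L})) / c0 (X l) = slow2 c0 (X l)"
    by (simp add: slow2_def power2_eq_square)
qed

lemma travel_time_pos:
  assumes "sound_speed c0" "ray c0 a t b"
  shows "0 < t"
proof -
  obtain L X P where h: "bicharacteristic c0 L X P" "t = travel_time c0 L X"
    using assms(2) by (auto simp: ray_def)
  then have L: "0 < L" and hc: "hamiltonian_curve c0 0 L X P"
    using assms(1) by (auto simp: bicharacteristic_iff)
  have pos: "0 < slow2 c0 (X l)" if "l \<in> {0..L}" for l
    using hc that slow2_pos[OF assms(1)] by (auto simp: hamiltonian_curve_def)
  note cont = hamiltonian_curve_slow2_continuous[OF assms(1) hc]
  have "0 \<in> {0..L}" using L by simp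
  have "integral {0..L} (\<lambda>l. slow2 c0 (X l)) \<noteq> 0"
  proof
    assume "integral {0..L} (\<lambda>l. slow2 c0 (X l)) = 0"
    then have "\<forall>l\<in>{0..L}. slow2 c0 (X l) = 0"
      using integral_eq_0_iff[OF cont L less_imp_le[OF pos]] by simp
    then show False using pos[OF \<open>0 \<in> {0..L}\<close>] \<open>0 \<in> {0..L}\<close> by simp
  qed
  moreover have "0 \<le> integral {0..L} (\<lambda>l. slow2 c0 (X l))"
    using pos by (intro integral_nonneg integrable_continuous_real cont less_imp_le)
  ultimately have "0 < integral {0..L} (\<lambda>l. slow2 c0 (X l))" by simp
  then show ?thesis using h travel_time_eq[OF assms(1) h(1)] by simp
qed

text \<open>Turned round, the incident ray also leads from the subsurface to the surface, so that
  one set of arrival estimates serves both legs.\<close>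

lemma ray_reverse:
  assumes "sound_speed c0" "ray c0 (x, p) t (y, q)"
  shows "ray c0 (y, - q) t (x, - p)"
proof -
  obtain L X P where h: "bicharacteristic c0 L X P" "X 0 = x" "P 0 = p" "X L = y" "P L = q" "t = travel_time c0 L X"
    using assms(2) by (auto simp: ray_def)
  then have L: "0 < L" and hc: "hamiltonian_curve c0 0 L X P"
    using assms(1) by (auto simp: bicharacteristic_iff)
  have r: "bicharacteristic c0 L (\<lambda>l. X (L - l)) (\<lambda>l. - P (L - l))"
    using hamiltonian_curve_reverse[OF hc, of L] L assms(1) by (simp add: bicharacteristic_iff)
  have "integral {0..L} (\<lambda>l. slow2 c0 (X (L - l))) = integral {0..L} (\<lambda>l. slow2 c0 (X l))"
  proof -
    have "((\<lambda>l. slow2 c0 (X l)) has_integral integral {0..L} (\<lambda>l. slow2 c0 (X l))) (cbox 0 L)"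
      using hamiltonian_curve_slow2_continuous[OF assms(1) hc]
      by (simp add: integrable_continuous_real integrable_integral)
    from has_integral_affinity[OF this, of "-1" L]
    have "((\<lambda>l. slow2 c0 (X (L - l))) has_integral integral {0..L} (\<lambda>l. slow2 c0 (X l))) ((\<lambda>x. L - x) ` {0..L})"
      by (simp add: algebra_simps)
    then show ?thesis by (simp add: integral_unique)
  qed
  then have "t = travel_time c0 L (\<lambda>l. X (L - l))"
    using travel_time_eq[OF assms(1) r] travel_time_eq[OF assms(1) h(1)] h(6) by simp
  then show ?thesis unfolding ray_def using r h by (intro exI[of _ L] exI[of _ "\<lambda>l. X (L - l)"] exI[of _ "\<lambda>l. - P (L - l)"]) auto
qed

subsection \<open>Transversal arrival at the surface\<close>

lemma has_vector_derivative_nth: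
  fixes X :: "real \<Rightarrow> real^'n::finite"
  shows "(X has_vector_derivative v) F \<Longrightarrow> ((\<lambda>l. X l $ i) has_real_derivative v $ i) F"
  using bounded_linear.has_vector_derivative[OF bounded_linear_vec_nth]
  by (auto simp: has_real_derivative_iff_has_vector_derivative)

text \<open>An earlier contact would be an interior minimum of the height, whose derivative is the
  negative of the third covector component; that component would vanish, which is grazing. At the
  arrival the component is not negative either, since the height would otherwise have increased to 0
  from negative values.\<close>

lemma positive_before_arrival:
  assumes c0: "sound_speed c0" and ng: "no_ray_grazes_surface c0"
    and h: "bicharacteristic c0 L X P" and X0: "X 0 \<in> subsurface" and XL: "X L $ 3 = 0"
  shows "\<And>l. l \<in> {0..<L} \<Longrightarrow> 0 < X l $ 3" and "0 < P L $ 3"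
proof -
  have L: "0 < L" and hc: "hamiltonian_curve c0 0 L X P"
    using h c0 by (auto simp: bicharacteristic_iff)
  \<comment> \<open>The curve truncated at l is itself a ray ending on the surface, so the
    non-grazing hypothesis applies to intermediate contacts too.\<close>
  have nongraz: "P l $ 3 \<noteq> 0" if "0 < l" "l \<le> L" "X l $ 3 = 0" for l
  proof -
    have "bicharacteristic c0 l X P"
      using hamiltonian_curve_subinterval[OF hc, of 0 l] that c0 by (simp add: bicharacteristic_iff)
    then have "ray c0 (X 0, P 0) (travel_time c0 l X) (X l, P l)" by (auto simp: ray_def)
    then show ?thesis using ng X0 that by (auto simp: no_ray_grazes_surface_def)
  qed
  have X3: "0 \<le> X l $ 3" and d: "((\<lambda>l. X l $ 3) has_real_derivative - P l $ 3) (at l within {0..L})" if "l \<in> {0..L}" for l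
    using hc that has_vector_derivative_nth[of X "- P l" _ 3] by (auto simp: hamiltonian_curve_def half_space_def)
  show "0 < X l $ 3" if l: "l \<in> {0..<L}" for l
  proof (rule ccontr)
    assume "\<not> 0 < X l $ 3"
    then have z: "X l $ 3 = 0" using X3[of l] l by auto
    then have l0: "0 < l" using X0 l by (cases "l = 0") (auto simp: subsurface_def)
    have "at l within {0..L} = at l" using l l0 by (simp add: at_within_Icc_at)
    then have "((\<lambda>l. X l $ 3) has_real_derivative - P l $ 3) (at l)" using d[of l] l by simp
    moreover have "\<forall>y. \<bar>l - y\<bar> < min l (L - l) \<longrightarrow> X l $ 3 \<le> X y $ 3"
      unfolding z by (intro allI impI X3) auto
    ultimately have "- P l $ 3 = 0"
      using DERIV_local_min[of "\<lambda>l. X l $ 3" "- P l $ 3" l "min l (L - l)"] l l0 by auto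
    then show False using nongraz[OF l0 _ z] l by simp
  qed
  have "\<not> P L $ 3 < 0"
  proof
    assume "P L $ 3 < 0"
    then obtain d where dd: "0 < d" "\<And>h. 0 < h \<Longrightarrow> L - h \<in> {0..L} \<Longrightarrow> h < d \<Longrightarrow> X (L - h) $ 3 < X L $ 3"
      using has_real_derivative_pos_inc_left[OF d[of L]] L by auto
    define h where "h = min L d / 2"
    have "0 < h" "h < d" "h < L" using dd L by (auto simp: h_def min_def)
    then show False using dd(2)[of h] X3[of "L - h"] XL by auto
  qed
  then show "0 < P L $ 3" using nongraz[OF L _ XL] by auto
qed

subsection \<open>Growth estimates\<close>

lemma norm_increment_le:
  fixes f :: "real \<Rightarrow> 'a::real_normed_vector"
  assumes "a \<le> b" "\<And>x. x \<in> {a..b} \<Longrightarrow> (f has_vector_derivative f' x) (at x within {a..b})"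
    and "\<And>x. x \<in> {a..b} \<Longrightarrow> norm (f' x) \<le> K"
  shows "norm (f b - f a) \<le> K * (b - a)"
proof -
  have "norm (f b - f a) \<le> K * norm (b - a)"
  proof (rule differentiable_bound[of "{a..b}" f "\<lambda>x h. h *\<^sub>R f' x"])
    show "onorm (\<lambda>h. h *\<^sub>R f' x) \<le> K" if "x \<in> {a..b}" for x
      using assms(3)[OF that] by (intro onorm_le) (simp add: mult.commute[of _ "norm (f' x)"] mult_right_mono)
  qed (use assms in \<open>auto simp: has_vector_derivative_def\<close>)
  then show ?thesis using assms(1) by simp
qed

text \<open>At the first parameter where \<phi> reaches c the weak inequality holds up to that
  point, and \<open>step\<close> makes it strict there, a contradiction. It serves estimates valid
  only as long as a curve stays in a set in which the estimate itself keeps it.\<close>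

lemma bootstrap:
  fixes \<phi> :: "real \<Rightarrow> real"
  assumes cont: "continuous_on {a..b} \<phi>" and start: "\<phi> a < c"
    and step: "\<And>l. l \<in> {a..b} \<Longrightarrow> (\<And>l'. l' \<in> {a..l} \<Longrightarrow> \<phi> l' \<le> c) \<Longrightarrow> \<phi> l < c"
    and l: "l \<in> {a..b}"
  shows "\<phi> l < c"
proof (rule ccontr)
  assume nl: "\<not> \<phi> l < c"
  let ?S = "{x \<in> {a..b}. c \<le> \<phi> x}"
  have "closed ?S" by (rule continuous_on_closed_Collect_le) (auto intro: cont)
  moreover have "bounded ?S" by (rule bounded_subset[of "{a..b}"]) auto
  ultimately have "compact ?S" by (simp add: compact_eq_bounded_closed)
  then obtain m where m: "m \<in> ?S" "\<And>x. x \<in> ?S \<Longrightarrow> m \<le> x"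
    using compact_attains_inf[of ?S] nl l by fastforce
  obtain x where x: "a \<le> x" "x \<le> m" "\<phi> x = c"
    using IVT'[of \<phi> a c m] start m(1) continuous_on_subset[OF cont, of "{a..m}"] by fastforce
  then have "x = m" using m by fastforce
  have "\<phi> m < c"
  proof (rule step)
    show "\<phi> l' \<le> c" if "l' \<in> {a..m}" for l'
      using m(2)[of l'] m(1) that x \<open>x = m\<close> by (cases "l' = m") force+
  qed (use m in auto)
  then show False using m by auto
qed

section \<open>Uniform bounds for the flow and Gronwall's inequality\<close>

lemma smooth_on_Lipschitz:
  fixes f :: "'a::euclidean_space \<Rightarrow> 'b::euclidean_space"
  assumes V: "open V" "smooth_on V f" and B: "compact B" "convex B" "B \<subseteq> V"
  obtains K where "0 \<le> K" "\<And>x y. x \<in> B \<Longrightarrow> y \<in> B \<Longrightarrow> norm (f x - f y) \<le> K * norm (x - y)"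
proof -
  define b where "b e x = norm (frechet_derivative f (at x) e)" for e x
  have "\<exists>M. \<forall>x\<in>B. b e x \<le> M" for e
  proof -
    have "continuous_on B (b e)"
      unfolding b_def by (intro continuous_intros continuous_on_subset[OF smooth_on_continuous_on[OF smooth_on_frechet_derivative[OF V(2)]] B(3)])
    then have "bounded (b e ` B)" using B(1) compact_continuous_image compact_imp_bounded by blast
    then obtain M where "\<forall>y\<in>b e ` B. norm y \<le> M" unfolding bounded_iff by blast
    then show ?thesis by (intro exI[of _ M]) auto
  qed
  then obtain M where M: "\<And>e x. x \<in> B \<Longrightarrow> b e x \<le> M e" by metis
  define K where "K = (\<Sum>e\<in>Basis. \<bar>M e\<bar>)"
  have d: "(f has_derivative frechet_derivative f (at x)) (at x)" if "x \<in> B" for x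
    using that B V smooth_on_has_derivative by blast
  have "norm (f x - f y) \<le> K * norm (x - y)" if "x \<in> B" "y \<in> B" for x y
  proof (rule differentiable_bound[OF B(2) _ _ that(1,2)])
    show "(f has_derivative frechet_derivative f (at x)) (at x within B)" if "x \<in> B" for x
      using d[OF that] by (rule has_derivative_at_withinI)
    show "onorm (frechet_derivative f (at x)) \<le> K" if "x \<in> B" for x
    proof (rule onorm_le)
      fix h :: 'a
      have l: "linear (frechet_derivative f (at x))" using d[OF that] has_derivative_linear by blast
      have "frechet_derivative f (at x) h = (\<Sum>e\<in>Basis. (h \<bullet> e) *\<^sub>R frechet_derivative f (at x) e)"
        using linear_sum[OF l, of "\<lambda>e. (h \<bullet> e) *\<^sub>R e" Basis] by (simp add: euclidean_representation linear_cmul[OF l])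
      also have "norm \<dots> \<le> (\<Sum>e\<in>Basis. \<bar>h \<bullet> e\<bar> * b e x)"
        by (rule order_trans[OF norm_sum]) (simp add: b_def)
      also have "\<dots> \<le> (\<Sum>e\<in>Basis. norm h * \<bar>M e\<bar>)"
        using M[OF that] by (intro sum_mono mult_mono) (auto simp: Basis_le_norm b_def intro: order_trans[OF M[OF that, unfolded b_def] abs_ge_self])
      finally show "norm (frechet_derivative f (at x) h) \<le> K * norm h"
        by (simp add: K_def sum_distrib_left mult.commute)
    qed
  qed
  moreover have "0 \<le> K" by (simp add: K_def sum_nonneg)
  ultimately show thesis using that by blast
qed

text \<open>A single constant for all bounds on a compact region, so that the later constants are
  expressions in K alone. The lower bound 1/K forces rays to move at definite speed; the last
  inequality is the second order Taylor estimate.\<close>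

definition flow_bound :: "(real^3 \<Rightarrow> real) \<Rightarrow> (real^3) set \<Rightarrow> real \<Rightarrow> bool"
  where "flow_bound c0 B K \<longleftrightarrow> 1 \<le> K \<and> B \<subseteq> half_space \<and>
    (\<forall>x\<in>B. slow2 c0 x \<le> K \<and> 1 / K \<le> slow2 c0 x \<and> norm (gradient (slow2 c0) x) \<le> K) \<and>
    (\<forall>x\<in>B. \<forall>y\<in>B. norm (gradient (slow2 c0) x - gradient (slow2 c0) y) \<le> K * norm (x - y) \<and>
       \<bar>slow2 c0 x - slow2 c0 y\<bar> \<le> K * norm (x - y) \<and>
       \<bar>slow2 c0 y - slow2 c0 x - gradient (slow2 c0) x \<bullet> (y - x)\<bar> \<le> K * (norm (y - x))\<^sup>2)"

lemma compact_half_ball: "compact (cball 0 R \<inter> half_space)" "convex (cball 0 R \<inter> half_space)"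
proof -
  have eq: "half_space = {x. axis 3 1 \<bullet> x \<ge> 0}"
    by (simp add: half_space_def inner_axis inner_commute)
  show "compact (cball 0 R \<inter> half_space)"
    unfolding eq by (intro compact_Int_closed closed_halfspace_ge) auto
  show "convex (cball 0 R \<inter> half_space)"
    unfolding eq by (intro convex_Int convex_halfspace_ge) auto
qed

lemma flow_bound_exists:
  assumes c0: "sound_speed c0"
  obtains K where "flow_bound c0 (cball 0 R \<inter> half_space) K"
proof -
  obtain V where V: "open V" "half_space \<subseteq> V" "smooth_on V (slow2 c0)"
    using slow2_smooth[OF c0] by metis
  let ?B = "cball 0 R \<inter> half_space" and ?G = "gradient (slow2 c0)"
  have BV: "?B \<subseteq> V" using V by auto
  have G: "smooth_on V ?G"
    by (rule smooth_on_vecI[OF V(1)]) (simp add: gradient_def smooth_on_partial_deriv[OF V(3)])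
  obtain K1 where K1: "0 \<le> K1" "\<And>x y. x \<in> ?B \<Longrightarrow> y \<in> ?B \<Longrightarrow> norm (?G x - ?G y) \<le> K1 * norm (x - y)"
    using smooth_on_Lipschitz[OF V(1) G compact_half_ball BV] by blast
  obtain K2 where K2: "0 \<le> K2" "\<And>x y. x \<in> ?B \<Longrightarrow> y \<in> ?B \<Longrightarrow> norm (slow2 c0 x - slow2 c0 y) \<le> K2 * norm (x - y)"
    using smooth_on_Lipschitz[OF V(1) V(3) compact_half_ball BV] by blast
  have bdd: "bounded (g ` ?B)" if "continuous_on ?B g" for g :: "real^3 \<Rightarrow> 'b::euclidean_space"
    using that compact_half_ball compact_continuous_image compact_imp_bounded by blast
  have cs: "continuous_on ?B (slow2 c0)" and cG: "continuous_on ?B ?G"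
    using V(3) G BV smooth_on_continuous_on continuous_on_subset by blast+
  have pos: "0 < slow2 c0 x" if "x \<in> ?B" for x using that slow2_pos[OF c0] by auto
  have ci: "continuous_on ?B (\<lambda>x. inverse (slow2 c0 x))"
    using cs pos by (intro continuous_on_inverse) force+
  obtain K3 where K3: "\<And>x. x \<in> ?B \<Longrightarrow> norm (slow2 c0 x) \<le> K3"
    using bdd[OF cs] by (force simp: bounded_iff)
  obtain K4 where K4: "\<And>x. x \<in> ?B \<Longrightarrow> norm (?G x) \<le> K4"
    using bdd[OF cG] by (force simp: bounded_iff)
  obtain K5 where K5: "\<And>x. x \<in> ?B \<Longrightarrow> norm (inverse (slow2 c0 x)) \<le> K5"
    using bdd[OF ci] by (force simp: bounded_iff)
  define K where "K = Max {1, K1, K2, K3, K4, K5}"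
  have K: "1 \<le> K" "K1 \<le> K" "K2 \<le> K" "K3 \<le> K" "K4 \<le> K" "K5 \<le> K"
    by (auto simp: K_def)
  \<comment> \<open>The Lipschitz bound for the gradient gives the quadratic remainder; convexity of
    the half ball keeps the connecting segment where the derivative of \<open>slow2 c0\<close> is
    known.\<close>
  have taylor: "\<bar>slow2 c0 y - slow2 c0 x - ?G x \<bullet> (y - x)\<bar> \<le> K * (norm (y - x))\<^sup>2"
    if xy: "x \<in> ?B" "y \<in> ?B" for x y
  proof -
    have "norm (slow2 c0 y - slow2 c0 x - ?G x \<bullet> (y - x)) \<le> norm (y - x) * (K1 * norm (y - x))"
    proof (rule differentiable_bound_linearization[of x y "closed_segment x y" "slow2 c0" "\<lambda>z h. ?G z \<bullet> h" x])
      have sub: "closed_segment x y \<subseteq> ?B" by (rule closed_segment_subset[OF xy compact_half_ball(2)])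
      show "(slow2 c0 has_derivative (\<lambda>h. ?G z \<bullet> h)) (at z within closed_segment x y)" if "z \<in> closed_segment x y" for z
      proof -
        have "z \<in> half_space" using sub that by blast
        then show ?thesis by (rule has_derivative_at_withinI[OF slow2_has_derivative[OF c0]])
      qed
      show "onorm ((\<lambda>h. ?G z \<bullet> h) - (\<lambda>h. ?G x \<bullet> h)) \<le> K1 * norm (y - x)" if z: "z \<in> closed_segment x y" for z
      proof (rule onorm_le)
        fix h
        have "norm (((\<lambda>h. ?G z \<bullet> h) - (\<lambda>h. ?G x \<bullet> h)) h) = \<bar>(?G z - ?G x) \<bullet> h\<bar>"
          by (simp add: inner_diff_left)
        also have "\<dots> \<le> norm (?G z - ?G x) * norm h" by (rule Cauchy_Schwarz_ineq2)
        also have "norm (?G z - ?G x) \<le> K1 * norm (y - x)"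
        proof (rule order_trans)
          show "norm (?G z - ?G x) \<le> K1 * norm (z - x)" using K1(2)[of z x] sub z xy(1) by blast
          show "K1 * norm (z - x) \<le> K1 * norm (y - x)"
            using segment_bound(1)[OF z] K1(1) by (intro mult_left_mono) (simp_all add: norm_minus_commute)
        qed
        finally show "norm (((\<lambda>h. ?G z \<bullet> h) - (\<lambda>h. ?G x \<bullet> h)) h) \<le> K1 * norm (y - x) * norm h"
          by (simp add: mult_right_mono)
      qed
      show "x + t *\<^sub>R (y - x) \<in> closed_segment x y" if "t \<in> {0..1}" for t
        using that unfolding in_segment by (intro exI[of _ t]) (auto simp: algebra_simps)
    qed auto
    also have "\<dots> = K1 * (norm (y - x))\<^sup>2" by (simp add: power2_eq_square)
    also have "\<dots> \<le> K * (norm (y - x))\<^sup>2" using K by (intro mult_right_mono) auto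
    finally show ?thesis by simp
  qed
  have lo: "1 / K \<le> slow2 c0 x" if "x \<in> ?B" for x
  proof -
    have "inverse (slow2 c0 x) \<le> K" using K5[OF that] K(6) pos[OF that] by simp
    then show ?thesis using pos[OF that] K(1) by (simp add: field_simps)
  qed
  have le: "K1 * norm (x - y) \<le> K * norm (x - y)" "K2 * norm (x - y) \<le> K * norm (x - y)" for x y :: "real^3"
    using K by (auto intro: mult_right_mono)
  have "flow_bound c0 ?B K"
    unfolding flow_bound_def
  proof (intro conjI ballI)
    fix x y assume x: "x \<in> ?B" and y: "y \<in> ?B"
    show "norm (?G x - ?G y) \<le> K * norm (x - y)" using K1(2)[OF x y] le(1)[of x y] by linarith
    show "\<bar>slow2 c0 x - slow2 c0 y\<bar> \<le> K * norm (x - y)" using K2(2)[OF x y] le(2)[of x y] by simp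
    show "\<bar>slow2 c0 y - slow2 c0 x - ?G x \<bullet> (y - x)\<bar> \<le> K * (norm (y - x))\<^sup>2" by (rule taylor[OF x y])
  next
    fix x assume x: "x \<in> ?B"
    show "slow2 c0 x \<le> K" using K3[OF x] K by simp
    show "norm (?G x) \<le> K" using K4[OF x] K by simp
    show "1 / K \<le> slow2 c0 x" by (rule lo[OF x])
  qed (use K in auto)
  then show thesis using that by blast
qed

lemma hamiltonian_curve_norm_le:
  assumes "flow_bound c0 B K" "hamiltonian_curve c0 a b X P" "X ` {a..b} \<subseteq> B" "l \<in> {a..b}"
  shows "norm (P l) \<le> K" "1 / K \<le> norm (P l)" "norm (gradient (slow2 c0) (X l)) \<le> K"
proof -
  have K: "1 \<le> K" and xB: "X l \<in> B" and fb: "flow_bound c0 B K"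
    using assms by (auto simp: flow_bound_def)
  have b: "slow2 c0 (X l) \<le> K" "1 / K \<le> slow2 c0 (X l)" "norm (gradient (slow2 c0) (X l)) \<le> K"
    using fb xB by (auto simp: flow_bound_def)
  have P: "(norm (P l))\<^sup>2 = slow2 c0 (X l)"
    using assms by (auto simp: hamiltonian_curve_def)
  have "K \<le> K\<^sup>2" using K by (simp add: power2_eq_square)
  then show "norm (P l) \<le> K"
    using power2_le_imp_le[of "norm (P l)" K] b P K by linarith
  have "(1 / K)\<^sup>2 \<le> 1 / K"
    using K by (simp add: power2_eq_square divide_simps)
  then show "1 / K \<le> norm (P l)"
    using power2_le_imp_le[of "1 / K" "norm (P l)"] b P by auto
  show "norm (gradient (slow2 c0) (X l)) \<le> K" by (rule b(3))
qed

text \<open>For the third bound the curve is compared with the straight line of velocity -P a: the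
  line moves at speed at least 1/K and the covector drifts by at most K (b - a). Over a short
  interval the chord therefore controls the parameter length.\<close>

lemma hamiltonian_curve_increments:
  assumes fb: "flow_bound c0 B K" and hc: "hamiltonian_curve c0 a b X P" and B: "X ` {a..b} \<subseteq> B" and ab: "a \<le> b"
  shows "norm (X b - X a) \<le> K * (b - a)" "norm (P b - P a) \<le> K * (b - a)"
    and "(b - a) * (1 / K - K * (b - a)) \<le> norm (X b - X a)"
proof -
  have K: "1 \<le> K" using fb by (simp add: flow_bound_def)
  note h = hc[unfolded hamiltonian_curve_def, rule_format]
  note n = hamiltonian_curve_norm_le[OF fb hc B]
  show "norm (X b - X a) \<le> K * (b - a)"
    using ab n(1) h by (intro norm_increment_le[where f' = "\<lambda>l. - P l"]) auto
  have P: "norm (P l - P a) \<le> K * (l - a)" if "l \<in> {a..b}" for l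
  proof (rule norm_increment_le[where f' = "\<lambda>l. - (1/2) *\<^sub>R gradient (slow2 c0) (X l)"])
    fix x assume x: "x \<in> {a..l}"
    show "(P has_vector_derivative - (1/2) *\<^sub>R gradient (slow2 c0) (X x)) (at x within {a..l})"
      using h[of x] x that by (auto intro: has_vector_derivative_within_subset)
    show "norm (- (1/2) *\<^sub>R gradient (slow2 c0) (X x)) \<le> K"
      using n(3)[of x] x that K by auto
  qed (use that in auto)
  from P[of b] ab show "norm (P b - P a) \<le> K * (b - a)" by auto
  have "norm ((X b + (b - a) *\<^sub>R P a) - (X a + (a - a) *\<^sub>R P a)) \<le> (K * (b - a)) * (b - a)"
  proof (rule norm_increment_le[where f' = "\<lambda>l. - P l + P a"])
    fix l assume l: "l \<in> {a..b}"
    show "((\<lambda>l. X l + (l - a) *\<^sub>R P a) has_vector_derivative - P l + P a) (at l within {a..b})"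
      using h[OF l] by (auto intro!: derivative_eq_intros)
    have "norm (- P l + P a) \<le> K * (l - a)"
      using P[OF l] by (simp add: norm_minus_commute)
    also have "\<dots> \<le> K * (b - a)" using l K by (intro mult_left_mono) auto
    finally show "norm (- P l + P a) \<le> K * (b - a)" .
  qed (rule ab)
  then have "norm ((X b - X a) + (b - a) *\<^sub>R P a) \<le> K * (b - a) * (b - a)"
    by (simp add: algebra_simps)
  moreover have "norm ((b - a) *\<^sub>R P a) \<ge> (b - a) * (1 / K)"
    using n(2)[of a] ab by (simp add: mult_left_mono del: times_divide_eq_right)
  moreover have "norm ((b - a) *\<^sub>R P a) \<le> norm ((X b - X a) + (b - a) *\<^sub>R P a) + norm (X b - X a)"
    using norm_triangle_ineq4[of "(X b - X a) + (b - a) *\<^sub>R P a" "X b - X a"] by simp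
  ultimately show "(b - a) * (1 / K - K * (b - a)) \<le> norm (X b - X a)"
    by (simp add: algebra_simps)
qed

text \<open>Along the curve slow2 = P . P and dX = -P dl, so the time differs from -P' . dX only by
  (P - P') . P dl. This handles the end pieces on which only one of two compared rays is
  defined.\<close>

lemma travel_time_increment:
  assumes c0: "sound_speed c0" and fb: "flow_bound c0 B K" and hc: "hamiltonian_curve c0 a b X P"
    and B: "X ` {a..b} \<subseteq> B" and ab: "a \<le> b" and e: "\<And>l. l \<in> {a..b} \<Longrightarrow> norm (P l - P') \<le> e"
  shows "\<bar>integral {a..b} (\<lambda>l. slow2 c0 (X l)) + P' \<bullet> (X b - X a)\<bar> \<le> K * e * (b - a)"
proof -
  note h = hc[unfolded hamiltonian_curve_def, rule_format]
  note n = hamiltonian_curve_norm_le[OF fb hc B]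
  let ?\<phi> = "\<lambda>u. integral {a..u} (\<lambda>l. slow2 c0 (X l)) + P' \<bullet> X u"
  have "norm (?\<phi> b - ?\<phi> a) \<le> (K * e) * (b - a)"
  proof (rule norm_increment_le[where f' = "\<lambda>l. slow2 c0 (X l) + P' \<bullet> (- P l)"])
    fix l assume l: "l \<in> {a..b}"
    show "(?\<phi> has_vector_derivative slow2 c0 (X l) + P' \<bullet> (- P l)) (at l within {a..b})"
      using h[OF l] l
      by (intro has_vector_derivative_add integral_has_vector_derivative hamiltonian_curve_slow2_continuous[OF c0 hc]
         bounded_linear.has_vector_derivative[OF bounded_linear_inner_right]) auto
    have "slow2 c0 (X l) + P' \<bullet> (- P l) = (P l - P') \<bullet> P l"
      using h[OF l] by (auto simp: inner_diff_left power2_norm_eq_inner)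
    then have "norm (slow2 c0 (X l) + P' \<bullet> (- P l)) \<le> norm (P l - P') * norm (P l)"
      using Cauchy_Schwarz_ineq2[of "P l - P'" "P l"] by simp
    also have "\<dots> \<le> e * K"
      using e[OF l] n(1)[OF l] order_trans[OF norm_ge_zero e[OF l]] by (intro mult_mono) auto
    finally show "norm (slow2 c0 (X l) + P' \<bullet> (- P l)) \<le> K * e" by (simp add: mult.commute)
  qed (rule ab)
  then show ?thesis by (simp add: inner_diff_right)
qed

text \<open>The squared distance \<open>E\<close> in phase space satisfies E' \<le> 2 K E; the
  square root halves the rate.\<close>

lemma gronwall:
  assumes fb: "flow_bound c0 B K"
    and X: "hamiltonian_curve c0 0 m X P" "X ` {0..m} \<subseteq> B"
    and Y: "hamiltonian_curve c0 0 m Y Q" "Y ` {0..m} \<subseteq> B" and l: "l \<in> {0..m}"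
  shows "norm ((Y l, Q l) - (X l, P l)) \<le> exp (K * l) * norm ((Y 0, Q 0) - (X 0, P 0))"
proof (cases "l = 0")
  case False
  then have l0: "0 < l" using l by auto
  have K: "1 \<le> K" using fb by (simp add: flow_bound_def)
  define E where "E l = (Y l - X l) \<bullet> (Y l - X l) + (Q l - P l) \<bullet> (Q l - P l)" for l
  have E: "E l = (norm ((Y l, Q l) - (X l, P l)))\<^sup>2" for l
    by (simp add: E_def norm_prod_def power2_norm_eq_inner)
  let ?G = "gradient (slow2 c0)"
  define E' where "E' l = 2 * ((Y l - X l) \<bullet> (P l - Q l)) + (Q l - P l) \<bullet> (?G (X l) - ?G (Y l))" for l
  have d: "(E has_real_derivative E' x) (at x within {0..l})" if "x \<in> {0..l}" for x
  proof -
    have x: "x \<in> {0..m}" using that l by auto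
    have sub: "{0..l} \<subseteq> {0..m}" using l by auto
    note hX = X(1)[unfolded hamiltonian_curve_def, rule_format, OF x]
    note hY = Y(1)[unfolded hamiltonian_curve_def, rule_format, OF x]
    have "(E has_derivative (\<lambda>h. h *\<^sub>R E' x)) (at x within {0..l})"
      unfolding E_def E'_def
      using hX hY has_derivative_subset[OF _ sub] unfolding has_vector_derivative_def
      by (auto intro!: derivative_eq_intros simp: fun_eq_iff algebra_simps inner_commute)
    then show ?thesis by (simp add: has_field_derivative_def mult.commute[of _ "E' x"] fun_eq_iff)
  qed
  have bound: "E' x \<le> 2 * K * E x" if "x \<in> {0..l}" for x
  proof -
    have x: "x \<in> {0..m}" using that l by auto
    let ?a = "norm (Y x - X x)" and ?b = "norm (Q x - P x)"
    have xy: "X x \<in> B" "Y x \<in> B" using X(2) Y(2) x by auto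
    then have "norm (?G (X x) - ?G (Y x)) \<le> K * norm (X x - Y x)"
      using fb by (auto simp: flow_bound_def)
    then have "norm (?G (X x) - ?G (Y x)) \<le> K * ?a" by (simp add: norm_minus_commute)
    then have "(Q x - P x) \<bullet> (?G (X x) - ?G (Y x)) \<le> ?b * (K * ?a)"
      by (intro order_trans[OF norm_cauchy_schwarz] mult_left_mono) auto
    moreover have "(Y x - X x) \<bullet> (P x - Q x) \<le> ?a * ?b"
      using norm_cauchy_schwarz[of "Y x - X x" "P x - Q x"] by (simp add: norm_minus_commute)
    ultimately have "E' x \<le> (2 + K) * (?a * ?b)"
      by (simp add: E'_def algebra_simps)
    \<comment> \<open>Since K \<ge> 1, the factor 2 + K is at most 4 K, and the product is at most
      half the sum of squares.\<close>
    also have "\<dots> \<le> (4 * K) * ((?a\<^sup>2 + ?b\<^sup>2) / 2)"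
    proof (rule mult_mono)
      show "?a * ?b \<le> (?a\<^sup>2 + ?b\<^sup>2) / 2"
        using sum_squares_bound[of ?a ?b] by simp
    qed (use K in auto)
    also have "\<dots> = 2 * K * E x"
      by (simp add: E_def power2_norm_eq_inner)
    finally show ?thesis .
  qed
  \<comment> \<open>With the integrating factor exp(-2 K x) the inequality says that
    \<open>?F\<close> does not increase, which the mean value theorem turns into the claim.\<close>
  let ?F = "\<lambda>x. E x * exp (- (2 * K) * x)"
  have dF: "(?F has_derivative (*) ((E' x - 2 * K * E x) * exp (- (2 * K) * x))) (at x within {0..l})"
    if "0 \<le> x" "x \<le> l" for x
    unfolding has_field_derivative_def[symmetric]
    using that by (auto intro!: derivative_eq_intros d simp: algebra_simps)
  obtain x where x: "x \<in> {0<..<l}" "?F l - ?F 0 = ((E' x - 2 * K * E x) * exp (- (2 * K) * x)) * (l - 0)"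
    using mvt_simple[OF l0 dF] by blast
  have "?F l - ?F 0 \<le> 0"
    unfolding x(2) using bound[of x] x(1) by (intro mult_nonpos_nonneg) auto
  then have "E l * exp (- (2 * K) * l) * exp (2 * K * l) \<le> E 0 * exp (2 * K * l)"
    by (intro mult_right_mono) auto
  then have "E l \<le> E 0 * exp (2 * K * l)"
    by (simp add: mult.assoc flip: exp_add)
  also have "\<dots> = (exp (K * l) * norm ((Y 0, Q 0) - (X 0, P 0)))\<^sup>2"
    by (simp add: E power_mult_distrib exp_double[symmetric] mult.assoc mult.commute)
  finally show ?thesis
    unfolding E by (rule power2_le_imp_le) auto
qed auto

text \<open>The parameter length of a perturbed ray is controlled because the reference ray arrives
  transversally; after leaving the comparison interval the perturbed ray must soon cross the surface.\<close>

lemma ray_stability: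
  assumes c0: "sound_speed c0" and ng: "no_ray_grazes_surface c0"
    and h: "bicharacteristic c0 L X P" and X0: "X 0 \<in> subsurface" and XL: "X L $ 3 = 0"
  obtains R C \<delta> where "0 < \<delta>" "1 \<le> C" "X ` {0..L} \<subseteq> cball 0 R \<inter> half_space"
    "\<And>M Y Q. bicharacteristic c0 M Y Q \<Longrightarrow> Y M $ 3 = 0 \<Longrightarrow> norm ((Y 0, Q 0) - (X 0, P 0)) < \<delta> \<Longrightarrow>
       Y 0 \<in> subsurface \<and> Y ` {0..M} \<subseteq> cball 0 R \<inter> half_space \<and>
       \<bar>M - L\<bar> \<le> C * norm ((Y 0, Q 0) - (X 0, P 0)) \<and>
       (\<forall>l\<in>{0..min L M}. norm ((Y l, Q l) - (X l, P l)) \<le> C * norm ((Y 0, Q 0) - (X 0, P 0)))"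
proof -
  have L: "0 < L" and hcX: "hamiltonian_curve c0 0 L X P"
    using h c0 by (auto simp: bicharacteristic_iff)
  note hX = hcX[unfolded hamiltonian_curve_def, rule_format]
  have pos: "0 < X l $ 3" if "l \<in> {0..<L}" for l
    using positive_before_arrival(1)[OF c0 ng h X0 XL that] .
  define a where "a = P L $ 3"
  have a: "0 < a" using positive_before_arrival(2)[OF c0 ng h X0 XL] by (simp add: a_def)
  have contX: "continuous_on {0..L} X" and contP: "continuous_on {0..L} P"
    using hamiltonian_curve_continuous[OF hcX] by auto
  obtain R0 where R0: "\<And>l. l \<in> {0..L} \<Longrightarrow> norm (X l) \<le> R0"
    using compact_imp_bounded[OF compact_continuous_image[OF contX]] by (force simp: bounded_iff)
  \<comment> \<open>One unit of room for the deviation on the common parameter interval, another for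
    the overshoot of a perturbed ray that arrives later.\<close>
  define R where "R = R0 + 2"
  define B where "B = cball 0 R \<inter> (half_space :: (real^3) set)"
  obtain K where fb: "flow_bound c0 B K" using flow_bound_exists[OF c0] B_def by blast
  then have K: "1 \<le> K" by (simp add: flow_bound_def)
  have XB: "X ` {0..L} \<subseteq> B" using R0 hX by (force simp: B_def R_def)
  \<comment> \<open>The reference ray is split at L - \<epsilon>: afterwards it descends at rate at
    least a/2, and before that its height has a positive minimum \<mu>.\<close>
  have "\<exists>\<epsilon>>0. \<epsilon> < L \<and> (\<forall>l\<in>{L - \<epsilon>..L}. a / 2 \<le> P l $ 3)"
  proof -
    have "continuous_on {0..L} (\<lambda>l. P l $ 3)" using contP by (intro continuous_intros)
    then have "\<forall>x\<in>{0..L}. \<forall>e>0. \<exists>d>0. \<forall>x'\<in>{0..L}. dist x' x < d \<longrightarrow> dist (P x' $ 3) (P x $ 3) < e"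
      unfolding continuous_on_iff .
    from this[rule_format, of L "a / 2"]
    have "\<exists>d>0. \<forall>x'\<in>{0..L}. dist x' L < d \<longrightarrow> dist (P x' $ 3) (P L $ 3) < a / 2"
      using L a by simp
    then obtain d where d: "d > 0" "\<And>x. x \<in> {0..L} \<Longrightarrow> dist x L < d \<Longrightarrow> dist (P x $ 3) a < a / 2"
      by (auto simp: a_def)
    define \<epsilon> where "\<epsilon> = min d L / 2"
    have \<epsilon>: "0 < \<epsilon>" "\<epsilon> < d" "\<epsilon> < L" using d(1) L by (auto simp: \<epsilon>_def min_def)
    have "a / 2 \<le> P l $ 3" if "l \<in> {L - \<epsilon>..L}" for l
    proof -
      have "dist (P l $ 3) a < a / 2" using that \<epsilon> by (intro d(2)) (auto simp: dist_real_def)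
      then show ?thesis unfolding dist_real_def by linarith
    qed
    then show ?thesis using \<epsilon> by blast
  qed
  then obtain \<epsilon> where \<epsilon>: "0 < \<epsilon>" "\<epsilon> < L" "\<And>l. l \<in> {L - \<epsilon>..L} \<Longrightarrow> a / 2 \<le> P l $ 3" by blast
  have "\<exists>l0\<in>{0..L - \<epsilon>}. \<forall>l\<in>{0..L - \<epsilon>}. X l0 $ 3 \<le> X l $ 3"
    using \<epsilon> by (intro continuous_attains_inf continuous_intros continuous_on_subset[OF contX]) auto
  then obtain l0 where l0: "l0 \<in> {0..L - \<epsilon>}" "\<And>l. l \<in> {0..L - \<epsilon>} \<Longrightarrow> X l0 $ 3 \<le> X l $ 3" by blast
  define \<mu> where "\<mu> = X l0 $ 3"
  have \<mu>: "0 < \<mu>" "\<And>l. l \<in> {0..L - \<epsilon>} \<Longrightarrow> \<mu> \<le> X l $ 3"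
    using l0 \<epsilon> pos[of l0] by (auto simp: \<mu>_def)
  define C1 where "C1 = exp (K * L)"
  have C1: "1 \<le> C1" using K L by (simp add: C1_def)
  \<comment> \<open>The overshoot that is tolerated: K \<eta> \<le> 1/2 keeps the perturbed ray
    within one unit of its position at L, and K \<eta> \<le> a/4 limits the drift of its covector so
    that its descent rate stays at least a/2.\<close>
  define \<eta> where "\<eta> = min (1 / (2 * K)) (a / (4 * K))"
  have \<eta>: "0 < \<eta>" "K * \<eta> \<le> 1 / 2" "K * \<eta> \<le> a / 4"
  proof -
    show "0 < \<eta>" using a K by (simp add: \<eta>_def)
    have "\<eta> \<le> 1 / (2 * K)" "\<eta> \<le> a / (4 * K)"
      by (auto simp: \<eta>_def)
    then show "K * \<eta> \<le> 1 / 2" "K * \<eta> \<le> a / 4" using K by (simp_all add: field_simps)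
  qed
  \<comment> \<open>Each entry has its task: 1 keeps the rays close on the common interval, \<mu>
    excludes an early arrival, a/4 bounds the error of the descent rate at L, a \<eta>/2 makes the
    overshoot shorter than \<eta>, and the initial height keeps the perturbed start in the
    subsurface.\<close>
  define D0 where "D0 = Min {1, \<mu>, a / 4, a * \<eta> / 2, X 0 $ 3}"
  have D0: "0 < D0" "D0 \<le> 1" "D0 \<le> \<mu>" "D0 \<le> a / 4" "D0 \<le> a * \<eta> / 2" "D0 \<le> X 0 $ 3"
    using \<mu>(1) a \<eta>(1) X0 by (auto simp: D0_def subsurface_def)
  \<comment> \<open>The Gronwall factor \<open>C1\<close>, and the bound 2 D/a on the difference of
    the lengths with D = C1 d.\<close>
  define C where "C = max C1 (2 * C1 / a)"
  have C: "1 \<le> C" "C1 \<le> C" "2 * C1 / a \<le> C" using C1 by (auto simp: C_def)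
  show thesis
  proof (rule that[of "D0 / C1" C R])
    show "0 < D0 / C1" using D0 C1 by simp
    show "1 \<le> C" by fact
    show "X ` {0..L} \<subseteq> cball 0 R \<inter> half_space" using XB by (simp add: B_def)
    fix M Y Q
    assume hY: "bicharacteristic c0 M Y Q" and YM: "Y M $ 3 = 0"
      and close: "norm ((Y 0, Q 0) - (X 0, P 0)) < D0 / C1"
    define d where "d = norm ((Y 0, Q 0) - (X 0, P 0))"
    define D where "D = C1 * d"
    have d: "0 \<le> d" "d \<le> D" "D < D0" "0 \<le> D"
      using close C1 by (auto simp: d_def D_def field_simps mult_le_cancel_left1 intro: mult_right_mono[of 1 C1, simplified])
    have M: "0 < M" and hcY: "hamiltonian_curve c0 0 M Y Q"
      using hY c0 by (auto simp: bicharacteristic_iff)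
    note hYd = hcY[unfolded hamiltonian_curve_def, rule_format]
    have contY: "continuous_on {0..M} Y" using hamiltonian_curve_continuous[OF hcY] by auto
    have comp: "\<bar>(y :: real^3) $ i - x $ i\<bar> \<le> norm ((y, q) - (x, p))" for x y p q :: "real^3" and i
      using order_trans[OF component_le_norm_cart[of "y - x" i] norm_fst_le[of "y - x" "q - p"]] by simp
    have comp2: "\<bar>(q :: real^3) $ i - p $ i\<bar> \<le> norm ((y, q) - (x, p))" for x y p q :: "real^3" and i
      using order_trans[OF component_le_norm_cart[of "q - p" i] norm_snd_le[of "q - p" "y - x"]] by simp
    have nfst: "norm (y - x) \<le> norm ((y, q) - (x, p))" for x y p q :: "real^3"
      using norm_fst_le[of "y - x" "q - p"] by simp
    define m where "m = min L M"
    have m: "0 < m" "m \<le> L" "m \<le> M" using L M by (auto simp: m_def)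
    have gron: "norm ((Y l, Q l) - (X l, P l)) \<le> D" if "l \<in> {0..m}" "Y ` {0..l} \<subseteq> B" for l
    proof -
      have "norm ((Y l, Q l) - (X l, P l)) \<le> exp (K * l) * d"
        unfolding d_def
        using hamiltonian_curve_subinterval[OF hcX, of 0 l] hamiltonian_curve_subinterval[OF hcY, of 0 l] that m XB
        by (intro gronwall[OF fb, where m = l]) auto
      also have "\<dots> \<le> D"
        unfolding D_def C1_def using that m K d by (intro mult_right_mono) auto
      finally show ?thesis .
    qed
    \<comment> \<open>The Gronwall bound requires the perturbed ray to lie in \<open>B\<close>, and
      it lies there because of that bound; the bootstrap resolves the circle.\<close>
    have near: "norm (Y l - X l) < 1" if "l \<in> {0..m}" for l
    proof (rule bootstrap[where a = 0 and b = m and \<phi> = "\<lambda>l. norm (Y l - X l)"])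
      show "continuous_on {0..m} (\<lambda>l. norm (Y l - X l))"
        using m by (intro continuous_intros continuous_on_subset[OF contX] continuous_on_subset[OF contY]) auto
      show "norm (Y 0 - X 0) < 1"
        using nfst[of "Y 0" "X 0" "Q 0" "P 0"] d D0 by (simp add: d_def)
      fix l assume l: "l \<in> {0..m}" and le: "\<And>l'. l' \<in> {0..l} \<Longrightarrow> norm (Y l' - X l') \<le> 1"
      have "Y l' \<in> B" if "l' \<in> {0..l}" for l'
      proof -
        have "norm (Y l') \<le> R0 + 1"
          using le[OF that] R0[of l'] norm_triangle_sub[of "Y l'" "X l'"] that l m by auto
        then show ?thesis using hYd[of l'] that l m by (auto simp: B_def R_def)
      qed
      then have "norm ((Y l, Q l) - (X l, P l)) \<le> D" using gron[OF l] by (simp add: image_subset_iff)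
      then show "norm (Y l - X l) < 1" using nfst[of "Y l" "X l" "Q l" "P l"] d D0 by linarith
    qed (rule that)
    have YR: "norm (Y l) \<le> R0 + 1" if "l \<in> {0..m}" for l
      using near[OF that] R0[of l] norm_triangle_sub[of "Y l" "X l"] that m by auto
    have YB: "Y ` {0..m} \<subseteq> B"
      using YR hYd m by (force simp: B_def R_def)
    have est: "norm ((Y l, Q l) - (X l, P l)) \<le> D" if "l \<in> {0..m}" for l
      using gron[OF that] YB that by fastforce
    \<comment> \<open>Up to L - \<epsilon> the reference ray is higher than the distance between the
      rays, so the perturbed one cannot have reached the surface.\<close>
    have late: "L - \<epsilon> < M"
    proof (rule ccontr)
      assume "\<not> L - \<epsilon> < M"
      then have "m = M" "\<mu> \<le> X M $ 3" using \<mu>(2)[of M] M \<epsilon> by (auto simp: m_def)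
      moreover have "\<bar>Y m $ 3 - X m $ 3\<bar> \<le> D" using est[of m] comp[of "Y m" 3 "X m" "Q m" "P m"] m by auto
      ultimately show False using YM d D0 by auto
    qed
    have "\<bar>M - L\<bar> \<le> 2 * D / a \<and> Y ` {0..M} \<subseteq> B"
    proof (cases "M \<le> L")
      case True
      \<comment> \<open>The perturbed ray is on the surface at M, so the reference ray is there at
        height at most D, and it descends to 0 at rate at least a/2.\<close>
      have "a / 2 * (L - M) \<le> X M $ 3 - X L $ 3"
      proof (cases "M = L")
        case False
        then have less: "M < L" using True by simp
        have "((\<lambda>l. X l $ 3) has_derivative (*) (- P x $ 3)) (at x within {M..L})" if "M \<le> x" "x \<le> L" for x
          unfolding has_field_derivative_def[symmetric]
          using hX[of x] that M has_vector_derivative_nth[of X "- P x" "at x within {M..L}" 3]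
            has_vector_derivative_within_subset[of X "- P x" x "{0..L}" "{M..L}"] by auto
        from mvt_simple[OF less this]
        obtain x where x: "x \<in> {M<..<L}" "X L $ 3 - X M $ 3 = - P x $ 3 * (L - M)" by blast
        then have "a / 2 \<le> P x $ 3" using \<epsilon>(3)[of x] late by auto
        then have "a / 2 * (L - M) \<le> P x $ 3 * (L - M)" using less by (intro mult_right_mono) auto
        then show ?thesis using x(2) by simp
      qed simp
      moreover have "X M $ 3 \<le> D"
        using est[of M] comp[of "Y M" 3 "X M" "Q M" "P M"] YM M True by (auto simp: m_def)
      ultimately show ?thesis using XL a YB True by (auto simp: field_simps m_def)
    next
      case False
      then have LM: "L < M" and mL: "m = L" by (auto simp: m_def)
      \<comment> \<open>M has no a priori bound, so the overshoot is examined up to L + \<eta> only.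
        On that stretch the ray descends at rate at least a/2 from height at most D; as it cannot
        leave the half space, l1 - L < \<eta>, and hence l1 = M.\<close>
      define l1 where "l1 = min M (L + \<eta>)"
      have l1: "L < l1" "l1 \<le> M" "l1 \<le> L + \<eta>" using LM \<eta> by (auto simp: l1_def)
      have inB: "Y ` {L..l} \<subseteq> B" if l: "l \<in> {L..l1}" "\<And>l'. l' \<in> {L..l} \<Longrightarrow> norm (Y l' - Y L) \<le> 1" for l
      proof -
        have "norm (Y l') \<le> R" if "l' \<in> {L..l}" for l'
          using l(2)[OF that] YR[of L] mL L norm_triangle_sub[of "Y l'" "Y L"] by (auto simp: R_def)
        then show ?thesis using hYd l l1 L by (force simp: B_def)
      qed
      have small: "norm (Y l - Y L) < 1" if "l \<in> {L..l1}" for l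
      proof (rule bootstrap[where a = L and b = l1 and \<phi> = "\<lambda>l. norm (Y l - Y L)"])
        show "continuous_on {L..l1} (\<lambda>l. norm (Y l - Y L))"
          using l1 L by (intro continuous_intros continuous_on_subset[OF contY]) auto
        fix l assume l: "l \<in> {L..l1}" and le: "\<And>l'. l' \<in> {L..l} \<Longrightarrow> norm (Y l' - Y L) \<le> 1"
        have "norm (Y l - Y L) \<le> K * (l - L)"
          using hamiltonian_curve_subinterval[OF hcY, of L l] l l1 L inB[OF l le]
          by (intro hamiltonian_curve_increments(1)[OF fb]) auto
        also have "\<dots> \<le> K * \<eta>" using l l1 K by (intro mult_left_mono) auto
        finally show "norm (Y l - Y L) < 1" using \<eta> by linarith
      qed (use that in auto)
      have YB1: "Y ` {L..l} \<subseteq> B" if "l \<in> {L..l1}" for l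
        using that by (intro inB less_imp_le small) auto
      have hc1: "hamiltonian_curve c0 L l Y Q" if "l \<in> {L..l1}" for l
        using hamiltonian_curve_subinterval[OF hcY, of L l] that L l1 by auto
      have Q3: "a / 2 \<le> Q l $ 3" if l: "l \<in> {L..l1}" for l
      proof -
        have "norm (Q l - Q L) \<le> K * (l - L)"
          using l by (intro hamiltonian_curve_increments(2)[OF fb hc1[OF l] YB1[OF l]]) auto
        also have "\<dots> \<le> K * \<eta>" using l l1 K by (intro mult_left_mono) auto
        finally have "\<bar>Q l $ 3 - Q L $ 3\<bar> \<le> a / 4" using component_le_norm_cart[of "Q l - Q L" 3] \<eta> by simp
        moreover have "\<bar>Q L $ 3 - a\<bar> \<le> a / 4"
          using est[of L] comp2[of "Q L" 3 "P L" "Y L" "X L"] mL L d D0 by (simp add: a_def)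
        ultimately show ?thesis by linarith
      qed
      have "((\<lambda>l. Y l $ 3) has_derivative (*) (- Q x $ 3)) (at x within {L..l1})" if "L \<le> x" "x \<le> l1" for x
        unfolding has_field_derivative_def[symmetric]
        using hc1[of l1, unfolded hamiltonian_curve_def, rule_format, of x] that l1
          has_vector_derivative_nth[of Y "- Q x" "at x within {L..l1}" 3] by auto
      from mvt_simple[OF l1(1) this]
      obtain x where x: "x \<in> {L<..<l1}" "Y l1 $ 3 - Y L $ 3 = - Q x $ 3 * (l1 - L)" by blast
      have "a / 2 * (l1 - L) \<le> Q x $ 3 * (l1 - L)" using Q3[of x] x l1 by (intro mult_right_mono) auto
      moreover have "Y L $ 3 \<le> D"
        using est[of L] comp[of "Y L" 3 "X L" "Q L" "P L"] XL mL L by simp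
      moreover have "0 \<le> Y l1 $ 3" using hYd[of l1] l1 L by (auto simp: half_space_def)
      ultimately have le: "a / 2 * (l1 - L) \<le> D" using x(2) by linarith
      have "l1 - L < \<eta>"
      proof -
        have "a / 2 * (l1 - L) < a / 2 * \<eta>" using le d(3) D0(5) by linarith
        then show ?thesis using a by simp
      qed
      then have l1M: "l1 = M" by (auto simp: l1_def min_def split: if_splits)
      have "{0..M} \<subseteq> {0..L} \<union> {L..M}" by auto
      then have "Y ` {0..M} \<subseteq> B" using YB YB1[of l1] l1 l1M mL by (fastforce simp: image_subset_iff)
      moreover have "\<bar>M - L\<bar> \<le> 2 * D / a" using le l1M LM a by (simp add: field_simps)
      ultimately show ?thesis by blast
    qed
    moreover have "2 * D / a \<le> C * d"
      using mult_right_mono[OF C(3) d(1)] by (simp add: D_def)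
    moreover have "D \<le> C * d" using mult_right_mono[OF C(2) d(1)] by (simp add: D_def)
    moreover have "Y 0 \<in> subsurface"
      using comp[of "Y 0" 3 "X 0" "Q 0" "P 0"] d D0 by (auto simp: subsurface_def d_def)
    ultimately show "Y 0 \<in> subsurface \<and> Y ` {0..M} \<subseteq> cball 0 R \<inter> half_space \<and>
       \<bar>M - L\<bar> \<le> C * norm ((Y 0, Q 0) - (X 0, P 0)) \<and>
       (\<forall>l\<in>{0..min L M}. norm ((Y l, Q l) - (X l, P l)) \<le> C * norm ((Y 0, Q 0) - (X 0, P 0)))"
      using est unfolding B_def d_def[symmetric] m_def[symmetric] by (meson order_trans)
  qed
qed

section \<open>First variation of the travel time and arrival estimates\<close>

lemma norm_fst_diff_le: "norm (y - x) \<le> norm ((y, q) - (x, p))"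
  using norm_fst_le[of "y - x" "q - p"] by simp

lemma norm_snd_diff_le: "norm (q - p) \<le> norm ((y, q) - (x, p))"
  using norm_snd_le[of "q - p" "y - x"] by simp

lemma norm_Pair_diff_le: "norm ((y, q) - (x, p)) \<le> norm (y - x) + norm (q - p)"
  unfolding diff_Pair by (rule norm_Pair_le)

lemma norm_triangle_le3:
  "norm (a + b - c) \<le> norm a + norm b + norm c" "norm (a - b + c) \<le> norm a + norm b + norm c"
  using norm_triangle_ineq4[of "a + b" c] norm_triangle_ineq[of a b]
    norm_triangle_ineq[of "a - b" c] norm_triangle_ineq4[of a b] by linarith+

text \<open>First variation with fixed parameter length: along the flow the derivative of P . (Y -
  X) cancels the linear part of the change of slow2, and a quadratic error integrates over
  [0, m].\<close>

lemma travel_time_comparison: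
  assumes c0: "sound_speed c0" and fb: "flow_bound c0 B K" and m: "0 \<le> m"
    and X: "hamiltonian_curve c0 0 m X P" "X ` {0..m} \<subseteq> B"
    and Y: "hamiltonian_curve c0 0 m Y Q" "Y ` {0..m} \<subseteq> B"
    and D: "\<And>l. l \<in> {0..m} \<Longrightarrow> norm ((Y l, Q l) - (X l, P l)) \<le> D"
  shows "\<bar>integral {0..m} (\<lambda>l. slow2 c0 (Y l)) - integral {0..m} (\<lambda>l. slow2 c0 (X l))
     + P m \<bullet> (Y m - X m) - P 0 \<bullet> (Y 0 - X 0)\<bar> \<le> K * D\<^sup>2 * m"
proof -
  have K: "1 \<le> K" using fb by (simp add: flow_bound_def)
  let ?G = "gradient (slow2 c0)"
  let ?F = "\<lambda>u. integral {0..u} (\<lambda>l. slow2 c0 (Y l)) - integral {0..u} (\<lambda>l. slow2 c0 (X l)) + P u \<bullet> (Y u - X u)"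
  let ?F' = "\<lambda>l. slow2 c0 (Y l) - slow2 c0 (X l) + (P l \<bullet> (- Q l - (- P l)) + (- (1/2) *\<^sub>R ?G (X l)) \<bullet> (Y l - X l))"
  have "norm (?F m - ?F 0) \<le> (K * D\<^sup>2) * (m - 0)"
  proof (rule norm_increment_le[where f' = ?F'])
    fix l assume l: "l \<in> {0..m}"
    note hX = X(1)[unfolded hamiltonian_curve_def, rule_format, OF l]
    note hY = Y(1)[unfolded hamiltonian_curve_def, rule_format, OF l]
    show "(?F has_vector_derivative ?F' l) (at l within {0..m})"
      using hX hY l
      by (intro has_vector_derivative_add has_vector_derivative_diff integral_has_vector_derivative
          hamiltonian_curve_slow2_continuous[OF c0 X(1)] hamiltonian_curve_slow2_continuous[OF c0 Y(1)]
          bounded_bilinear.has_vector_derivative[OF bounded_bilinear_inner]) auto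
    define T where "T = slow2 c0 (Y l) - slow2 c0 (X l) - ?G (X l) \<bullet> (Y l - X l)"
    \<comment> \<open>Half of the increment of slow2 is expanded by Taylor; its linear term cancels.
      The other half, written as (|Q|^2 - |P|^2)/2 by the eikonal equation, completes the square
      with P . (P - Q).\<close>
    have F': "?F' l = (1/2) * T + (1/2) * (norm (Q l - P l))\<^sup>2"
      using hX hY unfolding power2_norm_eq_inner T_def by (simp add: inner_diff inner_commute algebra_simps)
    have xy: "X l \<in> B" "Y l \<in> B" using X(2) Y(2) l by auto
    then have T: "\<bar>T\<bar> \<le> K * (norm (Y l - X l))\<^sup>2"
      unfolding T_def using fb by (auto simp: flow_bound_def)
    have sq: "(norm (Y l - X l))\<^sup>2 \<le> D\<^sup>2" "(norm (Q l - P l))\<^sup>2 \<le> D\<^sup>2"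
      using order_trans[OF norm_fst_diff_le D[OF l]] order_trans[OF norm_snd_diff_le D[OF l]]
      by (auto intro: power_mono)
    have KD: "K * (norm (Y l - X l))\<^sup>2 \<le> K * D\<^sup>2" "1 * D\<^sup>2 \<le> K * D\<^sup>2"
      using sq(1) K by (intro mult_left_mono mult_right_mono; simp)+
    have "\<bar>(1/2) * T + (1/2) * (norm (Q l - P l))\<^sup>2\<bar> \<le> K * D\<^sup>2"
      using T sq(2) KD zero_le_power2[of "norm (Q l - P l)"] by linarith
    then show "norm (?F' l) \<le> K * D\<^sup>2"
      unfolding F' real_norm_def .
  qed (rule m)
  then show ?thesis by simp
qed

text \<open>The restriction on a makes K a at most 1/(2 K), so at least half of the speed bound 1/K
  survives in the chord estimate.\<close>

lemma head_length_le:
  assumes fb: "flow_bound c0 B K" and hc: "hamiltonian_curve c0 0 a X P" and B: "X ` {0..a} \<subseteq> B"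
    and a: "0 \<le> a" "a \<le> 1 / (2 * K\<^sup>2)"
  shows "a \<le> 2 * K * norm (X a - X 0)"
proof -
  have K: "1 \<le> K" using fb by (simp add: flow_bound_def)
  have "K * a \<le> 1 / (2 * K)"
    using mult_left_mono[OF a(2), of K] K by (simp add: power2_eq_square)
  then have "1 / (2 * K) \<le> 1 / K - K * a" using K by (simp add: field_simps)
  then have "a * (1 / (2 * K)) \<le> a * (1 / K - K * a)" using a(1) by (rule mult_left_mono)
  also have "\<dots> \<le> norm (X a - X 0)"
    using hamiltonian_curve_increments(3)[OF fb hc B a(1)] by simp
  finally show ?thesis using K by (simp add: field_simps)
qed

text \<open>The second estimate is the first variation formula for the travel time. Together the three
  estimates replace the smooth dependence of rays on their initial data.\<close>

definition arrival_estimates ::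
    "(real^3 \<Rightarrow> real) \<Rightarrow> real \<Rightarrow> real \<Rightarrow> real^3 \<Rightarrow> real^3 \<Rightarrow> real \<Rightarrow> real^3 \<Rightarrow> real^3 \<Rightarrow> bool"
  where "arrival_estimates c0 C \<delta> x0 p0 t0 y0 q0 \<longleftrightarrow> 0 \<le> C \<and> 0 < \<delta> \<and>
    (\<forall>x p t y q. ray c0 (x, p) t (y, q) \<and> y $ 3 = 0 \<and> norm ((x, p) - (x0, p0)) < \<delta> \<longrightarrow>
       norm ((y, q) - (y0, q0)) \<le> C * norm ((x, p) - (x0, p0)) \<and>
       \<bar>t - t0 - (p0 \<bullet> (x - x0) - q0 \<bullet> (y - y0))\<bar> \<le> C * (norm ((x, p) - (x0, p0)))\<^sup>2 \<and>
       norm (p - p0) \<le> C * (norm (x - x0) + norm (y - y0) + \<bar>q $ 1 - q0 $ 1\<bar> + \<bar>q $ 2 - q0 $ 2\<bar>))"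

lemma arrival_estimatesD:
  assumes "arrival_estimates c0 C \<delta> x0 p0 t0 y0 q0"
  shows "0 \<le> C" "0 < \<delta>"
    and "ray c0 (x, p) t (y, q) \<Longrightarrow> y $ 3 = 0 \<Longrightarrow> norm ((x, p) - (x0, p0)) < \<delta> \<Longrightarrow>
       norm ((y, q) - (y0, q0)) \<le> C * norm ((x, p) - (x0, p0))"
    and "ray c0 (x, p) t (y, q) \<Longrightarrow> y $ 3 = 0 \<Longrightarrow> norm ((x, p) - (x0, p0)) < \<delta> \<Longrightarrow>
       \<bar>t - t0 - (p0 \<bullet> (x - x0) - q0 \<bullet> (y - y0))\<bar> \<le> C * (norm ((x, p) - (x0, p0)))\<^sup>2"
    and "ray c0 (x, p) t (y, q) \<Longrightarrow> y $ 3 = 0 \<Longrightarrow> norm ((x, p) - (x0, p0)) < \<delta> \<Longrightarrow>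
       norm (p - p0) \<le> C * (norm (x - x0) + norm (y - y0) + \<bar>q $ 1 - q0 $ 1\<bar> + \<bar>q $ 2 - q0 $ 2\<bar>)"
  using assms unfolding arrival_estimates_def by auto

text \<open>Both rays are compared on their common parameter interval; the piece left over has
  length at most D = C d by \<open>ray_stability\<close>. The last estimate compares the rays
  backwards from their arrival points, where all components of q are first recovered from
  two.\<close>

lemma ray_arrival:
  assumes c0: "sound_speed c0" and ng: "no_ray_grazes_surface c0"
    and ref: "ray c0 (x0, p0) t0 (y0, q0)" and x0: "x0 \<in> subsurface" and y0: "y0 $ 3 = 0"
  obtains C \<delta> where "arrival_estimates c0 C \<delta> x0 p0 t0 y0 q0"
proof -
  obtain L X P where h: "bicharacteristic c0 L X P" and X: "X 0 = x0" "P 0 = p0" "X L = y0" "P L = q0"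
    and t0: "t0 = travel_time c0 L X"
    using ref by (auto simp: ray_def)
  have L: "0 < L" and hcX: "hamiltonian_curve c0 0 L X P"
    using h c0 by (auto simp: bicharacteristic_iff)
  have X0: "X 0 \<in> subsurface" and XL: "X L $ 3 = 0" using X x0 y0 by auto
  define a where "a = P L $ 3"
  have a: "0 < a" using positive_before_arrival(2)[OF c0 ng h X0 XL] by (simp add: a_def)
  obtain R C \<delta> where \<delta>: "0 < \<delta>" and C: "1 \<le> C" and XR: "X ` {0..L} \<subseteq> cball 0 R \<inter> half_space"
    and stab: "\<And>M Y Q. bicharacteristic c0 M Y Q \<Longrightarrow> Y M $ 3 = 0 \<Longrightarrow> norm ((Y 0, Q 0) - (X 0, P 0)) < \<delta> \<Longrightarrow>
       Y 0 \<in> subsurface \<and> Y ` {0..M} \<subseteq> cball 0 R \<inter> half_space \<and>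
       \<bar>M - L\<bar> \<le> C * norm ((Y 0, Q 0) - (X 0, P 0)) \<and>
       (\<forall>l\<in>{0..min L M}. norm ((Y l, Q l) - (X l, P l)) \<le> C * norm ((Y 0, Q 0) - (X 0, P 0)))"
    using ray_stability[OF c0 ng h X0 XL] by metis
  define B where "B = cball 0 R \<inter> (half_space :: (real^3) set)"
  obtain K where fb: "flow_bound c0 B K" using flow_bound_exists[OF c0] B_def by blast
  then have K: "1 \<le> K" by (simp add: flow_bound_def)
  have XB: "X ` {0..L} \<subseteq> B" using XR by (simp add: B_def)
  define C1 where "C1 = exp (K * L)"
  have C1: "1 \<le> C1" using K L by (simp add: C1_def)
  define C2 where "C2 = 1 + 4 * K + K / a + 2 * K / a"
  have C2: "0 < C2" "0 \<le> C2" using K a by (auto simp: C2_def add_pos_nonneg)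
  define A1 where "A1 = (4 * K + 2) * C"
  define A2 where "A2 = (K * L + 2 * K * (2 * K + 1) + K) * C\<^sup>2"
  define A3 where "A3 = (4 * K\<^sup>2 + 1) * (C1 * C2 + 1)"
  define CC where "CC = A1 + A2 + A3"
  have pos: "0 \<le> A1" "0 \<le> A2" "0 \<le> A3" using K L C C1 C2 by (auto simp: A1_def A2_def A3_def)
  \<comment> \<open>The second entry gives D \<le> 1/(2 K^2), so that \<open>head_length_le\<close>
    applies to the left-over piece.\<close>
  define \<delta>' where "\<delta>' = min \<delta> (1 / (2 * K\<^sup>2 * C))"
  have \<delta>': "0 < \<delta>'" using \<delta> K C by (simp add: \<delta>'_def)
  have main: "norm ((y, q) - (y0, q0)) \<le> A1 * d \<and>
       \<bar>t - t0 - (p0 \<bullet> (x - x0) - q0 \<bullet> (y - y0))\<bar> \<le> A2 * d\<^sup>2 \<and>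
       norm (p - p0) \<le> A3 * (norm (x - x0) + norm (y - y0) + \<bar>q $ 1 - q0 $ 1\<bar> + \<bar>q $ 2 - q0 $ 2\<bar>)"
    if r: "ray c0 (x, p) t (y, q)" and y3: "y $ 3 = 0" and d: "d = norm ((x, p) - (x0, p0))" "d < \<delta>'"
    for x p t y q d
  proof -
    obtain M Y Q where hY: "bicharacteristic c0 M Y Q" and Y: "Y 0 = x" "Q 0 = p" "Y M = y" "Q M = q"
      and t: "t = travel_time c0 M Y"
      using r by (auto simp: ray_def)
    have M: "0 < M" and hcY: "hamiltonian_curve c0 0 M Y Q"
      using hY c0 by (auto simp: bicharacteristic_iff)
    have YM: "Y M $ 3 = 0" using Y y3 by simp
    define D where "D = C * d"
    have D: "0 \<le> D" using d C by (simp add: D_def)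
    have s: "Y 0 \<in> subsurface" "Y ` {0..M} \<subseteq> B" "\<bar>M - L\<bar> \<le> D"
      and est: "\<And>l. l \<in> {0..min L M} \<Longrightarrow> norm ((Y l, Q l) - (X l, P l)) \<le> D"
      using stab[OF hY YM] d X Y by (auto simp: B_def D_def \<delta>'_def)
    define m where "m = min L M"
    have m: "0 < m" "m \<le> L" "m \<le> M" "L - m \<le> D" "M - m \<le> D" "m = L \<or> m = M"
      using L M s(3) by (auto simp: m_def)
    have hcXm: "hamiltonian_curve c0 m L X P" and hcYm: "hamiltonian_curve c0 m M Y Q"
      and hcX0: "hamiltonian_curve c0 0 m X P" and hcY0: "hamiltonian_curve c0 0 m Y Q"
      using hamiltonian_curve_subinterval[OF hcX] hamiltonian_curve_subinterval[OF hcY] m by auto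
    have XBm: "X ` {m..L} \<subseteq> B" and YBm: "Y ` {m..M} \<subseteq> B" and XB0: "X ` {0..m} \<subseteq> B" and YB0: "Y ` {0..m} \<subseteq> B"
      using XB s(2) m by (auto simp: image_subset_iff)
    have KD: "K * (L - m) \<le> K * D" "K * (M - m) \<le> K * D"
      using m K by (auto intro: mult_left_mono)
    have tX: "norm (X L - X m) \<le> K * D" "norm (P L - P m) \<le> K * D"
      using hamiltonian_curve_increments(1,2)[OF fb hcXm XBm m(2)] KD by auto
    have tY: "norm (Y M - Y m) \<le> K * D" "norm (Q M - Q m) \<le> K * D"
      using hamiltonian_curve_increments(1,2)[OF fb hcYm YBm m(3)] KD by auto
    have em: "norm (Y m - X m) \<le> D" "norm (Q m - P m) \<le> D"
      using order_trans[OF norm_fst_diff_le est[of m]] order_trans[OF norm_snd_diff_le est[of m]] m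
      by (auto simp: m_def)
    have yq: "norm (y - y0) \<le> 2 * K * D + D" "norm (q - q0) \<le> 2 * K * D + D"
    proof -
      have eq: "y - y0 = (Y M - Y m) + (Y m - X m) - (X L - X m)" "q - q0 = (Q M - Q m) + (Q m - P m) - (P L - P m)"
        using X Y by simp_all
      show "norm (y - y0) \<le> 2 * K * D + D" "norm (q - q0) \<le> 2 * K * D + D"
        using tX tY em norm_triangle_le3(1)[of "Y M - Y m" "Y m - X m" "X L - X m"]
          norm_triangle_le3(1)[of "Q M - Q m" "Q m - P m" "P L - P m"] unfolding eq by linarith+
    qed
    have 1: "norm ((y, q) - (y0, q0)) \<le> A1 * d"
      using order_trans[OF norm_Pair_diff_le add_mono[OF yq]] by (simp add: A1_def D_def algebra_simps)
    have 2: "\<bar>t - t0 - (p0 \<bullet> (x - x0) - q0 \<bullet> (y - y0))\<bar> \<le> A2 * d\<^sup>2"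
    proof -
      define IX where "IX u v = integral {u..v} (\<lambda>l. slow2 c0 (X l))" for u v
      define IY where "IY u v = integral {u..v} (\<lambda>l. slow2 c0 (Y l))" for u v
      have ti: "t0 = IX 0 m + IX m L" "t = IY 0 m + IY m M"
        unfolding t0 t travel_time_eq[OF c0 h] travel_time_eq[OF c0 hY] IX_def IY_def
        using m hamiltonian_curve_slow2_continuous[OF c0 hcX] hamiltonian_curve_slow2_continuous[OF c0 hcY]
        by (auto intro!: Henstock_Kurzweil_Integration.integral_combine[symmetric] integrable_continuous_real)
      have PL: "norm (P l - P L) \<le> K * D" if l: "l \<in> {m..L}" for l
      proof -
        have "norm (P L - P l) \<le> K * (L - l)"
          using l m XB hamiltonian_curve_subinterval[OF hcX, of l L]
          by (intro hamiltonian_curve_increments(2)[OF fb]) auto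
        also have "\<dots> \<le> K * D" using l m K by (intro mult_left_mono) auto
        finally show ?thesis by (simp add: norm_minus_commute)
      qed
      have QL: "norm (Q l - P L) \<le> (2 * K + 1) * D" if l: "l \<in> {m..M}" for l
      proof -
        have "norm (Q l - Q m) \<le> K * (l - m)"
          using l m s(2) hamiltonian_curve_subinterval[OF hcY, of m l]
          by (intro hamiltonian_curve_increments(2)[OF fb]) auto
        also have "\<dots> \<le> K * D" using l m K by (intro mult_left_mono) auto
        finally have "norm (Q l - Q m) \<le> K * D" .
        moreover have eq: "Q l - Q m + (Q m - P m) - (P L - P m) = Q l - P L" by simp
        ultimately have "norm (Q l - P L) \<le> K * D + D + K * D"
          using em(2) tX(2) norm_triangle_le3(1)[of "Q l - Q m" "Q m - P m" "P L - P m"]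
          unfolding eq by linarith
        then show ?thesis by (simp add: algebra_simps)
      qed
      have "\<bar>IX m L + P L \<bullet> (X L - X m)\<bar> \<le> K * (K * D) * (L - m)"
        unfolding IX_def by (rule travel_time_increment[OF c0 fb hcXm XBm m(2) PL])
      also have "\<dots> \<le> K * (K * D) * D" using m K D by (intro mult_left_mono) auto
      finally have e2: "\<bar>IX m L + P L \<bullet> (X L - X m)\<bar> \<le> K * (K * D) * D" .
      have "\<bar>IY m M + P L \<bullet> (Y M - Y m)\<bar> \<le> K * ((2 * K + 1) * D) * (M - m)"
        unfolding IY_def by (rule travel_time_increment[OF c0 fb hcYm YBm m(3) QL])
      also have "\<dots> \<le> K * ((2 * K + 1) * D) * D" using m K D by (intro mult_left_mono) auto
      finally have e3: "\<bar>IY m M + P L \<bullet> (Y M - Y m)\<bar> \<le> K * ((2 * K + 1) * D) * D" .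
      have "\<bar>IY 0 m - IX 0 m + P m \<bullet> (Y m - X m) - P 0 \<bullet> (Y 0 - X 0)\<bar> \<le> K * D\<^sup>2 * m"
        unfolding IX_def IY_def
        using est m by (intro travel_time_comparison[OF c0 fb _ hcX0 XB0 hcY0 YB0]) (auto simp: m_def)
      also have "\<dots> \<le> K * D\<^sup>2 * L" using m K by (intro mult_left_mono) auto
      finally have e1: "\<bar>IY 0 m - IX 0 m + P m \<bullet> (Y m - X m) - P 0 \<bullet> (Y 0 - X 0)\<bar> \<le> K * D\<^sup>2 * L" .
      have e4: "\<bar>(P L - P m) \<bullet> (Y m - X m)\<bar> \<le> K * D * D"
        using tX em K D by (intro order_trans[OF Cauchy_Schwarz_ineq2] mult_mono) auto
      \<comment> \<open>The common stretch, the two end pieces with covector frozen at P L, and a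
        correction for having P m in place of P L at the junction; each is quadratic in D.\<close>
      have "t - t0 - (p0 \<bullet> (x - x0) - q0 \<bullet> (y - y0)) =
          (IY 0 m - IX 0 m + P m \<bullet> (Y m - X m) - P 0 \<bullet> (Y 0 - X 0)) + (IY m M + P L \<bullet> (Y M - Y m))
          - (IX m L + P L \<bullet> (X L - X m)) + (P L - P m) \<bullet> (Y m - X m)"
        unfolding ti X[symmetric] Y[symmetric] by (simp add: inner_diff algebra_simps)
      then have "\<bar>t - t0 - (p0 \<bullet> (x - x0) - q0 \<bullet> (y - y0))\<bar>
          \<le> K * D\<^sup>2 * L + K * ((2 * K + 1) * D) * D + K * (K * D) * D + K * D * D"
        using e1 e2 e3 e4 by linarith
      also have "\<dots> = (K * L + K * (2 * K + 1) + K * K + K) * D\<^sup>2"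
        by (simp add: power2_eq_square algebra_simps)
      also have "\<dots> \<le> (K * L + 2 * K * (2 * K + 1) + K) * D\<^sup>2"
        using K by (intro mult_right_mono) (auto simp: algebra_simps)
      finally show ?thesis by (simp add: A2_def D_def power_mult_distrib algebra_simps)
    qed
    define E3 where "E3 = norm (y - y0) + \<bar>q $ 1 - q0 $ 1\<bar> + \<bar>q $ 2 - q0 $ 2\<bar>"
    have E3: "0 \<le> E3" by (simp add: E3_def)
    \<comment> \<open>\<open>E3\<close> omits the third component of q. By the eikonal equation its
      square is determined by y and the other two components, and the sum of the two third
      components is at least a > 0, so the difference of the squares controls the difference
      itself.\<close>
    have e': "norm (y - y0) + norm (q - q0) \<le> C2 * E3"
    proof -
      have inB: "y \<in> B" "y0 \<in> B" using s(2) XB M L X Y by force+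
      have q3: "0 < q $ 3" using positive_before_arrival(2)[OF c0 ng hY s(1) YM] Y by simp
      have n: "(norm q)\<^sup>2 = slow2 c0 y" "(norm q0)\<^sup>2 = slow2 c0 y0"
        using hcX[unfolded hamiltonian_curve_def, rule_format, of L] hcY[unfolded hamiltonian_curve_def, rule_format, of M] X Y L M
        by auto
      have nK: "norm q \<le> K" "norm q0 \<le> K"
        using hamiltonian_curve_norm_le(1)[OF fb hcX XB, of L] hamiltonian_curve_norm_le(1)[OF fb hcY s(2), of M] X Y L M by auto
      have sq: "(norm v)\<^sup>2 = (v $ 1)\<^sup>2 + (v $ 2)\<^sup>2 + (v $ 3)\<^sup>2" for v :: "real^3"
        unfolding power2_norm_eq_inner by (simp add: inner_vec_def sum_3 power2_eq_square)
      have prod: "\<bar>(q $ i)\<^sup>2 - (q0 $ i)\<^sup>2\<bar> \<le> 2 * K * \<bar>q $ i - q0 $ i\<bar>" for i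
      proof -
        have "(q $ i)\<^sup>2 - (q0 $ i)\<^sup>2 = (q $ i + q0 $ i) * (q $ i - q0 $ i)"
          by (simp add: power2_eq_square algebra_simps)
        moreover have "\<bar>q $ i + q0 $ i\<bar> \<le> 2 * K"
          using component_le_norm_cart[of q i] component_le_norm_cart[of q0 i] nK by linarith
        ultimately show ?thesis by (simp add: abs_mult mult_right_mono)
      qed
      have "\<bar>q $ 3 - q0 $ 3\<bar> * a \<le> \<bar>q $ 3 - q0 $ 3\<bar> * (q $ 3 + q0 $ 3)"
        using q3 X by (intro mult_left_mono) (auto simp: a_def)
      also have "\<dots> = \<bar>(q $ 3)\<^sup>2 - (q0 $ 3)\<^sup>2\<bar>"
        using q3 a X by (simp add: a_def power2_eq_square square_diff_square_factored abs_mult)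
      also have "\<dots> \<le> \<bar>slow2 c0 y - slow2 c0 y0\<bar> + \<bar>(q $ 1)\<^sup>2 - (q0 $ 1)\<^sup>2\<bar> + \<bar>(q $ 2)\<^sup>2 - (q0 $ 2)\<^sup>2\<bar>"
        using n sq[of q] sq[of q0] by linarith
      also have "\<bar>slow2 c0 y - slow2 c0 y0\<bar> \<le> K * norm (y - y0)" using fb inB by (auto simp: flow_bound_def)
      finally have "\<bar>q $ 3 - q0 $ 3\<bar> * a \<le> K * norm (y - y0) + 2 * K * \<bar>q $ 1 - q0 $ 1\<bar> + 2 * K * \<bar>q $ 2 - q0 $ 2\<bar>"
        using prod[of 1] prod[of 2] by linarith
      also have "\<dots> \<le> (K + 2 * K) * E3"
        using K by (simp add: E3_def algebra_simps)
      finally have "\<bar>q $ 3 - q0 $ 3\<bar> \<le> (K + 2 * K) * E3 / a" using a by (simp add: field_simps)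
      moreover have "norm (q - q0) \<le> \<bar>q $ 1 - q0 $ 1\<bar> + \<bar>q $ 2 - q0 $ 2\<bar> + \<bar>q $ 3 - q0 $ 3\<bar>"
        using norm_le_l1_cart[of "q - q0"] by (simp add: sum_3)
      ultimately have "norm (y - y0) + norm (q - q0) \<le> E3 + (K + 2 * K) * E3 / a" by (simp add: E3_def)
      also have "\<dots> \<le> C2 * E3"
        using K E3 by (simp add: C2_def algebra_simps add_divide_distrib)
      finally show ?thesis .
    qed
    have 3: "norm (p - p0) \<le> A3 * (norm (x - x0) + norm (y - y0) + \<bar>q $ 1 - q0 $ 1\<bar> + \<bar>q $ 2 - q0 $ 2\<bar>)"
    proof -
      \<comment> \<open>The reversed rays start together at the arrival points and are followed for
        the common length m. What remains to reach x and x0 is a piece at the beginning of at most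
        one of them.\<close>
      have rX: "hamiltonian_curve c0 0 m (\<lambda>l. X (L - l)) (\<lambda>l. - P (L - l))"
        using hamiltonian_curve_subinterval[OF hamiltonian_curve_reverse[OF hcX, of L], of 0 m] m by simp
      have rY: "hamiltonian_curve c0 0 m (\<lambda>l. Y (M - l)) (\<lambda>l. - Q (M - l))"
        using hamiltonian_curve_subinterval[OF hamiltonian_curve_reverse[OF hcY, of M], of 0 m] m by simp
      have rXB: "(\<lambda>l. X (L - l)) ` {0..m} \<subseteq> B" and rYB: "(\<lambda>l. Y (M - l)) ` {0..m} \<subseteq> B"
        using XB s(2) m by (auto simp: image_subset_iff)
      have "norm ((Y (M - m), - Q (M - m)) - (X (L - m), - P (L - m)))
          \<le> exp (K * m) * norm ((Y M, - Q M) - (X L, - P L))"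
        using gronwall[OF fb rX rXB rY rYB, of m] m by simp
      also have "\<dots> \<le> C1 * (norm (y - y0) + norm (q - q0))"
      proof (rule mult_mono)
        show "exp (K * m) \<le> C1" using m K by (simp add: C1_def)
        show "norm ((Y M, - Q M) - (X L, - P L)) \<le> norm (y - y0) + norm (q - q0)"
          using norm_Pair_diff_le[of "Y M" "- Q M" "X L" "- P L"] X Y by (simp add: norm_minus_commute)
      qed (use C1 in auto)
      also have "\<dots> \<le> C1 * (C2 * E3)" using e' C1 by (intro mult_left_mono) auto
      finally have backw: "norm ((Y (M - m), - Q (M - m)) - (X (L - m), - P (L - m))) \<le> C1 * C2 * E3" by simp
      have bX: "norm (Y (M - m) - X (L - m)) \<le> C1 * C2 * E3"
        using order_trans[OF norm_fst_diff_le backw] .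
      have bP: "norm (Q (M - m) - P (L - m)) \<le> C1 * C2 * E3"
        using order_trans[OF norm_snd_diff_le backw] by (simp add: norm_minus_commute)
      have DK: "D \<le> 1 / (2 * K\<^sup>2)"
        using d(2) K C by (simp add: D_def \<delta>'_def field_simps)
      define W where "W = C1 * C2 * E3 + norm (x - x0)"
      \<comment> \<open>One of the two summands vanishes. The other is bounded by the displacement
        along that initial piece, which is already known to be small in terms of \<open>E3\<close>
        and the distance of x from x0.\<close>
      have len: "(M - m) + (L - m) \<le> 2 * K * W"
        using m(6)
      proof
        assume m_L: "m = L"
        have "M - m \<le> 2 * K * norm (Y (M - m) - Y 0)"
          using hamiltonian_curve_subinterval[OF hcY, of 0 "M - m"] s(2) m DK
          by (intro head_length_le[OF fb, where P = Q]) (auto simp: image_subset_iff)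
        also have "norm (Y (M - m) - Y 0) \<le> W"
          using bX norm_triangle_ineq4[of "Y (M - m) - X 0" "Y 0 - X 0"] m_L X Y by (simp add: W_def)
        finally show ?thesis using m_L K by simp
      next
        assume m_M: "m = M"
        have "L - m \<le> 2 * K * norm (X (L - m) - X 0)"
          using hamiltonian_curve_subinterval[OF hcX, of 0 "L - m"] XB m DK
          by (intro head_length_le[OF fb, where P = P]) (auto simp: image_subset_iff)
        also have "norm (X (L - m) - X 0) \<le> W"
          using bX norm_triangle_ineq4[of "Y 0 - X 0" "Y 0 - X (L - m)"] m_M X Y by (simp add: W_def)
        finally show ?thesis using m_M K by simp
      qed
      have "norm (Q (M - m) - Q 0) \<le> K * ((M - m) - 0)"
        using hamiltonian_curve_subinterval[OF hcY, of 0 "M - m"] s(2) m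
        by (intro hamiltonian_curve_increments(2)[OF fb]) (auto simp: image_subset_iff)
      moreover have "norm (P (L - m) - P 0) \<le> K * ((L - m) - 0)"
        using hamiltonian_curve_subinterval[OF hcX, of 0 "L - m"] XB m
        by (intro hamiltonian_curve_increments(2)[OF fb]) (auto simp: image_subset_iff)
      moreover have "p - p0 = (Q (M - m) - P (L - m)) - (Q (M - m) - Q 0) + (P (L - m) - P 0)"
        using X Y by simp
      ultimately have "norm (p - p0) \<le> C1 * C2 * E3 + K * (M - m) + K * (L - m)"
        using bP norm_triangle_le3(2)[of "Q (M - m) - P (L - m)" "Q (M - m) - Q 0" "P (L - m) - P 0"] by simp
      also have "\<dots> = C1 * C2 * E3 + K * ((M - m) + (L - m))" by (simp add: algebra_simps)
      also have "\<dots> \<le> W + K * (2 * K * W)"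
        using len K by (intro add_mono mult_left_mono) (auto simp: W_def)
      also have "\<dots> = (2 * K\<^sup>2 + 1) * W" by (simp add: power2_eq_square algebra_simps)
      also have "\<dots> \<le> (4 * K\<^sup>2 + 1) * ((C1 * C2 + 1) * (norm (x - x0) + E3))"
      proof (rule mult_mono)
        have "0 \<le> C1 * C2" using C1 C2 by simp
        then have "0 \<le> (C1 * C2) * norm (x - x0)" by simp
        then show "W \<le> (C1 * C2 + 1) * (norm (x - x0) + E3)"
          unfolding W_def distrib_left distrib_right using E3 by simp
        show "0 \<le> W" using \<open>0 \<le> C1 * C2\<close> E3 by (simp add: W_def)
      qed auto
      finally show ?thesis by (simp add: A3_def E3_def algebra_simps)
    qed
    show ?thesis using 1 2 3 by blast
  qed
  have le: "A1 * z \<le> CC * z" "A2 * z \<le> CC * z" "A3 * z \<le> CC * z" if "0 \<le> z" for z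
    using that pos by (auto simp: CC_def intro!: mult_right_mono)
  have "arrival_estimates c0 CC \<delta>' x0 p0 t0 y0 q0"
    unfolding arrival_estimates_def
  proof (intro conjI allI impI; (elim conjE)?)
    show "0 \<le> CC" "0 < \<delta>'" using pos \<delta>' by (auto simp: CC_def)
    fix x p t y q
    assume r: "ray c0 (x, p) t (y, q)" "y $ 3 = 0" "norm ((x, p) - (x0, p0)) < \<delta>'"
    note mm = main[OF r(1,2) refl r(3)]
    show "norm ((y, q) - (y0, q0)) \<le> CC * norm ((x, p) - (x0, p0))"
      using mm le(1)[OF norm_ge_zero] order_trans by blast
    show "\<bar>t - t0 - (p0 \<bullet> (x - x0) - q0 \<bullet> (y - y0))\<bar> \<le> CC * (norm ((x, p) - (x0, p0)))\<^sup>2"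
      using mm le(2)[OF zero_le_power2] order_trans by blast
    have "0 \<le> norm (x - x0) + norm (y - y0) + \<bar>q $ 1 - q0 $ 1\<bar> + \<bar>q $ 2 - q0 $ 2\<bar>" by simp
    from le(3)[OF this]
    show "norm (p - p0) \<le> CC * (norm (x - x0) + norm (y - y0) + \<bar>q $ 1 - q0 $ 1\<bar> + \<bar>q $ 2 - q0 $ 2\<bar>)"
      using mm order_trans by blast
  qed
  then show thesis by (rule that)
qed

section \<open>Ranks, minors and vectors of small dimension\<close>

lemma exhaust_6: fixes x :: 6 shows "x = 1 \<or> x = 2 \<or> x = 3 \<or> x = 4 \<or> x = 5 \<or> x = 6"
proof (induct x)
  case (of_int z)
  then have "z = 0 \<or> z = 1 \<or> z = 2 \<or> z = 3 \<or> z = 4 \<or> z = 5" by fastforce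
  then show ?case by auto
qed

lemma exhaust_7: fixes x :: 7 shows "x = 1 \<or> x = 2 \<or> x = 3 \<or> x = 4 \<or> x = 5 \<or> x = 6 \<or> x = 7"
proof (induct x)
  case (of_int z)
  then have "z = 0 \<or> z = 1 \<or> z = 2 \<or> z = 3 \<or> z = 4 \<or> z = 5 \<or> z = 6" by fastforce
  then show ?case by auto
qed

lemma exhaust_8: fixes x :: 8 shows "x = 1 \<or> x = 2 \<or> x = 3 \<or> x = 4 \<or> x = 5 \<or> x = 6 \<or> x = 7 \<or> x = 8"
proof (induct x)
  case (of_int z)
  then have "z = 0 \<or> z = 1 \<or> z = 2 \<or> z = 3 \<or> z = 4 \<or> z = 5 \<or> z = 6 \<or> z = 7" by fastforce
  then show ?case by auto
qed

lemma forall_6: "(\<forall>i::6. P i) \<longleftrightarrow> P 1 \<and> P 2 \<and> P 3 \<and> P 4 \<and> P 5 \<and> P 6"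
  by (metis exhaust_6)

lemma forall_7: "(\<forall>i::7. P i) \<longleftrightarrow> P 1 \<and> P 2 \<and> P 3 \<and> P 4 \<and> P 5 \<and> P 6 \<and> P 7"
  by (metis exhaust_7)

lemma forall_8: "(\<forall>i::8. P i) \<longleftrightarrow> P 1 \<and> P 2 \<and> P 3 \<and> P 4 \<and> P 5 \<and> P 6 \<and> P 7 \<and> P 8"
  by (metis exhaust_8)

lemma UNIV_6: "UNIV = {1, 2, 3, 4, 5, 6::6}" using exhaust_6 by auto

lemma UNIV_7: "UNIV = {1, 2, 3, 4, 5, 6, 7::7}" using exhaust_7 by auto

lemma sum_6: "sum f (UNIV::6 set) = f 1 + f 2 + f 3 + f 4 + f 5 + f 6"
  unfolding UNIV_6 by (simp add: ac_simps)

lemma sum_7: "sum f (UNIV::7 set) = f 1 + f 2 + f 3 + f 4 + f 5 + f 6 + f 7"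
  unfolding UNIV_7 by (simp add: ac_simps)

lemma vector_4 [simp]:
  "(vector [a,b,c,d] :: 'a::zero^4) $ 1 = a" "(vector [a,b,c,d] :: 'a^4) $ 2 = b"
  "(vector [a,b,c,d] :: 'a^4) $ 3 = c" "(vector [a,b,c,d] :: 'a^4) $ 4 = d"
  unfolding vector_def by simp_all

lemma vector_6 [simp]:
  "(vector [a,b,c,d,e,f] :: 'a::zero^6) $ 1 = a" "(vector [a,b,c,d,e,f] :: 'a^6) $ 2 = b"
  "(vector [a,b,c,d,e,f] :: 'a^6) $ 3 = c" "(vector [a,b,c,d,e,f] :: 'a^6) $ 4 = d"
  "(vector [a,b,c,d,e,f] :: 'a^6) $ 5 = e" "(vector [a,b,c,d,e,f] :: 'a^6) $ 6 = f"
  unfolding vector_def by simp_all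

lemma vector_7 [simp]:
  "(vector [a,b,c,d,e,f,g] :: 'a::zero^7) $ 1 = a" "(vector [a,b,c,d,e,f,g] :: 'a^7) $ 2 = b"
  "(vector [a,b,c,d,e,f,g] :: 'a^7) $ 3 = c" "(vector [a,b,c,d,e,f,g] :: 'a^7) $ 4 = d"
  "(vector [a,b,c,d,e,f,g] :: 'a^7) $ 5 = e" "(vector [a,b,c,d,e,f,g] :: 'a^7) $ 6 = f"
  "(vector [a,b,c,d,e,f,g] :: 'a^7) $ 7 = g"
  unfolding vector_def by simp_all

lemma vector_8 [simp]:
  "(vector [a,b,c,d,e,f,g,h] :: 'a::zero^8) $ 1 = a" "(vector [a,b,c,d,e,f,g,h] :: 'a^8) $ 2 = b"
  "(vector [a,b,c,d,e,f,g,h] :: 'a^8) $ 3 = c" "(vector [a,b,c,d,e,f,g,h] :: 'a^8) $ 4 = d"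
  "(vector [a,b,c,d,e,f,g,h] :: 'a^8) $ 5 = e" "(vector [a,b,c,d,e,f,g,h] :: 'a^8) $ 6 = f"
  "(vector [a,b,c,d,e,f,g,h] :: 'a^8) $ 7 = g" "(vector [a,b,c,d,e,f,g,h] :: 'a^8) $ 8 = h"
  unfolding vector_def by simp_all

section \<open>Ranks, kernels and maximal minors\<close>

lemma linear_standard_basis:
  fixes F :: "real^'n::finite \<Rightarrow> 'b::real_vector"
  assumes "linear F"
  shows "F w = (\<Sum>i\<in>UNIV. w $ i *\<^sub>R F (axis i 1))"
proof -
  have "w = (\<Sum>i\<in>UNIV. w $ i *\<^sub>R axis i 1)"
    by (simp add: vec_eq_iff axis_def if_distrib cong: if_cong)
  then show ?thesis
    using linear_sum[OF assms, of "\<lambda>i. w $ i *\<^sub>R axis i 1" UNIV] by (simp add: linear_cmul[OF assms])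
qed

text \<open>The matrix is injective on the hyperplane where the k-th coordinate vanishes, so its
  image has at least the dimension of that hyperplane.\<close>

lemma rank_ge_if_kernel_small:
  fixes A :: "real^'n::finite^'m::finite"
  assumes "\<And>w. A *v w = 0 \<Longrightarrow> w $ k = 0 \<Longrightarrow> w = 0"
  shows "CARD('n) \<le> rank A + 1"
proof -
  let ?S = "{w :: real^'n. \<forall>i. i \<notin> - {k} \<longrightarrow> w $ i = 0}"
  have sub: "subspace ?S" by (auto simp: subspace_def)
  have "inj_on ((*v) A) ?S"
  proof (rule inj_onI)
    fix x y assume "x \<in> ?S" "y \<in> ?S" "A *v x = A *v y"
    then have "A *v (x - y) = 0" "(x - y) $ k = 0" by (auto simp: matrix_vector_mult_diff_distrib)
    then have "x - y = 0" by (rule assms)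
    then show "x = y" by simp
  qed
  then have "dim ((*v) A ` ?S) = dim ?S"
    using sub by (intro dim_image_eq) (auto simp: span_eq_iff[THEN iffD2])
  also have "dim ?S = CARD('n) - 1"
    using dim_substandard_cart[of "- {k}", where 'a = real] by (simp add: dim_vec_eq Compl_eq_Diff_UNIV card_Diff_subset)
  finally have "CARD('n) - 1 \<le> rank A"
    using dim_subset[OF image_mono[OF subset_UNIV[of ?S]], of "(*v) A"] by (simp add: rank_dim_range)
  then show ?thesis by simp
qed

lemma rank_less_iff_kernel:
  fixes A :: "real^'n::finite^'m::finite"
  shows "rank A < CARD('n) \<longleftrightarrow> (\<exists>w. w \<noteq> 0 \<and> A *v w = 0)"
  using matrix_nonfull_linear_equations_eq[of A] rank_bound[of A] by auto

lemma jacobian_mult: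
  fixes f :: "real^'n::finite \<Rightarrow> real^'m::finite"
  assumes "f differentiable (at x)"
  shows "jacobian f (at x) *v w = frechet_derivative f (at x) w"
proof -
  have "linear (frechet_derivative f (at x))"
    using assms linear_frechet_derivative by blast
  then show ?thesis by (simp add: jacobian_def)
qed

lemma transpose_jacobian_kernel:
  fixes f :: "real^'n::finite \<Rightarrow> real^'m::finite"
  assumes "f differentiable (at x)"
  shows "transpose (jacobian f (at x)) *v n = 0 \<longleftrightarrow> (\<forall>w. n \<bullet> frechet_derivative f (at x) w = 0)"
proof -
  have *: "(transpose (jacobian f (at x)) *v n) \<bullet> w = n \<bullet> frechet_derivative f (at x) w" for w
    using dot_lmul_matrix[of n "jacobian f (at x)" w]
    by (simp add: jacobian_mult[OF assms] transpose_matrix_vector)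
  show ?thesis
  proof
    assume "transpose (jacobian f (at x)) *v n = 0"
    then show "\<forall>w. n \<bullet> frechet_derivative f (at x) w = 0" using * by (metis inner_zero_left)
  next
    assume "\<forall>w. n \<bullet> frechet_derivative f (at x) w = 0"
    then have "(transpose (jacobian f (at x)) *v n) \<bullet> (transpose (jacobian f (at x)) *v n) = 0"
      unfolding * by blast
    then show "transpose (jacobian f (at x)) *v n = 0" by simp
  qed
qed

lemma maximal_minor_zero_if_kernel:
  fixes M :: "real^'n::finite^'m::finite"
  assumes "w \<noteq> 0" "M *v w = 0"
  shows "det (\<chi> i j. M $ \<kappa> i $ j :: real^'n^'n) = 0"
proof -
  have "(\<chi> i j. M $ \<kappa> i $ j :: real^'n^'n) *v w = 0"
    using assms(2) by (simp add: vec_eq_iff matrix_vector_mult_def)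
  then have "rank (\<chi> i j. M $ \<kappa> i $ j :: real^'n^'n) < CARD('n)"
    using assms(1) rank_less_iff_kernel by blast
  then show ?thesis by (simp add: det_eq_0_rank)
qed

text \<open>Injectivity means full row rank, so a basis of the row space can be chosen among the
  rows; enumerating it by the column index type gives the row selection \<kappa>.\<close>

lemma nonzero_maximal_minor_exists:
  fixes M :: "real^'n::finite^'m::finite"
  assumes "\<And>w. M *v w = 0 \<Longrightarrow> w = 0"
  shows "\<exists>\<kappa>. inj \<kappa> \<and> det (\<chi> i j. M $ \<kappa> i $ j :: real^'n^'n) \<noteq> 0"
proof -
  have "\<not> rank M < CARD('n)" using assms rank_less_iff_kernel by blast
  then have rank: "dim (rows M) = CARD('n)" using rank_bound[of M] by (simp add: row_rank_def)
  obtain B where B: "B \<subseteq> rows M" "independent B" "card B = dim (rows M)"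
    by (rule basis_exists[of "rows M"])
  have "finite B" using B(2) independent_imp_finite by blast
  then obtain h :: "'n \<Rightarrow> real^'n" where h: "bij_betw h UNIV B"
    using finite_same_card_bij[of "UNIV :: 'n set" B] B(3) rank by auto
  have "\<forall>b\<in>B. \<exists>i. row i M = b" using B(1) by (auto simp: rows_def)
  then obtain g where g: "\<And>b. b \<in> B \<Longrightarrow> row (g b) M = b" by metis
  define \<kappa> where "\<kappa> = g \<circ> h"
  let ?N = "\<chi> i j. M $ \<kappa> i $ j :: real^'n^'n"
  have row: "row i ?N = h i" for i
    using g[of "h i"] h by (auto simp: row_def \<kappa>_def bij_betw_def vec_eq_iff)
  have "inj \<kappa>"
  proof (rule injI)
    fix i j assume "\<kappa> i = \<kappa> j"
    then have "h i = h j" using g h unfolding \<kappa>_def by (metis UNIV_I bij_betw_apply comp_apply)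
    then show "i = j" using h by (auto simp: bij_betw_def inj_on_def)
  qed
  moreover have "rows ?N = B" using h row by (auto simp: rows_def bij_betw_def)
  then have "rank ?N = CARD('n)"
    using dim_eq_card_independent[OF B(2)] B(3) rank by (simp add: row_rank_def)
  then have "det ?N \<noteq> 0" by (simp add: det_eq_0_rank)
  ultimately show ?thesis by blast
qed

text \<open>Chain rule for the smooth inverse composed with \<phi>, which is the identity.\<close>

lemma local_coordinates_derivative_injective:
  assumes "local_coordinates V \<phi>" "x \<in> V" "frechet_derivative \<phi> (at x) w = 0"
  shows "w = 0"
proof -
  have V: "open V" "smooth_on V \<phi>" "inj_on \<phi> V" "smooth_on (\<phi> ` V) (inv_into V \<phi>)"
    using assms(1) by (auto simp: local_coordinates_def)
  have "((\<lambda>y. inv_into V \<phi> (\<phi> y)) has_derivative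
      (\<lambda>w. frechet_derivative (inv_into V \<phi>) (at (\<phi> x)) (frechet_derivative \<phi> (at x) w))) (at x)"
    by (rule has_derivative_compose[OF smooth_on_has_derivative[OF V(2) assms(2)]
          smooth_on_has_derivative[OF V(4) imageI[OF assms(2)]]])
  then have "((\<lambda>y. y) has_derivative
      (\<lambda>w. frechet_derivative (inv_into V \<phi>) (at (\<phi> x)) (frechet_derivative \<phi> (at x) w))) (at x)"
    by (rule has_derivative_transform_within_open[OF _ V(1) assms(2)]) (simp add: V(3))
  then have "(\<lambda>w. w) = (\<lambda>w. frechet_derivative (inv_into V \<phi>) (at (\<phi> x)) (frechet_derivative \<phi> (at x) w))"
    by (rule has_derivative_unique[OF has_derivative_ident])
  then have "w = frechet_derivative (inv_into V \<phi>) (at (\<phi> x)) (frechet_derivative \<phi> (at x) w)"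
    by (rule fun_cong)
  moreover have "linear (frechet_derivative (inv_into V \<phi>) (at (\<phi> x)))"
    using smooth_on_has_derivative[OF V(4), of "\<phi> x"] assms(2) has_derivative_linear by blast
  ultimately show ?thesis using assms(3) linear_0 by metis
qed

section \<open>The fold condition on the generating function\<close>

lemma base_point_has_derivative:
  assumes "(f has_derivative f') (at v)"
  shows "(base_point f has_derivative (\<lambda>w. vector [w $ 1, w $ 2, f' w])) (at v)"
proof -
  have "((\<lambda>v. base_point f v $ i) has_derivative (\<lambda>w. vector [w $ 1, w $ 2, f' w] $ i)) (at v)" for i :: 3
    using exhaust_3[of i] assms bounded_linear_imp_has_derivative[OF bounded_linear_vec_nth]
    by (auto simp: base_point_def)
  then show ?thesis by (subst has_derivative_componentwise_within) (auto simp: Basis_vec_def inner_axis)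
qed

lemma smooth_on_base_point:
  assumes "open D" "smooth_on D f"
  shows "smooth_on D (base_point f)"
proof (rule smooth_on_vecI[OF assms(1)])
  show "smooth_on D (\<lambda>v. base_point f v $ i)" for i
    using exhaust_3[of i] assms smooth_on_vec_nth[OF assms(1) smooth_on_id[OF assms(1)]]
    by (auto simp: base_point_def)
qed

text \<open>Along the fibre directions \<open>w\<close> (those with \<open>w\<^sub>1 = w\<^sub>2 = 0\<close>) the coordinates singled out in the
  normal form have derivatives proportional to those of \<open>f\<close>, so that its Hessian determinant on the
  critical set is that of \<open>f\<close> in \<open>(s\<^sub>1, p\<^sub>3)\<close> up to a factor and a change of basis.\<close>

lemma fold_hessian_nondegenerate:
  assumes folds: "submersion_with_folds D (base_point f)" and f: "smooth_on D f"
    and v: "v \<in> D" "partial_deriv 3 f v = 0" "partial_deriv 4 f v = 0"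
    and w: "w $ 1 = 0" "w $ 2 = 0"
    and Hw: "frechet_derivative (partial_deriv 3 f) (at v) w = 0" "frechet_derivative (partial_deriv 4 f) (at v) w = 0"
  shows "w = 0"
proof -
  let ?h = "base_point f" and ?e = "axis (3::3) (1::real)"
  have D: "open D" using folds by (simp add: submersion_with_folds_def)
  have df: "(f has_derivative frechet_derivative f (at y)) (at y)" if "y \<in> D" for y
    using smooth_on_has_derivative[OF f that] .
  have dh: "(?h has_derivative (\<lambda>w. vector [w $ 1, w $ 2, frechet_derivative f (at y) w])) (at y)" if "y \<in> D" for y
    using base_point_has_derivative[OF df[OF that]] .
  have Dh: "frechet_derivative ?h (at y) w = vector [w $ 1, w $ 2, frechet_derivative f (at y) w]" if "y \<in> D" for y w
    using fun_cong[OF frechet_derivative_at[OF dh[OF that]], of w] by simp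
  have Df: "frechet_derivative f (at y) w = (\<Sum>i\<in>UNIV. w $ i * partial_deriv i f y)" if "y \<in> D" for y w
    using linear_standard_basis[OF has_derivative_linear[OF df[OF that]], of w] by (simp add: partial_deriv_def)
  have "v \<in> rank_drop_set D ?h"
  proof -
    \<comment> \<open>For vanishing f_s and f_p this covector annihilates the image of the
      differential. The rank of a map into a smaller space is read off from such covectors, hence
      the transpose.\<close>
    define n :: "real^3" where "n = vector [- partial_deriv 1 f v, - partial_deriv 2 f v, 1]"
    have "n \<bullet> frechet_derivative ?h (at v) w = 0" for w
      using v by (simp add: n_def Dh Df inner_vec_def sum_3 sum_4 algebra_simps)
    then have "transpose (jacobian ?h (at v)) *v n = 0"
      using transpose_jacobian_kernel[of ?h v n] dh[OF v(1)] by (auto simp: differentiable_def)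
    moreover have "n \<noteq> 0" by (auto simp: n_def vec_eq_iff forall_3)
    ultimately have "rank (transpose (jacobian ?h (at v))) < CARD(3)"
      using rank_less_iff_kernel by blast
    then show ?thesis using v(1) by (simp add: rank_drop_set_def rank_transpose)
  qed
  then obtain O' W \<phi> \<psi> l \<iota> where *: "v \<in> O'" "O' \<subseteq> D" "?h ` O' \<subseteq> W"
    and \<phi>: "local_coordinates O' \<phi>" and \<psi>: "local_coordinates W \<psi>" and \<iota>: "inj_on \<iota> (- {l :: 3})"
    and normal: "\<And>y i. y \<in> O' \<Longrightarrow> i \<noteq> l \<Longrightarrow> \<psi> (?h y) $ i = \<phi> y $ \<iota> i"
    and hd: "hessian_det (- \<iota> ` (- {l})) (\<lambda>z. \<psi> (?h (inv_into O' \<phi> z)) $ l) (\<phi> v) \<noteq> 0"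
    using folds unfolding submersion_with_folds_def by (smt (verit) IntI)
  define K where "K = - \<iota> ` (- {l})"
  define H where "H z = \<psi> (?h (inv_into O' \<phi> z)) $ l" for z
  have O: "open O'" "smooth_on O' \<phi>" "inj_on \<phi> O'" "open (\<phi> ` O')" "smooth_on (\<phi> ` O') (inv_into O' \<phi>)"
    using \<phi> by (auto simp: local_coordinates_def)
  have W: "open W" "smooth_on W \<psi>" using \<psi> by (auto simp: local_coordinates_def)
  have sh: "smooth_on O' ?h"
    using smooth_on_subset[OF smooth_on_base_point[OF D f] *(2)] .
  have inv_in: "inv_into O' \<phi> ` (\<phi> ` O') \<subseteq> O'" by (auto simp: O(3))
  have "(\<lambda>z. ?h (inv_into O' \<phi> z)) ` (\<phi> ` O') \<subseteq> W" using *(3) by (auto simp: O(3))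
  from smooth_on_compose[OF O(4) W(1) this smooth_on_compose[OF O(4) O(1) inv_in O(5) sh] W(2)]
  have sH: "smooth_on (\<phi> ` O') H"
    unfolding H_def[abs_def] by (rule smooth_on_vec_nth[OF O(4)])
  have Hphi: "H (\<phi> y) = \<psi> (?h y) $ l" if "y \<in> O'" for y
    using that O(3) by (simp add: H_def)
  define b where "b j y = frechet_derivative \<phi> (at y) (axis j 1)" for j y
  define fj where "fj j y = partial_deriv j f y" for j y
  \<comment> \<open>In the directions s1 and p3 the first two base coordinates are constant, so the
    differential of \<open>?h\<close> is \<open>fj j\<close> times the third unit vector;
    \<open>c\<close> is the image of that vector under the differential of \<psi>.\<close>
  define c where "c y = frechet_derivative \<psi> (at (?h y)) ?e" for y
  have d\<phi>: "(\<phi> has_derivative frechet_derivative \<phi> (at y)) (at y)" if "y \<in> O'" for y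
    using smooth_on_has_derivative[OF O(2) that] .
  have l\<phi>: "linear (frechet_derivative \<phi> (at y))" if "y \<in> O'" for y
    using d\<phi>[OF that] has_derivative_linear by blast
  have d\<psi>: "(\<psi> has_derivative frechet_derivative \<psi> (at (?h y))) (at (?h y))" if "y \<in> O'" for y
    using smooth_on_has_derivative[OF W(2)] *(3) that by blast
  have dH: "(H has_derivative frechet_derivative H (at (\<phi> y))) (at (\<phi> y))" if "y \<in> O'" for y
    using smooth_on_has_derivative[OF sH] that by blast
  have d\<psi>h: "((\<lambda>y. \<psi> (?h y) $ i) has_derivative (\<lambda>w. frechet_derivative \<psi> (at (?h y)) (vector [w $ 1, w $ 2, frechet_derivative f (at y) w]) $ i)) (at y)"
    if "y \<in> O'" for y i
    using that *(2) by (intro bounded_linear.has_derivative[OF bounded_linear_vec_nth] has_derivative_compose[OF dh d\<psi>]) auto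
  have e34: "frechet_derivative \<psi> (at (?h y)) (vector [axis j 1 $ 1, axis j 1 $ 2, frechet_derivative f (at y) (axis j 1)]) = fj j y *\<^sub>R c y"
    if "j \<in> {3, 4 :: 4}" "y \<in> O'" for j y
  proof -
    have "vector [axis j 1 $ 1, axis j 1 $ 2, frechet_derivative f (at y) (axis j 1)] = fj j y *\<^sub>R ?e"
      using that by (auto simp: vec_eq_iff forall_3 axis_def fj_def partial_deriv_def)
    then show ?thesis
      using linear_cmul[OF has_derivative_linear[OF d\<psi>[OF that(2)]]] by (simp add: c_def)
  qed
  have b1: "b j y $ \<iota> i = fj j y * c y $ i" if "j \<in> {3, 4}" "y \<in> O'" "i \<noteq> l" for j y i
  proof -
    have "((\<lambda>y. \<psi> (?h y) $ i) has_derivative (\<lambda>w. frechet_derivative \<phi> (at y) w $ \<iota> i)) (at y)"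
    proof (rule has_derivative_transform_within_open[OF _ O(1) that(2)])
      show "((\<lambda>y. \<phi> y $ \<iota> i) has_derivative (\<lambda>w. frechet_derivative \<phi> (at y) w $ \<iota> i)) (at y)"
        by (rule bounded_linear.has_derivative[OF bounded_linear_vec_nth d\<phi>[OF that(2)]])
    qed (simp add: normal that(3))
    from has_derivative_unique[OF this d\<psi>h[OF that(2)]]
    show ?thesis using e34[OF that(1,2)] unfolding b_def by (simp add: fun_eq_iff)
  qed
  have b2: "frechet_derivative H (at (\<phi> y)) (frechet_derivative \<phi> (at y) w) = frechet_derivative \<psi> (at (?h y)) (vector [w $ 1, w $ 2, frechet_derivative f (at y) w]) $ l"
    if "y \<in> O'" for y w
  proof -
    have "((\<lambda>y. H (\<phi> y)) has_derivative (\<lambda>w. frechet_derivative \<psi> (at (?h y)) (vector [w $ 1, w $ 2, frechet_derivative f (at y) w]) $ l)) (at y)"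
      by (rule has_derivative_transform_within_open[OF d\<psi>h[OF that] O(1) that]) (simp add: Hphi)
    from has_derivative_unique[OF has_derivative_compose[OF d\<phi>[OF that] dH[OF that]] this]
    show ?thesis by (simp add: fun_eq_iff)
  qed
  have DH: "frechet_derivative H (at z) a = (\<Sum>k\<in>UNIV. a $ k * partial_deriv k H z)" if "z \<in> \<phi> ` O'" for z a
    using linear_standard_basis[OF has_derivative_linear[OF smooth_on_has_derivative[OF sH that]], of a] by (simp add: partial_deriv_def)
  define C where "C y = c y $ l - (\<Sum>i\<in>-{l}. c y $ i * partial_deriv (\<iota> i) H (\<phi> y))" for y
  \<comment> \<open>The derivative of component l of \<psi> composed with \<open>?h\<close> in the
    fibre direction j is computed in two ways. The contributions of the coordinates selected by
    \<iota> are themselves multiples of \<open>fj j\<close>; moved to the other side and collected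
    in \<open>C\<close>, they leave the gradient of \<open>H\<close> in the K-directions.\<close>
  have key: "(\<Sum>k\<in>K. b j y $ k * partial_deriv k H (\<phi> y)) = fj j y * C y" if "j \<in> {3, 4}" "y \<in> O'" for j y
  proof -
    have "fj j y * c y $ l = (\<Sum>k\<in>UNIV. b j y $ k * partial_deriv k H (\<phi> y))"
      using b2[OF that(2), of "axis j 1"] e34[OF that] DH[of "\<phi> y" "b j y"] that(2) by (simp add: b_def)
    also have "\<dots> = (\<Sum>k\<in>K. b j y $ k * partial_deriv k H (\<phi> y)) + (\<Sum>k\<in>-K. b j y $ k * partial_deriv k H (\<phi> y))"
      by (subst sum.union_disjoint[symmetric]) (auto intro: arg_cong2[where f = sum])
    also have "(\<Sum>k\<in>-K. b j y $ k * partial_deriv k H (\<phi> y)) = (\<Sum>i\<in>-{l}. fj j y * c y $ i * partial_deriv (\<iota> i) H (\<phi> y))"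
      unfolding K_def double_compl by (subst sum.reindex[OF \<iota>]) (simp add: b1[OF that])
    finally show ?thesis by (simp add: C_def sum_distrib_left algebra_simps)
  qed
  have spartialH: "smooth_on O' (\<lambda>y. partial_deriv k H (\<phi> y))" for k
    by (rule smooth_on_compose[OF O(1) O(4) _ O(2) smooth_on_partial_deriv[OF sH]]) simp
  have sc: "smooth_on O' (\<lambda>y. c y $ i)" for i
    unfolding c_def
    by (rule smooth_on_vec_nth[OF O(1)], rule smooth_on_compose[OF O(1) W(1) *(3) sh smooth_on_frechet_derivative[OF W(2)]])
  have sC: "smooth_on O' C"
    unfolding C_def[abs_def] by (intro smooth_on_diff smooth_on_sum smooth_on_mult O(1) sc spartialH)
  have sb: "smooth_on O' (\<lambda>y. b j y $ k)" for j k
    unfolding b_def by (intro smooth_on_vec_nth[OF O(1)] smooth_on_frechet_derivative O(2))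
  have vD: "v \<in> D" using * by auto
  have fj0: "fj j v = 0" if "j \<in> {3, 4}" for j using that v by (auto simp: fj_def)
  let ?z = "\<phi> v" and ?L = "frechet_derivative \<phi> (at v)"
  let ?S = "{w :: real^4. \<forall>i. i \<notin> {3, 4} \<longrightarrow> w $ i = 0}" and ?T = "{a :: real^4. \<forall>i. i \<notin> K \<longrightarrow> a $ i = 0}"
  have S34: "w \<in> ?S \<longleftrightarrow> w $ 1 = 0 \<and> w $ 2 = 0" for w :: "real^4"
    by (simp add: forall_4)
  have LS: "?L w = w $ 3 *\<^sub>R b 3 v + w $ 4 *\<^sub>R b 4 v" if "w \<in> ?S" for w
    using linear_standard_basis[OF l\<phi>[OF *(1)], of w] that S34[of w] by (simp add: sum_4 b_def)
  \<comment> \<open>At v the factors \<open>fj j\<close> vanish, so fibre directions have no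
    components along the selected coordinates; both spaces have dimension 2, so the inclusion is an
    equality.\<close>
  have LT: "?L ` ?S = ?T"
  proof (rule subspace_dim_equal)
    show "subspace (?L ` ?S)"
      by (rule linear_subspace_image[OF l\<phi>[OF *(1)]]) (auto simp: subspace_def)
    show "subspace ?T" by (auto simp: subspace_def)
    show "?L ` ?S \<subseteq> ?T"
    proof (intro subsetI CollectI allI impI)
      fix a k assume "a \<in> ?L ` ?S" "k \<notin> K"
      then obtain w i where w: "w \<in> ?S" "a = ?L w" "k = \<iota> i" "i \<noteq> l" by (auto simp: K_def)
      then show "a $ k = 0"
        using LS[OF w(1)] b1[of 3 v i] b1[of 4 v i] fj0 *(1) by simp
    qed
    have "inj_on ?L (span ?S)"
      using local_coordinates_derivative_injective[OF \<phi> *(1)] linear_injective_0[OF l\<phi>[OF *(1)]] inj_on_subset by blast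
    then have "dim (?L ` ?S) = dim ?S" by (rule dim_image_eq[OF l\<phi>[OF *(1)]])
    also have "\<dots> = 2"
      using dim_substandard_cart[of "{3, 4 :: 4}", where 'a = real] by (simp add: dim_vec_eq)
    finally have 1: "dim (?L ` ?S) = 2" .
    have "card (\<iota> ` (- {l})) = 2" using card_image[OF \<iota>] by (simp add: Compl_eq_Diff_UNIV card_Diff_subset)
    then have "card K = 2" by (simp add: K_def Compl_eq_Diff_UNIV card_Diff_subset)
    then have "dim ?T = 2"
      using dim_substandard_cart[of K, where 'a = real] by (simp add: dim_vec_eq)
    then show "dim ?T \<le> dim (?L ` ?S)" using 1 by simp
  qed
  \<comment> \<open>Every K-direction comes from a fibre direction, and these lie in the kernel of
    the differential of \<open>?h\<close> at v.\<close>
  have gradH0: "partial_deriv k H ?z = 0" if "k \<in> K" for k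
  proof -
    have "axis k 1 \<in> ?L ` ?S" unfolding LT using that by (auto simp: axis_def)
    then obtain w where w: "w \<in> ?S" "axis k 1 = ?L w" by auto
    have "frechet_derivative f (at v) w = 0"
      using Df[OF vD, of w] S34[of w] w(1) v by (simp add: sum_4)
    then have "vector [w $ 1, w $ 2, frechet_derivative f (at v) w] = (0 :: real^3)"
      using S34[of w] w(1) by (simp add: vec_eq_iff forall_3)
    then show ?thesis
      using b2[OF *(1), of w] w(2) linear_0[OF has_derivative_linear[OF d\<psi>[OF *(1)]]] by (simp add: partial_deriv_def)
  qed
  define a where "a = ?L w"
  have wS: "w \<in> ?S" using w S34 by blast
  have aT: "a \<in> ?T" using wS LT a_def by blast
  define q where "q k = frechet_derivative (partial_deriv k H) (at ?z) a" for k
  \<comment> \<open>Identity \<open>key\<close> is differentiated at v in the direction w. The terms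
    containing the K-gradient of \<open>H\<close>, the value of \<open>fj j\<close> or its
    derivative along w all vanish; only the Hessian of \<open>H\<close> applied to a, paired with
    \<open>b j v\<close>, is left.\<close>
  have qb: "(\<Sum>k\<in>K. b j v $ k * q k) = 0" if j: "j \<in> {3, 4}" for j
  proof -
    have dp: "((\<lambda>y. partial_deriv k H (\<phi> y)) has_derivative (\<lambda>w. frechet_derivative (partial_deriv k H) (at ?z) (?L w))) (at v)" for k
      using smooth_on_has_derivative[OF smooth_on_partial_deriv[OF sH], of ?z k] *(1)
      by (intro has_derivative_compose[OF d\<phi>[OF *(1)]]) auto
    have "((\<lambda>y. \<Sum>k\<in>K. b j y $ k * partial_deriv k H (\<phi> y)) has_derivative
        (\<lambda>w. \<Sum>k\<in>K. b j v $ k * frechet_derivative (partial_deriv k H) (at ?z) (?L w) + frechet_derivative (\<lambda>y. b j y $ k) (at v) w * partial_deriv k H ?z)) (at v)"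
      by (intro has_derivative_sum has_derivative_mult dp smooth_on_has_derivative[OF sb *(1)])
    then have 1: "((\<lambda>y. fj j y * C y) has_derivative
        (\<lambda>w. \<Sum>k\<in>K. b j v $ k * frechet_derivative (partial_deriv k H) (at ?z) (?L w) + frechet_derivative (\<lambda>y. b j y $ k) (at v) w * partial_deriv k H ?z)) (at v)"
      by (rule has_derivative_transform_within_open[OF _ O(1) *(1)]) (simp add: key[OF j])
    have "((\<lambda>y. fj j y * C y) has_derivative (\<lambda>w. fj j v * frechet_derivative C (at v) w + frechet_derivative (fj j) (at v) w * C v)) (at v)"
      using smooth_on_has_derivative[OF smooth_on_partial_deriv[OF f, of j] vD]
      by (intro has_derivative_mult smooth_on_has_derivative[OF sC *(1)]) (simp add: fj_def[abs_def])
    from has_derivative_unique[OF 1 this]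
    have "(\<Sum>k\<in>K. b j v $ k * q k + frechet_derivative (\<lambda>y. b j y $ k) (at v) w * partial_deriv k H ?z) =
        fj j v * frechet_derivative C (at v) w + frechet_derivative (fj j) (at v) w * C v"
      unfolding q_def a_def by (rule fun_cong)
    moreover have "frechet_derivative (fj j) (at v) w = 0"
      using Hw j by (auto simp: fj_def[abs_def])
    ultimately show ?thesis using fj0[OF j] by (simp add: gradH0)
  qed
  \<comment> \<open>By \<open>LT\<close> the vectors \<open>b 3 v\<close> and \<open>b 4 v\<close>
    span the K-plane, so vanishing against both of them means vanishing in each component.\<close>
  have q0: "q k = 0" if "k \<in> K" for k
  proof -
    have "axis k 1 \<in> ?L ` ?S" unfolding LT using that by (auto simp: axis_def)
    then obtain w where w: "w \<in> ?S" "axis k 1 = ?L w" by auto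
    have "q k = (\<Sum>k'\<in>K. axis k 1 $ k' * q k')"
      using that by (subst sum.remove[of _ k]) (auto simp: axis_def)
    also have "\<dots> = w $ 3 * (\<Sum>k\<in>K. b 3 v $ k * q k) + w $ 4 * (\<Sum>k\<in>K. b 4 v $ k * q k)"
      unfolding w(2) LS[OF w(1)] by (simp add: sum_distrib_left sum.distrib algebra_simps)
    finally show ?thesis using qb by simp
  qed
  \<comment> \<open>The padded Hessian. Outside K the identity block reads off the components of a,
    which are zero; inside K the product with a is q. So a lies in the kernel of an invertible
    matrix.\<close>
  define M :: "real^4^4" where "M = (\<chi> i j. if i \<in> K \<and> j \<in> K then partial_deriv i (partial_deriv j H) ?z else if i = j then 1 else 0)"
  have H_eq: "H = (\<lambda>z. \<psi> (?h (inv_into O' \<phi> z)) $ l)" by (simp add: H_def fun_eq_iff)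
  have "det M \<noteq> 0" using hd unfolding hessian_det_def M_def K_def[symmetric] H_eq[symmetric] .
  have "transpose M *v a = 0"
  proof -
    have "(transpose M *v a) $ k = 0" for k
    proof (cases "k \<in> K")
      case True
      have "q k = (\<Sum>i\<in>UNIV. a $ i * partial_deriv i (partial_deriv k H) ?z)"
        using linear_standard_basis[OF has_derivative_linear[OF smooth_on_has_derivative[OF smooth_on_partial_deriv[OF sH], of ?z k]], of a] *(1)
        by (simp add: q_def partial_deriv_def)
      also have "\<dots> = (\<Sum>i\<in>UNIV. M $ i $ k * a $ i)"
        using aT True by (intro sum.cong) (auto simp: M_def)
      finally show ?thesis using q0[OF True] by (simp add: matrix_vector_mult_def transpose_def)
    next
      case False
      then have "(transpose M *v a) $ k = (\<Sum>i\<in>UNIV. (if i = k then a $ i else 0))"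
        unfolding matrix_vector_mult_def vec_lambda_beta by (intro sum.cong) (auto simp: transpose_def M_def)
      then show ?thesis using aT False by simp
    qed
    then show ?thesis by (simp add: vec_eq_iff)
  qed
  moreover have "\<not> rank (transpose M) < CARD(4)"
    using \<open>det M \<noteq> 0\<close> det_eq_0_rank[of "transpose M"] by (simp add: det_transpose)
  ultimately have "a = 0" using rank_less_iff_kernel by blast
  then show ?thesis using local_coordinates_derivative_injective[OF \<phi> *(1), of w] a_def by simp
qed

section \<open>First-order consequences of Lipschitz estimates\<close>

lemma has_derivative_vecI:
  fixes f :: "'a::real_normed_vector \<Rightarrow> real^'n::finite"
  assumes "\<And>i. ((\<lambda>x. f x $ i) has_derivative (\<lambda>h. f' h $ i)) F"
  shows "(f has_derivative f') F"
proof -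
  have "((\<lambda>x. \<Sum>i\<in>UNIV. (f x $ i) *\<^sub>R axis i (1::real)) has_derivative (\<lambda>h. \<Sum>i\<in>UNIV. (f' h $ i) *\<^sub>R axis i 1)) F"
    by (intro has_derivative_sum bounded_linear.has_derivative[OF bounded_linear_scaleR_left] assms)
  moreover have "(\<Sum>i\<in>UNIV. (v $ i) *\<^sub>R axis i (1::real)) = v" for v :: "real^'n"
    by (simp add: vec_eq_iff axis_def if_distrib cong: if_cong)
  ultimately show ?thesis by simp
qed

lemma has_derivative_along_line:
  assumes "(z has_derivative z') (at u)"
  shows "((\<lambda>h::real. norm (z (u + h *\<^sub>R k) - z u - h *\<^sub>R z' k) / \<bar>h\<bar>) \<longlongrightarrow> 0) (at 0)"
proof -
  have "(z has_derivative z') (at (u + (0::real) *\<^sub>R k))" using assms by simp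
  moreover have "((\<lambda>h::real. u + h *\<^sub>R k) has_derivative (\<lambda>h. h *\<^sub>R k)) (at 0)"
    by (auto intro!: derivative_eq_intros)
  ultimately have "((\<lambda>h::real. z (u + h *\<^sub>R k)) has_derivative (\<lambda>h. z' (h *\<^sub>R k))) (at 0)"
    by (intro has_derivative_compose[where f = "\<lambda>h::real. u + h *\<^sub>R k" and g = z])
  moreover have "z' (h *\<^sub>R k) = h *\<^sub>R z' k" for h
    using has_derivative_linear[OF assms] linear_cmul by blast
  ultimately show ?thesis
    unfolding has_derivative_iff_norm by simp
qed

lemma eventually_along_line:
  assumes "eventually P (nhds (u::'a::real_normed_vector))"
  shows "\<forall>\<^sub>F h::real in at 0. P (u + h *\<^sub>R k)"
proof -
  have "((\<lambda>h::real. u + h *\<^sub>R k) \<longlongrightarrow> u + 0 *\<^sub>R k) (at 0)" by (intro tendsto_intros)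
  then show ?thesis using eventually_compose_filterlim[OF assms] by simp
qed

text \<open>Along the line u + h k the increments of z are o(h), hence so are those of \<phi>. Since
  the derivative of \<phi> is already known to exist, this determines it in the direction k.\<close>

lemma derivative_zero_if_dominated:
  fixes \<phi> :: "'a::real_normed_vector \<Rightarrow> 'b::real_normed_vector" and z :: "'a \<Rightarrow> 'c::real_normed_vector"
  assumes \<phi>: "(\<phi> has_derivative \<phi>') (at u)" and z: "(z has_derivative z') (at u)" and "z' k = 0"
    and le: "eventually (\<lambda>x. norm (\<phi> x - \<phi> u) \<le> C * norm (z x - z u)) (nhds u)"
  shows "\<phi>' k = 0"
proof -
  let ?e1 = "\<lambda>h::real. norm (\<phi> (u + h *\<^sub>R k) - \<phi> u - h *\<^sub>R \<phi>' k) / \<bar>h\<bar>"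
  let ?e2 = "\<lambda>h::real. norm (z (u + h *\<^sub>R k) - z u - h *\<^sub>R z' k) / \<bar>h\<bar>"
  have "((\<lambda>h. ?e1 h + C * ?e2 h) \<longlongrightarrow> 0 + C * 0) (at 0)"
    by (intro tendsto_intros has_derivative_along_line \<phi> z)
  moreover have "\<forall>\<^sub>F h in at 0. norm (\<phi>' k) \<le> ?e1 h + C * ?e2 h"
    using eventually_along_line[OF le, of k] eventually_neq_at_within[of 0 0 UNIV]
  proof eventually_elim
    case (elim h)
    have "\<bar>h\<bar> * norm (\<phi>' k) \<le> norm (\<phi> (u + h *\<^sub>R k) - \<phi> u - h *\<^sub>R \<phi>' k) + norm (\<phi> (u + h *\<^sub>R k) - \<phi> u)"
      using norm_triangle_ineq4[of "\<phi> (u + h *\<^sub>R k) - \<phi> u" "\<phi> (u + h *\<^sub>R k) - \<phi> u - h *\<^sub>R \<phi>' k"] by simp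
    then have "\<bar>h\<bar> * norm (\<phi>' k) \<le> norm (\<phi> (u + h *\<^sub>R k) - \<phi> u - h *\<^sub>R \<phi>' k) + C * norm (z (u + h *\<^sub>R k) - z u)"
      using elim by linarith
    then show ?case using elim \<open>z' k = 0\<close> by (simp add: field_simps)
  qed
  ultimately have "norm (\<phi>' k) \<le> 0"
    using tendsto_lowerbound[of "\<lambda>h. ?e1 h + C * ?e2 h" 0 "at 0" "norm (\<phi>' k)"] by simp
  then show ?thesis by simp
qed

text \<open>Here k is arbitrary: the increments of z are O(h), so their squares are o(h) in every
  direction.\<close>

lemma derivative_zero_if_quadratic:
  fixes \<phi> :: "'a::real_normed_vector \<Rightarrow> 'b::real_normed_vector" and z :: "'a \<Rightarrow> 'c::real_normed_vector"
  assumes \<phi>: "(\<phi> has_derivative \<phi>') (at u)" and z: "(z has_derivative z') (at u)"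
    and le: "eventually (\<lambda>x. norm (\<phi> x - \<phi> u) \<le> C * (norm (z x - z u))\<^sup>2) (nhds u)" and C: "0 \<le> C"
  shows "\<phi>' k = 0"
proof -
  let ?e1 = "\<lambda>h::real. norm (\<phi> (u + h *\<^sub>R k) - \<phi> u - h *\<^sub>R \<phi>' k) / \<bar>h\<bar>"
  let ?e2 = "\<lambda>h::real. norm (z (u + h *\<^sub>R k) - z u - h *\<^sub>R z' k) / \<bar>h\<bar>"
  have "((\<lambda>h. ?e1 h + C * ((?e2 h + norm (z' k))\<^sup>2 * \<bar>h\<bar>)) \<longlongrightarrow> 0 + C * ((0 + norm (z' k))\<^sup>2 * \<bar>0\<bar>)) (at 0)"
    by (intro tendsto_intros has_derivative_along_line \<phi> z)
  moreover have "\<forall>\<^sub>F h in at 0. norm (\<phi>' k) \<le> ?e1 h + C * ((?e2 h + norm (z' k))\<^sup>2 * \<bar>h\<bar>)"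
    using eventually_along_line[OF le, of k] eventually_neq_at_within[of 0 0 UNIV]
  proof eventually_elim
    case (elim h)
    let ?N = "norm (z (u + h *\<^sub>R k) - z u)"
    have "?N \<le> norm (z (u + h *\<^sub>R k) - z u - h *\<^sub>R z' k) + \<bar>h\<bar> * norm (z' k)"
      using norm_triangle_ineq[of "z (u + h *\<^sub>R k) - z u - h *\<^sub>R z' k" "h *\<^sub>R z' k"] by simp
    also have "\<dots> = (?e2 h + norm (z' k)) * \<bar>h\<bar>" using elim by (simp add: field_simps)
    finally have "?N\<^sup>2 \<le> ((?e2 h + norm (z' k)) * \<bar>h\<bar>)\<^sup>2" by (intro power_mono) auto
    then have "C * ?N\<^sup>2 \<le> C * ((?e2 h + norm (z' k)) * \<bar>h\<bar>)\<^sup>2" using C by (intro mult_left_mono)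
    then have "C * ?N\<^sup>2 \<le> \<bar>h\<bar> * (C * ((?e2 h + norm (z' k))\<^sup>2 * \<bar>h\<bar>))"
      by (simp add: power_mult_distrib power2_eq_square mult_ac)
    moreover have "\<bar>h\<bar> * norm (\<phi>' k) \<le> norm (\<phi> (u + h *\<^sub>R k) - \<phi> u - h *\<^sub>R \<phi>' k) + norm (\<phi> (u + h *\<^sub>R k) - \<phi> u)"
      using norm_triangle_ineq4[of "\<phi> (u + h *\<^sub>R k) - \<phi> u" "\<phi> (u + h *\<^sub>R k) - \<phi> u - h *\<^sub>R \<phi>' k"] by simp
    moreover have "norm (\<phi> (u + h *\<^sub>R k) - \<phi> u - h *\<^sub>R \<phi>' k) = \<bar>h\<bar> * ?e1 h" using elim by simp
    ultimately have "\<bar>h\<bar> * norm (\<phi>' k) \<le> \<bar>h\<bar> * (?e1 h + C * ((?e2 h + norm (z' k))\<^sup>2 * \<bar>h\<bar>))"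
      using elim unfolding distrib_left by linarith
    then show ?case using elim by (subst (asm) mult_le_cancel_left_pos) auto
  qed
  ultimately have "norm (\<phi>' k) \<le> 0"
    using tendsto_lowerbound[of "\<lambda>h. ?e1 h + C * ((?e2 h + norm (z' k))\<^sup>2 * \<bar>h\<bar>)" 0 "at 0" "norm (\<phi>' k)"] by simp
  then show ?thesis by simp
qed

text \<open>The exterior derivative of a one-form vanishing along a map vanishes as well.\<close>

lemma contact_imp_symplectic:
  fixes P Q :: "real^'n::finite \<Rightarrow> real^'m::finite"
  assumes U: "open U" "u \<in> U" and P: "smooth_on U P" and Q: "smooth_on U Q"
    and contact: "\<And>u h. u \<in> U \<Longrightarrow> P u \<bullet> frechet_derivative Q (at u) h = 0"
  shows "frechet_derivative P (at u) k \<bullet> frechet_derivative Q (at u) h =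
    frechet_derivative P (at u) h \<bullet> frechet_derivative Q (at u) k"
proof -
  let ?DQ = "\<lambda>h u. frechet_derivative Q (at u) h"
  \<comment> \<open>The contact identity is differentiated once more in the direction k; exchanging
    h and k and subtracting removes the second derivatives of Q by symmetry.\<close>
  have zero: "frechet_derivative P (at u) k \<bullet> ?DQ h u + P u \<bullet> frechet_derivative (?DQ h) (at u) k = 0" for h k
  proof -
    have 1: "((\<lambda>u. P u \<bullet> ?DQ h u) has_derivative
        (\<lambda>k. P u \<bullet> frechet_derivative (?DQ h) (at u) k + frechet_derivative P (at u) k \<bullet> ?DQ h u)) (at u)"
      by (intro has_derivative_inner smooth_on_has_derivative[OF P U(2)]
          smooth_on_has_derivative[OF smooth_on_frechet_derivative[OF Q] U(2)])
    have 2: "((\<lambda>u. P u \<bullet> ?DQ h u) has_derivative (\<lambda>k. 0)) (at u)"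
      by (rule has_derivative_transform_within_open[OF has_derivative_const U]) (simp add: contact)
    show ?thesis using fun_cong[OF has_derivative_unique[OF 1 2], of k] by (simp add: add.commute)
  qed
  have sym: "frechet_derivative (?DQ h) (at u) k = frechet_derivative (?DQ k) (at u) h"
  proof (rule vec_eq_iff[THEN iffD2, rule_format])
    fix i
    have comp: "frechet_derivative (?DQ h) (at u) k $ i =
        frechet_derivative (\<lambda>y. frechet_derivative (\<lambda>z. Q z $ i) (at y) h) (at u) k" for h k
    proof -
      have "((\<lambda>y. ?DQ h y $ i) has_derivative (\<lambda>k. frechet_derivative (?DQ h) (at u) k $ i)) (at u)"
        by (intro bounded_linear.has_derivative[OF bounded_linear_vec_nth]
            smooth_on_has_derivative[OF smooth_on_frechet_derivative[OF Q] U(2)])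
      then have "((\<lambda>y. frechet_derivative (\<lambda>z. Q z $ i) (at y) h) has_derivative (\<lambda>k. frechet_derivative (?DQ h) (at u) k $ i)) (at u)"
        by (rule has_derivative_transform_within_open[OF _ U])
           (simp add: frechet_derivative_vec_nth smooth_on_differentiable[OF Q])
      from fun_cong[OF frechet_derivative_at[OF this], of k] show ?thesis .
    qed
    show "frechet_derivative (?DQ h) (at u) k $ i = frechet_derivative (?DQ k) (at u) h $ i"
      unfolding comp by (rule second_derivative_symmetric[OF U smooth_on_vec_nth[OF U(1) Q]])
  qed
  show ?thesis using zero[of k h] zero[of h k] sym by simp
qed

section \<open>Orthonormal coordinates and endpoints of rays\<close>

lemma original_inner:
  assumes "orthogonal_matrix A"
  shows "original A x \<bullet> original A y = x \<bullet> y"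
proof -
  have "original A x \<bullet> original A y = x \<bullet> (A *v (transpose A *v y))"
    unfolding original_def transpose_matrix_vector[of A x] by (rule dot_lmul_matrix)
  moreover have "A *v (transpose A *v y) = y"
    using assms by (simp add: matrix_vector_mul_assoc orthogonal_matrix_def del: transpose_matrix_vector)
  ultimately show ?thesis by simp
qed

lemma original_norm: "orthogonal_matrix A \<Longrightarrow> norm (original A x) = norm x"
  by (simp add: norm_eq_sqrt_inner original_inner)

lemma original_linear: "linear (original A)"
  unfolding original_def[abs_def] by (rule matrix_vector_mul_linear)

lemma original_has_derivative: "(original A has_derivative original A) F"
  by (rule bounded_linear_imp_has_derivative) (use original_linear linear_linear in blast)

lemma incident_part_has_derivative: "(incident_part has_derivative incident_part) F"
proof (rule has_derivative_vecI)
  show "((\<lambda>u. incident_part u $ i) has_derivative (\<lambda>u. incident_part u $ i)) F" for i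
    using exhaust_4[of i] bounded_linear_imp_has_derivative[OF bounded_linear_vec_nth]
    by (auto simp: incident_part_def)
qed

lemma smooth_on_incident_part: "open U \<Longrightarrow> smooth_on U incident_part"
proof (rule smooth_on_vecI)
  assume "open U"
  then show "smooth_on U (\<lambda>u. incident_part u $ i)" for i
    using exhaust_4[of i] smooth_on_vec_nth[OF _ smooth_on_id] by (auto simp: incident_part_def)
qed

lemma ray_endpoints:
  assumes "sound_speed c0" "ray c0 (x, p) t (y, q)"
  shows "(norm p)\<^sup>2 = slow2 c0 x" "(norm q)\<^sup>2 = slow2 c0 y" "x \<in> half_space" "y \<in> half_space"
proof -
  obtain L X P where h: "bicharacteristic c0 L X P" "X 0 = x" "P 0 = p" "X L = y" "P L = q"
    using assms(2) by (auto simp: ray_def)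
  then have "0 < L" "hamiltonian_curve c0 0 L X P" using assms(1) by (auto simp: bicharacteristic_iff)
  then show "(norm p)\<^sup>2 = slow2 c0 x" "(norm q)\<^sup>2 = slow2 c0 y" "x \<in> half_space" "y \<in> half_space"
    using h by (auto simp: hamiltonian_curve_def)
qed

section \<open>The canonical relation\<close>

locale marine_geometry =
  fixes c0 :: "real^3 \<Rightarrow> real" and Src Rec :: "(real \<times> real) set" and T s2 br :: real
    and A :: "real^3^3" and D :: "(real^4) set" and U :: "(real^7) set"
    and f g1 g2 t_inc :: "real^4 \<Rightarrow> real" and p0 :: "real^4 \<Rightarrow> real^3"
    and r1 r2 t_ref :: "real^7 \<Rightarrow> real" and q :: "real^7 \<Rightarrow> real^3"
  assumes c0: "sound_speed c0"
    and no_connection: "no_ray_connects c0 Src Rec"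
    and no_grazing: "no_ray_grazes_surface c0"
    and orth: "orthogonal_matrix A"
    and coords: "incident_coordinates c0 Src s2 A D f g1 g2"
    and folds: "submersion_with_folds D (base_point f)"
    and inc_data: "incident_data c0 s2 A D f g1 g2 t_inc p0"
    and branch: "br = 1 \<or> br = -1"
    and ref_data: "reflected_data c0 A br f U r1 r2 t_ref q"
    and param: "marine_parametrization T Rec D t_inc r1 r2 t_ref U (canonical_point c0 A br f g1 g2 t_inc p0 r1 r2 t_ref q)"
begin

abbreviation "xx u \<equiv> base_point f (incident_part u)"
abbreviation "pp u \<equiv> incident_covector g1 g2 (incident_part u)"
abbreviation "slowness u \<equiv> 1 / c0 (original A (xx u))"
abbreviation "Lf \<equiv> canonical_left t_inc p0 r1 r2 t_ref q"
abbreviation "Rf \<equiv> canonical_right c0 A br f g1 g2"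
abbreviation "DL u \<equiv> frechet_derivative Lf (at u)"
abbreviation "DR u \<equiv> frechet_derivative Rf (at u)"
abbreviation "Df u h \<equiv> frechet_derivative f (at (incident_part u)) (incident_part h)"

text \<open>The slowness of the reflected ray minus that of the incident ray at the scattering
  point, since p is minus the incident slowness; \<xi> is -\<tau> times this vector.\<close>

definition yy :: "real^7 \<Rightarrow> real^3"
  where "yy u = slowness u *\<^sub>R takeoff br u + pp u"

lemma openU: "open U" and openD: "open D"
  using param coords by (auto simp: marine_parametrization_def incident_coordinates_def)

lemma smooth_f: "smooth_on D f" and smooth_g: "smooth_on D g1" "smooth_on D g2"
  using coords by (auto simp: incident_coordinates_def)

lemma inD: "u \<in> U \<Longrightarrow> incident_part u \<in> D"
  and alpha: "u \<in> U \<Longrightarrow> (u $ 5)\<^sup>2 + (u $ 6)\<^sup>2 < 1"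
  and tau: "u \<in> U \<Longrightarrow> u $ 7 \<noteq> 0"
  and receivers: "u \<in> U \<Longrightarrow> (r1 u, r2 u) \<in> Rec"
  and time_less: "u \<in> U \<Longrightarrow> t_inc (incident_part u) + t_ref u < T"
  using param by (auto simp: marine_parametrization_def)

lemma smooth_L: "smooth_on U Lf" and smooth_R: "smooth_on U Rf"
proof -
  have s: "smooth_on U (canonical_point c0 A br f g1 g2 t_inc p0 r1 r2 t_ref q)"
    using param by (simp add: marine_parametrization_def)
  show "smooth_on U Lf"
    using smooth_on_bounded_linear[OF openU bounded_linear_fst s] by (simp add: canonical_point_def)
  show "smooth_on U Rf"
    using smooth_on_bounded_linear[OF openU bounded_linear_snd s] by (simp add: canonical_point_def)
qed

lemma sources: "u \<in> U \<Longrightarrow> (u $ 1, s2) \<in> Src"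
  and subsurface_x: "u \<in> U \<Longrightarrow> original A (xx u) \<in> subsurface"
  using coords inD[of u] by (auto simp: incident_coordinates_def source_point_def incident_part_def)

lemma incident_ray:
  "u \<in> U \<Longrightarrow> ray c0 (surface_point (u $ 1, s2), p0 (incident_part u)) (t_inc (incident_part u))
      (original A (xx u), original A (pp u))"
  using inc_data inD[of u] by (auto simp: incident_data_def source_point_def incident_part_def)

lemma reflected_ray:
  "u \<in> U \<Longrightarrow> ray c0 (original A (xx u), - slowness u *\<^sub>R original A (takeoff br u)) (t_ref u)
      (surface_point (r1 u, r2 u), - q u)"
  using ref_data by (auto simp: reflected_data_def Let_def)

lemma reversed_incident_ray:
  "u \<in> U \<Longrightarrow> ray c0 (original A (xx u), - original A (pp u)) (t_inc (incident_part u))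
      (surface_point (u $ 1, s2), - p0 (incident_part u))"
  using ray_reverse[OF c0 incident_ray] .

lemma slowness_pos: "u \<in> U \<Longrightarrow> 0 < slowness u"
  using c0 subsurface_x[of u] by (auto simp: sound_speed_def subsurface_def half_space_def)

lemma norm_pp: "u \<in> U \<Longrightarrow> norm (pp u) = slowness u"
proof -
  assume u: "u \<in> U"
  have "(norm (pp u))\<^sup>2 = (slowness u)\<^sup>2"
    using ray_endpoints(2)[OF c0 incident_ray[OF u]] by (simp add: original_norm[OF orth] slow2_def power_one_over)
  then show ?thesis using slowness_pos[OF u] by (simp add: power2_eq_iff_nonneg)
qed

lemma takeoff3: "u \<in> U \<Longrightarrow> takeoff br u $ 3 \<noteq> 0"
  using alpha[of u] branch by (auto simp: takeoff_def)

lemma takeoff_unit: "u \<in> U \<Longrightarrow> takeoff br u \<bullet> takeoff br u = 1"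
  using alpha[of u] branch
  by (auto simp: takeoff_def inner_vec_def sum_3 power_mult_distrib simp flip: power2_eq_square)

text \<open>Otherwise the reflected ray would continue the incident one.\<close>

lemma yy_takeoff: "u \<in> U \<Longrightarrow> yy u \<bullet> takeoff br u \<noteq> 0"
proof
  assume u: "u \<in> U" and z: "yy u \<bullet> takeoff br u = 0"
  let ?s = "slowness u" and ?w = "takeoff br u"
  have "?s + pp u \<bullet> ?w = 0"
    using z takeoff_unit[OF u] by (simp add: yy_def inner_add_left)
  \<comment> \<open>This is the equality case of Cauchy-Schwarz: both vectors have length
    \<open>slowness u\<close> and their inner product is minimal, so they are opposite.\<close>
  moreover have "(norm (pp u + ?s *\<^sub>R ?w))\<^sup>2 = (norm (pp u))\<^sup>2 + 2 * ?s * (pp u \<bullet> ?w) + ?s\<^sup>2 * (?w \<bullet> ?w)"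
    unfolding power2_norm_eq_inner by (simp add: inner_add inner_commute power2_eq_square algebra_simps)
  ultimately have "(norm (pp u + ?s *\<^sub>R ?w))\<^sup>2 = ?s\<^sup>2 + 2 * ?s * (- ?s) + ?s\<^sup>2"
    using norm_pp[OF u] takeoff_unit[OF u] by (simp add: add_eq_0_iff)
  then have "pp u + ?s *\<^sub>R ?w = 0" by (simp add: power2_eq_square)
  then have "pp u = - ?s *\<^sub>R ?w" by (simp add: eq_neg_iff_add_eq_0)
  then have "original A (pp u) = - ?s *\<^sub>R original A ?w"
    using linear_cmul[OF original_linear, of A "- ?s" ?w] by simp
  then have "ray c0 (original A (xx u), original A (pp u)) (t_ref u) (surface_point (r1 u, r2 u), - q u)"
    using reflected_ray[OF u] by simp
  then show False
    using no_connection incident_ray[OF u] sources[OF u] receivers[OF u] subsurface_x[OF u]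
    unfolding no_ray_connects_def by blast
qed

section \<open>The two factors and their differentials\<close>

lemma Lf_nth:
  "Lf u $ 1 = u $ 1" "Lf u $ 2 = r1 u" "Lf u $ 3 = r2 u" "Lf u $ 4 = t_inc (incident_part u) + t_ref u"
  "Lf u $ 5 = - (u $ 7 * p0 (incident_part u) $ 1)" "Lf u $ 6 = - (u $ 7 * q u $ 1)" "Lf u $ 7 = - (u $ 7 * q u $ 2)"
  "Lf u $ 8 = u $ 7"
  by (simp_all add: canonical_left_def Let_def)

lemma Rf_nth:
  "Rf u $ 1 = u $ 2" "Rf u $ 2 = u $ 3" "Rf u $ 3 = f (incident_part u)"
  "Rf u $ 4 = - (u $ 7) * yy u $ 1" "Rf u $ 5 = - (u $ 7) * yy u $ 2" "Rf u $ 6 = - (u $ 7) * yy u $ 3"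
  by (simp_all add: canonical_right_def Let_def yy_def base_point_def incident_part_def)

lemma has_derivative_L: "u \<in> U \<Longrightarrow> (Lf has_derivative DL u) (at u)"
  and has_derivative_R: "u \<in> U \<Longrightarrow> (Rf has_derivative DR u) (at u)"
  using smooth_L smooth_R smooth_on_has_derivative by blast+

lemma has_derivative_L_nth: "u \<in> U \<Longrightarrow> ((\<lambda>u. Lf u $ i) has_derivative (\<lambda>h. DL u h $ i)) (at u)"
  and has_derivative_R_nth: "u \<in> U \<Longrightarrow> ((\<lambda>u. Rf u $ j) has_derivative (\<lambda>h. DR u h $ j)) (at u)"
  using has_derivative_L has_derivative_R bounded_linear.has_derivative[OF bounded_linear_vec_nth] by blast+

lemma linear_DL: "u \<in> U \<Longrightarrow> linear (DL u)" and linear_DR: "u \<in> U \<Longrightarrow> linear (DR u)"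
  using has_derivative_L has_derivative_R has_derivative_linear by blast+

lemma has_derivative_f: "u \<in> U \<Longrightarrow> ((\<lambda>u. f (incident_part u)) has_derivative (\<lambda>h. Df u h)) (at u)"
  by (rule has_derivative_compose[OF incident_part_has_derivative smooth_on_has_derivative[OF smooth_f inD]])

lemma nth_has_derivative: "((\<lambda>u. u $ i) has_derivative (\<lambda>h. h $ i)) F" for i :: "'n::finite"
  by (rule bounded_linear_imp_has_derivative[OF bounded_linear_vec_nth])

lemma DL_nth: "u \<in> U \<Longrightarrow> DL u h $ 1 = h $ 1" "u \<in> U \<Longrightarrow> DL u h $ 8 = h $ 7"
  using fun_cong[OF has_derivative_unique[OF has_derivative_L_nth[of u 1, unfolded Lf_nth] nth_has_derivative]]
    fun_cong[OF has_derivative_unique[OF has_derivative_L_nth[of u 8, unfolded Lf_nth] nth_has_derivative]] by auto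

lemma DR_nth: "u \<in> U \<Longrightarrow> DR u h $ 1 = h $ 2" "u \<in> U \<Longrightarrow> DR u h $ 2 = h $ 3" "u \<in> U \<Longrightarrow> DR u h $ 3 = Df u h"
  using fun_cong[OF has_derivative_unique[OF has_derivative_R_nth[of u 1, unfolded Rf_nth] nth_has_derivative]]
    fun_cong[OF has_derivative_unique[OF has_derivative_R_nth[of u 2, unfolded Rf_nth] nth_has_derivative]]
    fun_cong[OF has_derivative_unique[OF has_derivative_R_nth[of u 3, unfolded Rf_nth] has_derivative_f]] by auto

definition Dx :: "real^7 \<Rightarrow> real^7 \<Rightarrow> real^3"
  where "Dx u h = vector [h $ 2, h $ 3, Df u h]"

definition Dxi :: "real^7 \<Rightarrow> real^7 \<Rightarrow> real^3"
  where "Dxi u h = vector [DR u h $ 4, DR u h $ 5, DR u h $ 6]"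

text \<open>The third entry results from differentiating |w|^2 = 1, which avoids the square root and
  its branch.\<close>

definition Dw :: "real^7 \<Rightarrow> real^7 \<Rightarrow> real^3"
  where "Dw u h = vector [h $ 5, h $ 6, - (u $ 5 * h $ 5 + u $ 6 * h $ 6) / takeoff br u $ 3]"

definition Dp :: "real^7 \<Rightarrow> real^7 \<Rightarrow> real^3"
  where "Dp u h = vector [frechet_derivative g1 (at (incident_part u)) (incident_part h),
                          frechet_derivative g2 (at (incident_part u)) (incident_part h), h $ 4]"

lemma has_derivative_x: "u \<in> U \<Longrightarrow> (xx has_derivative Dx u) (at u)"
proof (rule has_derivative_vecI)
  fix i :: 3 assume "u \<in> U"
  then show "((\<lambda>u. xx u $ i) has_derivative (\<lambda>h. Dx u h $ i)) (at u)"
    using exhaust_3[of i] has_derivative_f nth_has_derivative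
    by (auto simp: base_point_def Dx_def incident_part_def)
qed

lemma has_derivative_p: "u \<in> U \<Longrightarrow> (pp has_derivative Dp u) (at u)"
proof (rule has_derivative_vecI)
  fix i :: 3 assume u: "u \<in> U"
  have "((\<lambda>u. g1 (incident_part u)) has_derivative (\<lambda>h. frechet_derivative g1 (at (incident_part u)) (incident_part h))) (at u)"
    "((\<lambda>u. g2 (incident_part u)) has_derivative (\<lambda>h. frechet_derivative g2 (at (incident_part u)) (incident_part h))) (at u)"
    by (rule has_derivative_compose[OF incident_part_has_derivative], use smooth_on_has_derivative inD[OF u] smooth_g in blast)+
  then show "((\<lambda>u. pp u $ i) has_derivative (\<lambda>h. Dp u h $ i)) (at u)"
    using exhaust_3[of i] nth_has_derivative
    by (auto simp: incident_covector_def Dp_def incident_part_def)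
qed

lemma has_derivative_takeoff: "u \<in> U \<Longrightarrow> (takeoff br has_derivative Dw u) (at u)"
proof (rule has_derivative_vecI)
  fix i :: 3 assume u: "u \<in> U"
  have pos: "0 < 1 - ((u $ 5)\<^sup>2 + (u $ 6)\<^sup>2)" using alpha[OF u] by simp
  have "((\<lambda>u. br * sqrt (1 - ((u $ 5)\<^sup>2 + (u $ 6)\<^sup>2))) has_derivative
      (\<lambda>h. - (u $ 5 * h $ 5 + u $ 6 * h $ 6) / (br * sqrt (1 - ((u $ 5)\<^sup>2 + (u $ 6)\<^sup>2))))) (at u)"
    using pos branch
    by (auto intro!: derivative_eq_intros nth_has_derivative simp: fun_eq_iff field_simps power2_eq_square)
  then show "((\<lambda>u. takeoff br u $ i) has_derivative (\<lambda>h. Dw u h $ i)) (at u)"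
    using exhaust_3[of i] nth_has_derivative by (auto simp: takeoff_def Dw_def)
qed

text \<open>The derivative is left as an unspecified linear functional n' of the displacement of x:
  it is used only in directions that keep x fixed, where linearity makes it vanish.\<close>

lemma has_derivative_slowness:
  assumes u: "u \<in> U"
  obtains n' where "linear n'" "((\<lambda>u. slowness u) has_derivative (\<lambda>h. n' (Dx u h))) (at u)"
proof -
  obtain V where V: "open V" "half_space \<subseteq> V" "\<And>x. x \<in> V \<Longrightarrow> 0 < c0 x" "smooth_on V c0"
    using slow2_smooth[OF c0] by metis
  have x: "original A (xx u) \<in> V" using subsurface_x[OF u] V(2) by (auto simp: subsurface_def half_space_def)
  have "((\<lambda>x. 1 / c0 x) has_derivative frechet_derivative (\<lambda>x. 1 / c0 x) (at (original A (xx u)))) (at (original A (xx u)))"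
    using V x by (intro smooth_on_has_derivative[of V] smooth_on_divide smooth_on_const) force+
  from has_derivative_compose[OF original_has_derivative this]
  have d: "((\<lambda>x. 1 / c0 (original A x)) has_derivative
      (\<lambda>h. frechet_derivative (\<lambda>x. 1 / c0 x) (at (original A (xx u))) (original A h))) (at (xx u))" .
  show thesis
    using that[OF has_derivative_linear[OF d] has_derivative_compose[OF has_derivative_x[OF u] d]] .
qed

lemma Dxi_eq:
  assumes u: "u \<in> U"
  obtains n' where "linear n'" "((\<lambda>u. slowness u) has_derivative (\<lambda>h. n' (Dx u h))) (at u)"
    "\<And>h. Dxi u h = - (h $ 7) *\<^sub>R yy u - u $ 7 *\<^sub>R (n' (Dx u h) *\<^sub>R takeoff br u + slowness u *\<^sub>R Dw u h + Dp u h)"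
proof -
  obtain n' where n': "linear n'" "((\<lambda>u. slowness u) has_derivative (\<lambda>h. n' (Dx u h))) (at u)"
    using has_derivative_slowness[OF u] .
  define F where "F h = n' (Dx u h) *\<^sub>R takeoff br u + slowness u *\<^sub>R Dw u h + Dp u h" for h
  have "(yy has_derivative (\<lambda>h. slowness u *\<^sub>R Dw u h + n' (Dx u h) *\<^sub>R takeoff br u + Dp u h)) (at u)"
    unfolding yy_def[abs_def]
    by (intro has_derivative_add has_derivative_scaleR n' has_derivative_takeoff has_derivative_p u)
  then have y: "(yy has_derivative F) (at u)" by (simp add: F_def[abs_def] add_ac)
  have "((\<lambda>u. - (u $ 7) * yy u $ i) has_derivative (\<lambda>h. - (u $ 7) * F h $ i + - (h $ 7) * yy u $ i)) (at u)" for i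
    by (intro has_derivative_mult has_derivative_minus nth_has_derivative bounded_linear.has_derivative[OF bounded_linear_vec_nth] y)
  note d = this
  have "DR u h $ 4 = - (u $ 7) * F h $ 1 + - (h $ 7) * yy u $ 1"
    "DR u h $ 5 = - (u $ 7) * F h $ 2 + - (h $ 7) * yy u $ 2"
    "DR u h $ 6 = - (u $ 7) * F h $ 3 + - (h $ 7) * yy u $ 3" for h
    using fun_cong[OF has_derivative_unique[OF has_derivative_R_nth[OF u, of 4, unfolded Rf_nth] d], of h]
      fun_cong[OF has_derivative_unique[OF has_derivative_R_nth[OF u, of 5, unfolded Rf_nth] d], of h]
      fun_cong[OF has_derivative_unique[OF has_derivative_R_nth[OF u, of 6, unfolded Rf_nth] d], of h] by auto
  then have "Dxi u h = - (h $ 7) *\<^sub>R yy u - u $ 7 *\<^sub>R F h" for h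
    by (simp add: Dxi_def vec_eq_iff forall_3)
  then show thesis using that[OF n'] by (simp add: F_def)
qed

lemma linear_Dxi: "u \<in> U \<Longrightarrow> linear (Dxi u)"
  by (rule linearI) (simp_all add: Dxi_def vec_eq_iff forall_3 linear_add[OF linear_DR] linear_cmul[OF linear_DR])

lemma incident_part_eq_0: "h $ 1 = 0 \<Longrightarrow> h $ 2 = 0 \<Longrightarrow> h $ 3 = 0 \<Longrightarrow> h $ 4 = 0 \<Longrightarrow> incident_part h = 0"
  by (simp add: incident_part_def vec_eq_iff forall_4)

lemma Df_eq:
  assumes u: "u \<in> U"
  shows "Df u h = h $ 2 * partial_deriv 1 f (incident_part u) + h $ 3 * partial_deriv 2 f (incident_part u)
     + h $ 1 * partial_deriv 3 f (incident_part u) + h $ 4 * partial_deriv 4 f (incident_part u)"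
  using linear_standard_basis[OF has_derivative_linear[OF smooth_on_has_derivative[OF smooth_f inD[OF u]]], of "incident_part h"]
  by (simp add: sum_4 partial_deriv_def) (simp add: incident_part_def)

text \<open>\<open>Dw\<close> is tangent to the unit sphere, so the inner product with the takeoff
  direction leaves only the change of \<tau> times \<open>yy u \<bullet> takeoff br u\<close>, which
  is nonzero. Once \<tau> is stationary, so are the takeoff direction and its coordinates
  \<alpha>.\<close>

lemma fibre_directions:
  assumes u: "u \<in> U" and h: "h $ 1 = 0" "h $ 2 = 0" "h $ 3 = 0" "h $ 4 = 0"
  shows "Dx u h = 0" "Dxi u h = - (h $ 7) *\<^sub>R yy u - (u $ 7 * slowness u) *\<^sub>R Dw u h"
    and "Dxi u h = 0 \<Longrightarrow> h = 0"
proof -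
  have f0: "Df u h = 0" using h by (simp add: Df_eq[OF u])
  then show Dx: "Dx u h = 0" using h by (simp add: Dx_def vec_eq_iff forall_3)
  have g0: "frechet_derivative g (at (incident_part u)) (incident_part h) = 0" if "smooth_on D g" for g :: "real^4 \<Rightarrow> real"
    using incident_part_eq_0[OF h] linear_0[OF has_derivative_linear[OF smooth_on_has_derivative[OF that inD[OF u]]]] by simp
  have Dp: "Dp u h = 0" using h g0 smooth_g by (simp add: Dp_def vec_eq_iff forall_3)
  obtain n' where n': "linear n'"
    "\<And>h. Dxi u h = - (h $ 7) *\<^sub>R yy u - u $ 7 *\<^sub>R (n' (Dx u h) *\<^sub>R takeoff br u + slowness u *\<^sub>R Dw u h + Dp u h)"
    using Dxi_eq[OF u] by metis
  show eq: "Dxi u h = - (h $ 7) *\<^sub>R yy u - (u $ 7 * slowness u) *\<^sub>R Dw u h"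
    unfolding n'(2) Dx Dp linear_0[OF n'(1)] by simp
  assume z: "Dxi u h = 0"
  have wt: "Dw u h \<bullet> takeoff br u = 0"
    using takeoff3[OF u] by (simp add: Dw_def inner_vec_def sum_3) (simp add: takeoff_def algebra_simps)
  have "Dxi u h \<bullet> takeoff br u = - (h $ 7) * (yy u \<bullet> takeoff br u)"
    unfolding eq using wt by (simp add: inner_diff_left)
  then have h7: "h $ 7 = 0" using z yy_takeoff[OF u] by simp
  then have "Dw u h = 0" using eq z tau[OF u] slowness_pos[OF u] by simp
  then have "h $ 5 = 0" "h $ 6 = 0" by (simp_all add: Dw_def vec_eq_iff forall_3)
  then show "h = 0" using h h7 by (simp add: vec_eq_iff forall_7)
qed

text \<open>Every change of \<xi> can be realized with x fixed. In the symplectic form such a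
  direction pairs with the displacement of x alone, and choosing the change of \<xi> equal to that
  displacement shows whether it is zero.\<close>

lemma fibre_directions_surj:
  assumes u: "u \<in> U"
  obtains h where "h $ 1 = 0" "h $ 2 = 0" "h $ 3 = 0" "h $ 4 = 0" "Dxi u h = b"
proof -
  define E :: "real^3 \<Rightarrow> real^7" where "E k = vector [0, 0, 0, 0, k $ 1, k $ 2, k $ 3]" for k
  have E: "linear E" by (rule linearI) (simp_all add: E_def vec_eq_iff forall_7)
  have lin: "linear (\<lambda>k. Dxi u (E k))"
    using linear_compose[OF E linear_Dxi[OF u]] by (simp add: o_def)
  have "inj (\<lambda>k. Dxi u (E k))"
    unfolding linear_injective_0[OF lin]
  proof (intro allI impI)
    fix k assume "Dxi u (E k) = 0"
    then have "E k = 0" by (intro fibre_directions(3)[OF u]) (simp_all add: E_def)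
    then show "k = 0" by (simp add: E_def vec_eq_iff forall_7 forall_3)
  qed
  then have "surj (\<lambda>k. Dxi u (E k))" using lin linear_injective_imp_surjective by blast
  then obtain k where "Dxi u (E k) = b" by (metis surjD)
  then show thesis using that[of "E k"] by (simp add: E_def)
qed

end

text \<open>The symplectic form on the left factor, in the coordinates \<open>(s\<^sub>1,r\<^sub>1,r\<^sub>2,t,\<sigma>,\<rho>\<^sub>1,\<rho>\<^sub>2,\<tau>)\<close>.\<close>

definition pairing :: "real^8 \<Rightarrow> real^8 \<Rightarrow> real"
  where "pairing X Y = X $ 8 * Y $ 4 - Y $ 8 * X $ 4 + (X $ 5 * Y $ 1 - Y $ 5 * X $ 1)
    + (X $ 6 * Y $ 2 - Y $ 6 * X $ 2) + (X $ 7 * Y $ 3 - Y $ 7 * X $ 3)"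

lemma surface_point_nth [simp]:
  "surface_point a $ 1 = fst a" "surface_point a $ 2 = snd a" "surface_point a $ 3 = 0"
  by (simp_all add: surface_point_def)

section \<open>Ray estimates and the symplectic form along the parametrization\<close>

context marine_geometry
begin

text \<open>Initial data, at the scattering point, of the incident ray traversed backwards; the
  reversal changes the sign of the covector.\<close>

definition incident_end :: "real^7 \<Rightarrow> (real^3) \<times> (real^3)"
  where "incident_end u = (original A (xx u), - original A (pp u))"

definition reflected_start :: "real^7 \<Rightarrow> (real^3) \<times> (real^3)"
  where "reflected_start u = (original A (xx u), - slowness u *\<^sub>R original A (takeoff br u))"

lemma incident_end_has_derivative:
  "u \<in> U \<Longrightarrow> (incident_end has_derivative (\<lambda>h. (original A (Dx u h), - original A (Dp u h)))) (at u)"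
  unfolding incident_end_def[abs_def]
  by (intro has_derivative_Pair has_derivative_minus has_derivative_compose[OF _ original_has_derivative]
      has_derivative_x has_derivative_p)

lemma reflected_start_has_derivative:
  assumes u: "u \<in> U"
  obtains n' where "linear n'" "(reflected_start has_derivative
    (\<lambda>h. (original A (Dx u h), - slowness u *\<^sub>R original A (Dw u h) + (- n' (Dx u h)) *\<^sub>R original A (takeoff br u)))) (at u)"
proof -
  obtain n' where n': "linear n'" "((\<lambda>u. slowness u) has_derivative (\<lambda>h. n' (Dx u h))) (at u)"
    using has_derivative_slowness[OF u] .
  show thesis
    by (rule that[OF n'(1)], unfold reflected_start_def[abs_def])
       (intro has_derivative_Pair has_derivative_scaleR has_derivative_minus n'(2)
          has_derivative_compose[OF _ original_has_derivative] has_derivative_x[OF u] has_derivative_takeoff[OF u])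
qed

lemma eventually_near:
  assumes "(z has_derivative z') (at u)" "0 < \<delta>"
  shows "eventually (\<lambda>x. norm (z x - z u) < \<delta>) (nhds u)"
proof -
  have "isCont z u" using has_derivative_continuous[OF assms(1)] .
  then have "(z \<longlongrightarrow> z u) (nhds u)" by (simp add: continuous_at tendsto_at_iff_tendsto_nhds)
  from tendstoD[OF this assms(2)] show ?thesis by (simp add: dist_norm)
qed

lemma eventually_U: "u \<in> U \<Longrightarrow> eventually (\<lambda>x. x \<in> U) (nhds u)"
  using openU eventually_nhds_in_open by blast

text \<open>The first variation formula for the total travel time; multiplied by \<open>\<tau>\<close>, it says that the
  canonical one-forms of the two factors agree along the parametrization.\<close>

lemma contact:
  assumes u: "u \<in> U"
  shows "DL u h $ 4 = - (yy u \<bullet> Dx u h) + p0 (incident_part u) $ 1 * h $ 1 + q u $ 1 * DL u h $ 2 + q u $ 2 * DL u h $ 3"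
proof -
  let ?P = "p0 (incident_part u) $ 1"
  \<comment> \<open>The total travel time minus its predicted linear variation with coefficients
    frozen at u. The second arrival estimates of the two legs, applied at x and u, add up to a
    quadratic bound for its increments.\<close>
  define \<phi> where "\<phi> x = Lf x $ 4 + yy u \<bullet> xx x - ?P * x $ 1 - q u $ 1 * Lf x $ 2 - q u $ 2 * Lf x $ 3" for x
  define \<phi>' where "\<phi>' h = DL u h $ 4 + yy u \<bullet> Dx u h - ?P * h $ 1 - q u $ 1 * DL u h $ 2 - q u $ 2 * DL u h $ 3" for h
  have \<phi>: "(\<phi> has_derivative \<phi>') (at u)"
    unfolding \<phi>_def[abs_def] \<phi>'_def[abs_def]
    by (intro has_derivative_diff has_derivative_add has_derivative_mult_right has_derivative_inner_right
        has_derivative_L_nth has_derivative_x nth_has_derivative u)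
  obtain n' where n': "linear n'" and rs: "(reflected_start has_derivative
    (\<lambda>h. (original A (Dx u h), - slowness u *\<^sub>R original A (Dw u h) + (- n' (Dx u h)) *\<^sub>R original A (takeoff br u)))) (at u)"
    using reflected_start_has_derivative[OF u] .
  have ie: "(incident_end has_derivative (\<lambda>h. (original A (Dx u h), - original A (Dp u h)))) (at u)"
    using incident_end_has_derivative[OF u] .
  obtain C1 \<delta>1 where e1: "arrival_estimates c0 C1 \<delta>1 (original A (xx u)) (- original A (pp u)) (t_inc (incident_part u))
      (surface_point (u $ 1, s2)) (- p0 (incident_part u))"
    using ray_arrival[OF c0 no_grazing reversed_incident_ray[OF u] subsurface_x[OF u] surface_point_nth(3)] .
  obtain C2 \<delta>2 where e2: "arrival_estimates c0 C2 \<delta>2 (original A (xx u)) (- slowness u *\<^sub>R original A (takeoff br u)) (t_ref u)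
      (surface_point (r1 u, r2 u)) (- q u)"
    using ray_arrival[OF c0 no_grazing reflected_ray[OF u] subsurface_x[OF u] surface_point_nth(3)] .
  note 1 = arrival_estimatesD[OF e1, folded incident_end_def] and 2 = arrival_estimatesD[OF e2, folded reflected_start_def]
  have ev: "eventually (\<lambda>x. norm (\<phi> x - \<phi> u) \<le> (C1 + C2) * (norm ((incident_end x, reflected_start x) - (incident_end u, reflected_start u)))\<^sup>2) (nhds u)"
    using eventually_near[OF ie 1(2)] eventually_near[OF rs 2(2)] eventually_U[OF u]
  proof eventually_elim
    case (elim x)
    let ?N = "norm ((incident_end x, reflected_start x) - (incident_end u, reflected_start u))"
    have dx: "original A (xx x) - original A (xx u) = original A (xx x - xx u)"
      using linear_diff[OF original_linear] by metis
    let ?a = "t_inc (incident_part x) - t_inc (incident_part u) - (- (pp u \<bullet> (xx x - xx u)) + ?P * (x $ 1 - u $ 1))"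
    let ?b = "t_ref x - t_ref u - (- (slowness u * (takeoff br u \<bullet> (xx x - xx u))) + q u $ 1 * (r1 x - r1 u) + q u $ 2 * (r2 x - r2 u))"
    have "\<bar>?a\<bar> \<le> C1 * (norm (incident_end x - incident_end u))\<^sup>2"
      using 1(4)[OF reversed_incident_ray[OF elim(3)] surface_point_nth(3), folded incident_end_def] elim(1)
      by (simp add: dx original_inner[OF orth] incident_end_def inner_vec_def[of "p0 (incident_part u)"] sum_3)
    also have "\<dots> \<le> C1 * ?N\<^sup>2"
      using norm_fst_diff_le 1(1) by (intro mult_left_mono power_mono) auto
    finally have a: "\<bar>?a\<bar> \<le> C1 * ?N\<^sup>2" .
    have "\<bar>?b\<bar> \<le> C2 * (norm (reflected_start x - reflected_start u))\<^sup>2"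
      using 2(4)[OF reflected_ray[OF elim(3)] surface_point_nth(3), folded reflected_start_def] elim(2)
      by (simp add: dx original_inner[OF orth] reflected_start_def inner_vec_def[of "q u"] sum_3 algebra_simps)
    also have "\<dots> \<le> C2 * ?N\<^sup>2"
      using norm_snd_diff_le 2(1) by (intro mult_left_mono power_mono) auto
    finally have b: "\<bar>?b\<bar> \<le> C2 * ?N\<^sup>2" .
    have "\<phi> x - \<phi> u = ?a + ?b"
      by (simp add: \<phi>_def Lf_nth yy_def inner_diff_right inner_add_left algebra_simps)
    then have "norm (\<phi> x - \<phi> u) \<le> C1 * ?N\<^sup>2 + C2 * ?N\<^sup>2" using a b by simp
    then show ?case by (simp add: distrib_right)
  qed
  have "\<phi>' h = 0"
    by (rule derivative_zero_if_quadratic[OF \<phi> has_derivative_Pair[OF ie rs] ev]) (use 1 2 in simp)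
  then show ?thesis by (simp add: \<phi>'_def)
qed

text \<open>Smoothness is given for the canonical point, not for q. The two tangential components
  are recovered from \<rho> = -\<tau> q by dividing by \<tau> \<noteq> 0.\<close>

lemma final_slowness_has_derivative:
  assumes u: "u \<in> U"
  shows "((\<lambda>u. q u $ 1) has_derivative (\<lambda>h. - (DL u h $ 6 + h $ 7 * q u $ 1) / u $ 7)) (at u)"
    and "((\<lambda>u. q u $ 2) has_derivative (\<lambda>h. - (DL u h $ 7 + h $ 7 * q u $ 2) / u $ 7)) (at u)"
proof -
  have t: "u $ 7 \<noteq> 0" using tau[OF u] .
  have "((\<lambda>u. - (Lf u $ 6 / u $ 7)) has_derivative (\<lambda>h. - ((DL u h $ 6 * u $ 7 - Lf u $ 6 * h $ 7) / (u $ 7 * u $ 7)))) (at u)"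
    by (intro has_derivative_minus has_derivative_divide' has_derivative_L_nth nth_has_derivative u t)
  moreover have "(\<lambda>h. - ((DL u h $ 6 * u $ 7 - Lf u $ 6 * h $ 7) / (u $ 7 * u $ 7))) = (\<lambda>h. - (DL u h $ 6 + h $ 7 * q u $ 1) / u $ 7)"
    using t by (simp add: Lf_nth fun_eq_iff field_simps)
  ultimately have "((\<lambda>u. - (Lf u $ 6 / u $ 7)) has_derivative (\<lambda>h. - (DL u h $ 6 + h $ 7 * q u $ 1) / u $ 7)) (at u)" by simp
  then show "((\<lambda>u. q u $ 1) has_derivative (\<lambda>h. - (DL u h $ 6 + h $ 7 * q u $ 1) / u $ 7)) (at u)"
    by (rule has_derivative_transform_within_open[OF _ openU u]) (simp add: Lf_nth tau)
  have "((\<lambda>u. - (Lf u $ 7 / u $ 7)) has_derivative (\<lambda>h. - ((DL u h $ 7 * u $ 7 - Lf u $ 7 * h $ 7) / (u $ 7 * u $ 7)))) (at u)"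
    by (intro has_derivative_minus has_derivative_divide' has_derivative_L_nth nth_has_derivative u t)
  moreover have "(\<lambda>h. - ((DL u h $ 7 * u $ 7 - Lf u $ 7 * h $ 7) / (u $ 7 * u $ 7))) = (\<lambda>h. - (DL u h $ 7 + h $ 7 * q u $ 2) / u $ 7)"
    using t by (simp add: Lf_nth fun_eq_iff field_simps)
  ultimately have "((\<lambda>u. - (Lf u $ 7 / u $ 7)) has_derivative (\<lambda>h. - (DL u h $ 7 + h $ 7 * q u $ 2) / u $ 7)) (at u)" by simp
  then show "((\<lambda>u. q u $ 2) has_derivative (\<lambda>h. - (DL u h $ 7 + h $ 7 * q u $ 2) / u $ 7)) (at u)"
    by (rule has_derivative_transform_within_open[OF _ openU u]) (simp add: Lf_nth tau)
qed

text \<open>If neither the starting point nor the takeoff direction moves to first order, the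
  Lipschitz estimate for the arrival data makes the end of the reflected ray stationary.\<close>

lemma reflected_end_stationary:
  assumes u: "u \<in> U" and h: "Dx u h = 0" "Dw u h = 0" "h $ 7 = 0"
  shows "DL u h $ 2 = 0" "DL u h $ 3 = 0" "DL u h $ 6 = 0" "DL u h $ 7 = 0"
proof -
  obtain n' where n': "linear n'" and rs: "(reflected_start has_derivative
    (\<lambda>h. (original A (Dx u h), - slowness u *\<^sub>R original A (Dw u h) + (- n' (Dx u h)) *\<^sub>R original A (takeoff br u)))) (at u)"
    using reflected_start_has_derivative[OF u] .
  have z: "(original A (Dx u h), - slowness u *\<^sub>R original A (Dw u h) + (- n' (Dx u h)) *\<^sub>R original A (takeoff br u)) = 0"
    using h linear_0[OF n'] linear_0[OF original_linear] by (simp add: zero_prod_def)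
  obtain C \<delta> where e: "arrival_estimates c0 C \<delta> (original A (xx u)) (- slowness u *\<^sub>R original A (takeoff br u)) (t_ref u)
      (surface_point (r1 u, r2 u)) (- q u)"
    using ray_arrival[OF c0 no_grazing reflected_ray[OF u] subsurface_x[OF u] surface_point_nth(3)] .
  note C = arrival_estimatesD[OF e, folded reflected_start_def]
  have le: "eventually (\<lambda>x. norm ((surface_point (r1 x, r2 x), - q x) - (surface_point (r1 u, r2 u), - q u))
      \<le> C * norm (reflected_start x - reflected_start u)) (nhds u)"
    using eventually_near[OF rs C(2)] eventually_U[OF u]
  proof eventually_elim
    case (elim x)
    show ?case
      using C(3)[OF reflected_ray[OF elim(2)] surface_point_nth(3), folded reflected_start_def] elim(1) by simp
  qed
  have ev: "eventually (\<lambda>x. norm (r1 x - r1 u) \<le> C * norm (reflected_start x - reflected_start u)) (nhds u)"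
    "eventually (\<lambda>x. norm (r2 x - r2 u) \<le> C * norm (reflected_start x - reflected_start u)) (nhds u)"
    "eventually (\<lambda>x. norm (q x $ 1 - q u $ 1) \<le> C * norm (reflected_start x - reflected_start u)) (nhds u)"
    "eventually (\<lambda>x. norm (q x $ 2 - q u $ 2) \<le> C * norm (reflected_start x - reflected_start u)) (nhds u)"
  proof -
    have y: "\<bar>y $ i - y' $ i\<bar> \<le> norm ((y, p) - (y', p'))" and p: "\<bar>p $ i - p' $ i\<bar> \<le> norm ((y, p) - (y', p'))"
      for y y' p p' :: "real^3" and i
      using order_trans[OF component_le_norm_cart[of "y - y'" i] norm_fst_diff_le[of y y' p p']]
        order_trans[OF component_le_norm_cart[of "p - p'" i] norm_snd_diff_le[of p p' y y']] by simp_all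
    let ?y = "\<lambda>x. surface_point (r1 x, r2 x)"
    have "\<bar>r1 x - r1 u\<bar> \<le> norm ((?y x, - q x) - (?y u, - q u))" "\<bar>r2 x - r2 u\<bar> \<le> norm ((?y x, - q x) - (?y u, - q u))"
      "\<bar>q x $ 1 - q u $ 1\<bar> \<le> norm ((?y x, - q x) - (?y u, - q u))" "\<bar>q x $ 2 - q u $ 2\<bar> \<le> norm ((?y x, - q x) - (?y u, - q u))" for x
      using y[of "?y x" 1 "?y u" "- q x" "- q u"] y[of "?y x" 2 "?y u" "- q x" "- q u"]
        p[of "- q x" 1 "- q u" "?y x" "?y u"] p[of "- q x" 2 "- q u" "?y x" "?y u"] by (simp_all add: abs_minus_commute)
    note c = this
    show "eventually (\<lambda>x. norm (r1 x - r1 u) \<le> C * norm (reflected_start x - reflected_start u)) (nhds u)"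
      unfolding real_norm_def by (rule eventually_mono[OF le], rule order_trans[OF c(1)], assumption)
    show "eventually (\<lambda>x. norm (r2 x - r2 u) \<le> C * norm (reflected_start x - reflected_start u)) (nhds u)"
      unfolding real_norm_def by (rule eventually_mono[OF le], rule order_trans[OF c(2)], assumption)
    show "eventually (\<lambda>x. norm (q x $ 1 - q u $ 1) \<le> C * norm (reflected_start x - reflected_start u)) (nhds u)"
      unfolding real_norm_def by (rule eventually_mono[OF le], rule order_trans[OF c(3)], assumption)
    show "eventually (\<lambda>x. norm (q x $ 2 - q u $ 2) \<le> C * norm (reflected_start x - reflected_start u)) (nhds u)"
      unfolding real_norm_def by (rule eventually_mono[OF le], rule order_trans[OF c(4)], assumption)
  qed
  show "DL u h $ 2 = 0" "DL u h $ 3 = 0"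
    using derivative_zero_if_dominated[OF has_derivative_L_nth[OF u, of 2, unfolded Lf_nth] rs, where k = h, OF z ev(1)]
      derivative_zero_if_dominated[OF has_derivative_L_nth[OF u, of 3, unfolded Lf_nth] rs, where k = h, OF z ev(2)] by auto
  show "DL u h $ 6 = 0" "DL u h $ 7 = 0"
    using derivative_zero_if_dominated[OF final_slowness_has_derivative(1)[OF u] rs, where k = h, OF z ev(3)]
      derivative_zero_if_dominated[OF final_slowness_has_derivative(2)[OF u] rs, where k = h, OF z ev(4)] h(3) tau[OF u] by auto
qed

text \<open>The backward estimate, which asks only for the two components of q present in the left
  factor; the third would not be known to be differentiable.\<close>

lemma reflected_start_stationary:
  assumes u: "u \<in> U" and h: "Dx u h = 0" "h $ 7 = 0" "DL u h $ 2 = 0" "DL u h $ 3 = 0" "DL u h $ 6 = 0" "DL u h $ 7 = 0"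
  shows "h $ 5 = 0" "h $ 6 = 0"
proof -
  obtain n' where n': "linear n'" and rs: "(reflected_start has_derivative
    (\<lambda>h. (original A (Dx u h), - slowness u *\<^sub>R original A (Dw u h) + (- n' (Dx u h)) *\<^sub>R original A (takeoff br u)))) (at u)"
    using reflected_start_has_derivative[OF u] .
  obtain C \<delta> where e: "arrival_estimates c0 C \<delta> (original A (xx u)) (- slowness u *\<^sub>R original A (takeoff br u)) (t_ref u)
      (surface_point (r1 u, r2 u)) (- q u)"
    using ray_arrival[OF c0 no_grazing reflected_ray[OF u] subsurface_x[OF u] surface_point_nth(3)] .
  note C = arrival_estimatesD[OF e, folded reflected_start_def]
  let ?z = "\<lambda>x. ((original A (xx x), (Lf x $ 2, Lf x $ 3)), (q x $ 1, q x $ 2))"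
  have z: "(?z has_derivative (\<lambda>h. ((original A (Dx u h), (DL u h $ 2, DL u h $ 3)),
      (- (DL u h $ 6 + h $ 7 * q u $ 1) / u $ 7, - (DL u h $ 7 + h $ 7 * q u $ 2) / u $ 7)))) (at u)"
    by (intro has_derivative_Pair has_derivative_compose[OF has_derivative_x[OF u] original_has_derivative]
        has_derivative_L_nth[OF u] final_slowness_has_derivative[OF u])
  have z0: "((original A (Dx u h), (DL u h $ 2, DL u h $ 3)),
      (- (DL u h $ 6 + h $ 7 * q u $ 1) / u $ 7, - (DL u h $ 7 + h $ 7 * q u $ 2) / u $ 7)) = 0"
    using h linear_0[OF original_linear] by (simp add: zero_prod_def)
  \<comment> \<open>The factor 5 counts the contributions of x, r1, r2 and the two components of q,
    each at most the norm of the whole tuple.\<close>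
  have le: "eventually (\<lambda>x. norm (snd (reflected_start x) - snd (reflected_start u)) \<le> (5 * C) * norm (?z x - ?z u)) (nhds u)"
    using eventually_near[OF rs C(2)] eventually_U[OF u]
  proof eventually_elim
    case (elim x)
    let ?N = "norm (?z x - ?z u)"
    have n1: "norm ((original A (xx x), (Lf x $ 2, Lf x $ 3)) - (original A (xx u), (Lf u $ 2, Lf u $ 3))) \<le> ?N"
      and n2: "norm ((q x $ 1, q x $ 2) - (q u $ 1, q u $ 2)) \<le> ?N"
      by (rule norm_fst_diff_le norm_snd_diff_le)+
    have n3: "norm ((Lf x $ 2, Lf x $ 3) - (Lf u $ 2, Lf u $ 3)) \<le> ?N"
      using order_trans[OF norm_snd_diff_le n1] .
    have "norm (original A (xx x) - original A (xx u)) \<le> ?N" using order_trans[OF norm_fst_diff_le n1] .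
    moreover have "\<bar>q x $ 1 - q u $ 1\<bar> \<le> ?N" "\<bar>q x $ 2 - q u $ 2\<bar> \<le> ?N"
      using order_trans[OF norm_fst_diff_le n2] order_trans[OF norm_snd_diff_le n2] by auto
    moreover have "\<bar>r1 x - r1 u\<bar> \<le> ?N" "\<bar>r2 x - r2 u\<bar> \<le> ?N"
      using order_trans[OF norm_fst_diff_le n3] order_trans[OF norm_snd_diff_le n3] unfolding Lf_nth by auto
    moreover have "norm (surface_point (r1 x, r2 x) - surface_point (r1 u, r2 u)) \<le> \<bar>r1 x - r1 u\<bar> + \<bar>r2 x - r2 u\<bar>"
      using norm_le_l1_cart[of "surface_point (r1 x, r2 x) - surface_point (r1 u, r2 u)"] by (simp add: sum_3)
    moreover have "norm (snd (reflected_start x) - snd (reflected_start u)) \<le> C * (norm (original A (xx x) - original A (xx u))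
        + norm (surface_point (r1 x, r2 x) - surface_point (r1 u, r2 u)) + \<bar>q x $ 1 - q u $ 1\<bar> + \<bar>q x $ 2 - q u $ 2\<bar>)"
      using C(5)[OF reflected_ray[OF elim(2)] surface_point_nth(3), folded reflected_start_def] elim(1)
      by (simp add: reflected_start_def abs_minus_commute)
    ultimately have "norm (snd (reflected_start x) - snd (reflected_start u)) \<le> C * (5 * ?N)"
      using C(1) by (elim order_trans) (intro mult_left_mono, auto)
    then show ?case by simp
  qed
  have "- slowness u *\<^sub>R original A (Dw u h) + (- n' (Dx u h)) *\<^sub>R original A (takeoff br u) = 0"
    using derivative_zero_if_dominated[OF has_derivative_snd[OF rs] z, where k = h, OF z0 le] by simp
  then have "original A (Dw u h) = 0" using h(1) linear_0[OF n'] slowness_pos[OF u] by simp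
  then have "Dw u h = 0" using original_norm[OF orth, of "Dw u h"] by simp
  then show "h $ 5 = 0" "h $ 6 = 0" by (simp_all add: Dw_def vec_eq_iff forall_3)
qed

lemma symplectic:
  assumes u: "u \<in> U"
  shows "pairing (DL u h) (DL u k) = Dxi u h \<bullet> Dx u k - Dxi u k \<bullet> Dx u h"
proof -
  \<comment> \<open>With these choices P . dQ is \<tau> dt + \<sigma> ds1 + \<rho> dr - \<xi> dx,
    the difference of the canonical one-forms. By \<open>contact\<close> it vanishes identically on
    U.\<close>
  define P :: "real^7 \<Rightarrow> real^7" where "P u = vector [Lf u $ 8, Lf u $ 5, Lf u $ 6, Lf u $ 7, - Rf u $ 4, - Rf u $ 5, - Rf u $ 6]" for u
  define Q :: "real^7 \<Rightarrow> real^7" where "Q u = vector [Lf u $ 4, Lf u $ 1, Lf u $ 2, Lf u $ 3, Rf u $ 1, Rf u $ 2, Rf u $ 3]" for u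
  have sL: "smooth_on U (\<lambda>u. Lf u $ i)" and sR: "smooth_on U (\<lambda>u. Rf u $ j)" and sR': "smooth_on U (\<lambda>u. - Rf u $ j)" for i j
    using smooth_L smooth_R smooth_on_vec_nth smooth_on_minus openU by (blast, blast, blast)
  have "smooth_on U (\<lambda>u. P u $ i)" for i
    using exhaust_7[of i] sL sR' by (auto simp: P_def)
  then have P: "smooth_on U P" by (rule smooth_on_vecI[OF openU])
  have "smooth_on U (\<lambda>u. Q u $ i)" for i
    using exhaust_7[of i] sL sR by (auto simp: Q_def)
  then have Q: "smooth_on U Q" by (rule smooth_on_vecI[OF openU])
  have dP: "(P has_derivative (\<lambda>h. vector [DL u h $ 8, DL u h $ 5, DL u h $ 6, DL u h $ 7, - DR u h $ 4, - DR u h $ 5, - DR u h $ 6])) (at u)"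
    if "u \<in> U" for u
  proof (rule has_derivative_vecI)
    show "((\<lambda>u. P u $ i) has_derivative (\<lambda>h. vector [DL u h $ 8, DL u h $ 5, DL u h $ 6, DL u h $ 7, - DR u h $ 4, - DR u h $ 5, - DR u h $ 6] $ i)) (at u)" for i
      using exhaust_7[of i] has_derivative_L_nth[OF that] has_derivative_minus[OF has_derivative_R_nth[OF that]] by (auto simp: P_def)
  qed
  have DP: "frechet_derivative P (at u) h = vector [DL u h $ 8, DL u h $ 5, DL u h $ 6, DL u h $ 7, - DR u h $ 4, - DR u h $ 5, - DR u h $ 6]"
    if "u \<in> U" for u h
    using fun_cong[OF frechet_derivative_at[OF dP[OF that]], of h] by simp
  have dQ: "(Q has_derivative (\<lambda>h. vector [DL u h $ 4, DL u h $ 1, DL u h $ 2, DL u h $ 3, DR u h $ 1, DR u h $ 2, DR u h $ 3])) (at u)"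
    if "u \<in> U" for u
  proof (rule has_derivative_vecI)
    show "((\<lambda>u. Q u $ i) has_derivative (\<lambda>h. vector [DL u h $ 4, DL u h $ 1, DL u h $ 2, DL u h $ 3, DR u h $ 1, DR u h $ 2, DR u h $ 3] $ i)) (at u)" for i
      using exhaust_7[of i] has_derivative_L_nth[OF that] has_derivative_R_nth[OF that] by (auto simp: Q_def)
  qed
  have DQ: "frechet_derivative Q (at u) h = vector [DL u h $ 4, DL u h $ 1, DL u h $ 2, DL u h $ 3, DR u h $ 1, DR u h $ 2, DR u h $ 3]"
    if "u \<in> U" for u h
    using fun_cong[OF frechet_derivative_at[OF dQ[OF that]], of h] by simp
  have "P u \<bullet> frechet_derivative Q (at u) h = 0" if "u \<in> U" for u h
  proof -
    have "P u \<bullet> frechet_derivative Q (at u) h = u $ 7 * (DL u h $ 4 - (- (yy u \<bullet> Dx u h)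
        + p0 (incident_part u) $ 1 * h $ 1 + q u $ 1 * DL u h $ 2 + q u $ 2 * DL u h $ 3))"
      unfolding DQ[OF that]
      by (simp add: P_def inner_vec_def sum_7 sum_3 Lf_nth Rf_nth DL_nth[OF that] DR_nth[OF that] Dx_def algebra_simps)
    then show ?thesis using contact[OF that, of h] by simp
  qed
  from contact_imp_symplectic[OF openU u P Q this, of k h]
  show ?thesis
    by (simp add: DP[OF u] DQ[OF u] inner_vec_def sum_7 sum_3 pairing_def Dx_def Dxi_def DR_nth[OF u] algebra_simps)
qed

section \<open>Kernels of the two differentials and the critical set\<close>

definition critical :: "(real^7) set"
  where "critical = {u \<in> U. partial_deriv 3 f (incident_part u) = 0 \<and> partial_deriv 4 f (incident_part u) = 0}"

lemma Dx_axis: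
  assumes u: "u \<in> U"
  shows "Dx u (axis 1 1) = vector [0, 0, partial_deriv 3 f (incident_part u)]"
    "Dx u (axis 4 1) = vector [0, 0, partial_deriv 4 f (incident_part u)]"
  by (simp_all add: Dx_def Df_eq[OF u] axis_def)

text \<open>Where f_p = 0, a change of p3 leaves x and the takeoff direction fixed, so \<xi> changes
  by -\<tau> times the change of p.\<close>

lemma Dxi_axis4:
  assumes u: "u \<in> U" and z: "partial_deriv 4 f (incident_part u) = 0"
  shows "Dxi u (axis 4 1) $ 3 = - u $ 7"
proof -
  obtain n' where n': "linear n'"
    "\<And>h. Dxi u h = - (h $ 7) *\<^sub>R yy u - u $ 7 *\<^sub>R (n' (Dx u h) *\<^sub>R takeoff br u + slowness u *\<^sub>R Dw u h + Dp u h)"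
    using Dxi_eq[OF u] by metis
  have "Dx u (axis 4 1) = 0" using z by (simp add: Dx_axis[OF u] vec_eq_iff forall_3)
  then have "n' (Dx u (axis 4 1)) = 0" using linear_0[OF n'(1)] by simp
  then show ?thesis unfolding n'(2) by (simp add: Dw_def Dp_def axis_def)
qed

text \<open>A kernel vector pairs to zero with every image vector. Pairing with directions that only
  change \<xi> makes x stationary; s1 and \<tau> are coordinates of the left factor, and the
  backward ray estimate fixes \<alpha>. Only p3 is left.\<close>

lemma kernel_DL:
  assumes u: "u \<in> U" and h: "DL u h = 0"
  shows "h = h $ 4 *\<^sub>R axis 4 1"
proof -
  have h17: "h $ 1 = 0" "h $ 7 = 0" using DL_nth[OF u, of h] h by auto
  have sym: "Dxi u h \<bullet> Dx u k = Dxi u k \<bullet> Dx u h" for k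
    using symplectic[OF u, of h k] h by (simp add: pairing_def)
  obtain k where k: "k $ 1 = 0" "k $ 2 = 0" "k $ 3 = 0" "k $ 4 = 0" "Dxi u k = Dx u h"
    using fibre_directions_surj[OF u] .
  have "Dx u h \<bullet> Dx u h = 0" using sym[of k] fibre_directions(1)[OF u k(1-4)] k(5) by simp
  then have Dx: "Dx u h = 0" by simp
  then have h23: "h $ 2 = 0" "h $ 3 = 0" by (simp_all add: Dx_def vec_eq_iff forall_3)
  have "h $ 5 = 0" "h $ 6 = 0"
    using reflected_start_stationary[OF u Dx h17(2)] h by auto
  then show ?thesis using h17 h23 by (simp add: vec_eq_iff forall_7 axis_def)
qed

text \<open>In one direction, pairing with the fibre directions yields f_p = 0 and pairing with the
  s1-direction then yields f_s = 0. In the other, x and the takeoff direction are stationary, which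
  settles all components but \<sigma>.\<close>

lemma DL_axis4:
  assumes u: "u \<in> U"
  shows "DL u (axis 4 1) = 0 \<longleftrightarrow> u \<in> critical"
proof
  assume z: "DL u (axis 4 1) = 0"
  have sym: "Dxi u (axis 4 1) \<bullet> Dx u k = Dxi u k \<bullet> Dx u (axis 4 1)" for k
    using symplectic[OF u, of "axis 4 1" k] z by (simp add: pairing_def)
  obtain k where k: "k $ 1 = 0" "k $ 2 = 0" "k $ 3 = 0" "k $ 4 = 0" "Dxi u k = Dx u (axis 4 1)"
    using fibre_directions_surj[OF u] .
  have "Dx u (axis 4 1) \<bullet> Dx u (axis 4 1) = 0" using sym[of k] fibre_directions(1)[OF u k(1-4)] k(5) by simp
  then have Dx: "Dx u (axis 4 1) = 0" by simp
  then have f4: "partial_deriv 4 f (incident_part u) = 0" by (simp add: Dx_axis[OF u] vec_eq_iff forall_3)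
  have "Dxi u (axis 4 1) \<bullet> Dx u (axis 1 1) = 0" using sym[of "axis 1 1"] Dx by simp
  then have "- u $ 7 * partial_deriv 3 f (incident_part u) = 0"
    using Dxi_axis4[OF u f4] by (simp add: Dx_axis[OF u] inner_vec_def sum_3)
  then show "u \<in> critical" using f4 tau[OF u] u by (simp add: critical_def)
next
  assume "u \<in> critical"
  then have f: "partial_deriv 3 f (incident_part u) = 0" "partial_deriv 4 f (incident_part u) = 0"
    by (auto simp: critical_def)
  then have Dx: "Dx u (axis 4 1) = 0" "Dx u (axis 1 1) = 0"
    by (simp_all add: Dx_axis[OF u] vec_eq_iff forall_3)
  have Dw: "Dw u (axis 4 1) = 0" by (simp add: Dw_def axis_def vec_eq_iff forall_3)
  have r: "DL u (axis 4 1) $ 2 = 0" "DL u (axis 4 1) $ 3 = 0" "DL u (axis 4 1) $ 6 = 0" "DL u (axis 4 1) $ 7 = 0"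
    using reflected_end_stationary[OF u Dx(1) Dw] by (simp_all add: axis_def)
  have a: "DL u (axis 4 1) $ 1 = 0" "DL u (axis 4 1) $ 8 = 0" by (simp_all add: DL_nth[OF u] axis_def)
  have b: "DL u (axis 4 1) $ 4 = 0"
    unfolding contact[OF u] Dx r by (simp add: axis_def)
  \<comment> \<open>The incident covector at x does change with p3, so \<sigma> cannot be treated by
    stationarity of the ray. It is isolated by pairing with the s1-direction, which has first
    component 1 and, as f_s = 0, leaves x fixed.\<close>
  have "pairing (DL u (axis 4 1)) (DL u (axis 1 1)) = 0"
    using symplectic[OF u, of "axis 4 1" "axis 1 1"] Dx by simp
  then have "DL u (axis 4 1) $ 5 * DL u (axis 1 1) $ 1 = 0" using r a b by (simp add: pairing_def)
  then have "DL u (axis 4 1) $ 5 = 0" by (simp add: DL_nth[OF u] axis_def)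
  then show "DL u (axis 4 1) = 0" using r a b by (simp add: vec_eq_iff forall_8)
qed

lemma jacobian_L: "u \<in> U \<Longrightarrow> jacobian Lf (at u) *v h = DL u h"
  and jacobian_R: "u \<in> U \<Longrightarrow> jacobian Rf (at u) *v h = DR u h"
  using jacobian_mult smooth_on_differentiable smooth_L smooth_R by blast+

lemma rank_drops_L: "rank_drops_at_most_1 U Lf" and rank_drop_set_L: "rank_drop_set U Lf = critical"
proof -
  have k: "w = 0" if "u \<in> U" "jacobian Lf (at u) *v w = 0" "w $ 4 = 0" for u w
    using kernel_DL[OF that(1), of w] that jacobian_L by simp
  show "rank_drops_at_most_1 U Lf"
    using rank_ge_if_kernel_small[of "jacobian Lf (at u)" 4 for u] k by (simp add: rank_drops_at_most_1_def)
  have "rank (jacobian Lf (at u)) < 7 \<longleftrightarrow> u \<in> critical" if u: "u \<in> U" for u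
  proof
    assume "rank (jacobian Lf (at u)) < 7"
    then obtain w where w: "w \<noteq> 0" "DL u w = 0"
      using rank_less_iff_kernel[of "jacobian Lf (at u)"] jacobian_L[OF u] by auto
    then have e: "w = w $ 4 *\<^sub>R axis 4 1" using kernel_DL[OF u] by blast
    then have "w $ 4 \<noteq> 0" using w(1) by auto
    moreover have "w $ 4 *\<^sub>R DL u (axis 4 1) = 0"
      using w(2) e linear_cmul[OF linear_DL[OF u]] by metis
    ultimately show "u \<in> critical" using DL_axis4[OF u] by simp
  next
    assume "u \<in> critical"
    then have "\<exists>w. w \<noteq> 0 \<and> jacobian Lf (at u) *v w = 0"
      using DL_axis4[OF u] by (intro exI[of _ "axis 4 1"]) (simp add: jacobian_L[OF u] axis_eq_0_iff)
    then show "rank (jacobian Lf (at u)) < 7"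
      using rank_less_iff_kernel[of "jacobian Lf (at u)"] by simp
  qed
  then show "rank_drop_set U Lf = critical"
    by (auto simp: rank_drop_set_def critical_def)
qed

text \<open>Since \<xi> can be varied arbitrarily with x fixed, an annihilating covector has no
  \<xi>-part; what remains is an annihilator of the differential of (x1, x2, f).\<close>

lemma left_kernel_R:
  assumes u: "u \<in> U"
  shows "transpose (jacobian Rf (at u)) *v n = 0 \<longleftrightarrow>
    n $ 4 = 0 \<and> n $ 5 = 0 \<and> n $ 6 = 0 \<and> n $ 1 + n $ 3 * partial_deriv 1 f (incident_part u) = 0 \<and>
    n $ 2 + n $ 3 * partial_deriv 2 f (incident_part u) = 0 \<and>
    n $ 3 * partial_deriv 3 f (incident_part u) = 0 \<and> n $ 3 * partial_deriv 4 f (incident_part u) = 0"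
    (is "?l \<longleftrightarrow> ?r")
proof -
  let ?x = "vector [n $ 1, n $ 2, n $ 3] :: real^3" and ?\<xi> = "vector [n $ 4, n $ 5, n $ 6] :: real^3"
  have inner: "n \<bullet> DR u h = ?x \<bullet> Dx u h + ?\<xi> \<bullet> Dxi u h" for h
    by (simp add: inner_vec_def sum_6 sum_3 Dx_def Dxi_def DR_nth[OF u])
  have l: "?l \<longleftrightarrow> (\<forall>h. n \<bullet> DR u h = 0)"
    by (rule transpose_jacobian_kernel[OF smooth_on_differentiable[OF smooth_R u]])
  show ?thesis
  proof
    assume ?l
    then have z: "?x \<bullet> Dx u h + ?\<xi> \<bullet> Dxi u h = 0" for h using l inner by simp
    obtain k where k: "k $ 1 = 0" "k $ 2 = 0" "k $ 3 = 0" "k $ 4 = 0" "Dxi u k = ?\<xi>"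
      using fibre_directions_surj[OF u] .
    have "?\<xi> \<bullet> ?\<xi> = 0" using z[of k] fibre_directions(1)[OF u k(1-4)] k(5) by simp
    then have \<xi>: "?\<xi> = 0" by simp
    then have "?x \<bullet> Dx u h = 0" for h using z[of h] by simp
    then have "?x \<bullet> Dx u (axis i 1) = 0" for i by simp
    from this[of 1] this[of 2] this[of 3] this[of 4] \<xi>
    show ?r by (simp add: Dx_def Df_eq[OF u] axis_def inner_vec_def sum_3 vec_eq_iff forall_3)
  next
    assume r: ?r
    then have n: "n $ 1 = - (n $ 3 * partial_deriv 1 f (incident_part u))" "n $ 2 = - (n $ 3 * partial_deriv 2 f (incident_part u))"
      by auto
    have "?x \<bullet> Dx u h = h $ 1 * (n $ 3 * partial_deriv 3 f (incident_part u)) + h $ 4 * (n $ 3 * partial_deriv 4 f (incident_part u))" for h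
      by (simp add: Dx_def Df_eq[OF u] inner_vec_def sum_3 n algebra_simps)
    then have "n \<bullet> DR u h = 0" for h unfolding inner using r by (simp add: inner_vec_def sum_3)
    then show ?l using l by simp
  qed
qed

lemma rank_drops_R: "rank_drops_at_most_1 U Rf" and rank_drop_set_R: "rank_drop_set U Rf = critical"
proof -
  have "n = 0" if "u \<in> U" "transpose (jacobian Rf (at u)) *v n = 0" "n $ 3 = 0" for u n
    using left_kernel_R[OF that(1), of n] that(2,3) by (simp add: vec_eq_iff forall_6)
  then have "6 \<le> rank (transpose (jacobian Rf (at u))) + 1" if "u \<in> U" for u
    using rank_ge_if_kernel_small[of "transpose (jacobian Rf (at u))" 3] that by simp
  then show "rank_drops_at_most_1 U Rf" by (simp add: rank_drops_at_most_1_def rank_transpose)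
  have "rank (jacobian Rf (at u)) < 6 \<longleftrightarrow> u \<in> critical" if u: "u \<in> U" for u
  proof -
    have "rank (jacobian Rf (at u)) < 6 \<longleftrightarrow> (\<exists>n. n \<noteq> 0 \<and> transpose (jacobian Rf (at u)) *v n = 0)"
      using rank_less_iff_kernel[of "transpose (jacobian Rf (at u))"] by (simp add: rank_transpose)
    also have "\<dots> \<longleftrightarrow> u \<in> critical"
    proof
      assume "\<exists>n. n \<noteq> 0 \<and> transpose (jacobian Rf (at u)) *v n = 0"
      then obtain n where n: "n \<noteq> 0" "transpose (jacobian Rf (at u)) *v n = 0" by blast
      note k = n(2)[unfolded left_kernel_R[OF u]]
      have "n $ 3 \<noteq> 0" using n(1) k by (auto simp: vec_eq_iff forall_6)
      then show "u \<in> critical" using k u by (simp add: critical_def)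
    next
      assume "u \<in> critical"
      then show "\<exists>n. n \<noteq> 0 \<and> transpose (jacobian Rf (at u)) *v n = 0"
        unfolding left_kernel_R[OF u]
        by (intro exI[of _ "vector [- partial_deriv 1 f (incident_part u), - partial_deriv 2 f (incident_part u), 1, 0, 0, 0]"])
           (simp add: critical_def vec_eq_iff forall_6)
    qed
    finally show ?thesis .
  qed
  then show "rank_drop_set U Rf = critical"
    by (auto simp: rank_drop_set_def critical_def)
qed

end

text \<open>The converse reading of the padded Hessian: a kernel vector vanishes outside K because
  of the identity block, and its K-part is killed by the Hessian.\<close>

lemma hessian_det_nonzeroI:
  assumes d: "\<And>k. k \<in> K \<Longrightarrow> partial_deriv k H differentiable (at z)"
    and inj: "\<And>a. (\<And>i. i \<notin> K \<Longrightarrow> a $ i = 0) \<Longrightarrow> (\<And>k. k \<in> K \<Longrightarrow> frechet_derivative (partial_deriv k H) (at z) a = 0) \<Longrightarrow> a = 0"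
  shows "hessian_det K H z \<noteq> 0"
proof -
  define M where "M = (\<chi> i j. if i \<in> K \<and> j \<in> K then partial_deriv i (partial_deriv j H) z else if i = j then 1 else 0)"
  have "a = 0" if "transpose M *v a = 0" for a
  proof (rule inj)
    have M: "(\<Sum>i\<in>UNIV. M $ i $ k * a $ i) = 0" for k
      using that by (simp add: vec_eq_iff matrix_vector_mult_def transpose_def del: transpose_matrix_vector)
    show a0: "a $ k = 0" if "k \<notin> K" for k
    proof -
      have "(\<Sum>i\<in>UNIV. M $ i $ k * a $ i) = (\<Sum>i\<in>UNIV. if i = k then a $ i else 0)"
        using that by (intro sum.cong) (auto simp: M_def)
      then show ?thesis using M[of k] by simp
    qed
    show "frechet_derivative (partial_deriv k H) (at z) a = 0" if k: "k \<in> K" for k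
    proof -
      have "frechet_derivative (partial_deriv k H) (at z) a = (\<Sum>i\<in>UNIV. a $ i * partial_deriv i (partial_deriv k H) z)"
        using linear_standard_basis[OF linear_frechet_derivative[OF d[OF k]], of a] by (simp add: partial_deriv_def)
      also have "\<dots> = (\<Sum>i\<in>UNIV. M $ i $ k * a $ i)"
        using a0 k by (intro sum.cong) (auto simp: M_def)
      finally show ?thesis using M by simp
    qed
  qed
  then have "\<not> rank (transpose M) < CARD('a)" using rank_less_iff_kernel by blast
  then have "det M \<noteq> 0" using det_eq_0_rank[of "transpose M"] by (simp add: det_transpose)
  then show ?thesis by (simp add: hessian_det_def M_def)
qed

lemma smooth_on_pairing:
  "open S \<Longrightarrow> smooth_on S X \<Longrightarrow> smooth_on S Y \<Longrightarrow> smooth_on S (\<lambda>u. pairing (X u) (Y u))"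
  unfolding pairing_def by (intro smooth_on_add smooth_on_diff smooth_on_mult smooth_on_vec_nth)

lemma pairing_bilinear:
  "pairing (X + X') Y = pairing X Y + pairing X' Y" "pairing (c *\<^sub>R X) Y = c * pairing X Y"
  by (simp_all add: pairing_def algebra_simps)

section \<open>Local structure of the critical set\<close>

context marine_geometry
begin

abbreviation "ff i u \<equiv> partial_deriv i f (incident_part u)"
abbreviation "Dff i u h \<equiv> frechet_derivative (partial_deriv i f) (at (incident_part u)) (incident_part h)"

lemma smooth_ff: "smooth_on U (ff i)"
  using inD by (intro smooth_on_compose[OF openU openD _ smooth_on_incident_part[OF openU] smooth_on_partial_deriv[OF smooth_f]]) auto

lemma has_derivative_ff: "u \<in> U \<Longrightarrow> (ff i has_derivative Dff i u) (at u)"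
  by (rule has_derivative_compose[OF incident_part_has_derivative
        smooth_on_has_derivative[OF smooth_on_partial_deriv[OF smooth_f] inD]])

lemma criticalD: "u \<in> critical \<Longrightarrow> u \<in> U" "u \<in> critical \<Longrightarrow> ff 3 u = 0" "u \<in> critical \<Longrightarrow> ff 4 u = 0"
  by (auto simp: critical_def)

lemma hessian_nondegenerate:
  assumes u: "u \<in> critical" and h: "h $ 2 = 0" "h $ 3 = 0" "Dff 3 u h = 0" "Dff 4 u h = 0"
  shows "h $ 1 = 0" "h $ 4 = 0"
proof -
  have "incident_part h = 0"
    using criticalD[OF u] h
    by (intro fold_hessian_nondegenerate[OF folds smooth_f inD]) (auto simp: incident_part_def)
  then show "h $ 1 = 0" "h $ 4 = 0" by (auto simp: incident_part_def vec_eq_iff forall_4)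
qed

text \<open>Restricted to the s1- and p3-directions the pair of derivatives is the 2 x 2 Hessian,
  which is injective and therefore onto.\<close>

lemma hessian_surjective:
  assumes u: "u \<in> critical"
  obtains h where "Dff 3 u h = \<alpha>" "Dff 4 u h = \<beta>"
proof -
  define a b c d where "a = Dff 3 u (axis 1 1)" and "b = Dff 3 u (axis 4 1)" and "c = Dff 4 u (axis 1 1)" and "d = Dff 4 u (axis 4 1)"
  have lin: "linear (Dff i u)" for i
    by (rule has_derivative_linear[OF has_derivative_ff[OF criticalD(1)[OF u]]])
  define comb :: "real \<Rightarrow> real \<Rightarrow> real^7" where "comb s t = s *\<^sub>R axis 1 1 + t *\<^sub>R axis 4 1" for s t
  have D: "Dff 3 u (comb s t) = s * a + t * b" "Dff 4 u (comb s t) = s * c + t * d" for s t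
    by (simp_all add: comb_def linear_add[OF lin] linear_cmul[OF lin] a_def b_def c_def d_def)
  have z: "s = 0 \<and> t = 0" if "s * a + t * b = 0" "s * c + t * d = 0" for s t
  proof -
    have c: "comb s t $ 1 = s" "comb s t $ 2 = 0" "comb s t $ 3 = 0" "comb s t $ 4 = t"
      by (simp_all add: comb_def axis_def)
    show ?thesis
      using hessian_nondegenerate[OF u c(2,3), unfolded D c, OF that] by blast
  qed
  have det: "a * d - b * c \<noteq> 0"
  proof
    assume "a * d - b * c = 0"
    \<comment> \<open>With zero determinant, (-b, a) and (-d, c) solve the homogeneous system, so
      all entries vanish, and then (1, 0) is a nonzero solution.\<close>
    then have "b = 0 \<and> a = 0" "d = 0 \<and> c = 0" using z[of "- b" a] z[of "- d" c] by (auto simp: algebra_simps)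
    then show False using z[of 1 0] by simp
  qed
  let ?d = "a * d - b * c"
  show thesis
  \<comment> \<open>Cramer's rule for the 2 x 2 system.\<close>
  proof (rule that[of "comb ((\<alpha> * d - b * \<beta>) / ?d) ((a * \<beta> - \<alpha> * c) / ?d)"])
    have "(\<alpha> * d - b * \<beta>) * a + (a * \<beta> - \<alpha> * c) * b = \<alpha> * ?d" "(\<alpha> * d - b * \<beta>) * c + (a * \<beta> - \<alpha> * c) * d = \<beta> * ?d"
      by (simp_all add: algebra_simps)
    then show "Dff 3 u (comb ((\<alpha> * d - b * \<beta>) / ?d) ((a * \<beta> - \<alpha> * c) / ?d)) = \<alpha>"
      "Dff 4 u (comb ((\<alpha> * d - b * \<beta>) / ?d) ((a * \<beta> - \<alpha> * c) / ?d)) = \<beta>"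
      unfolding D times_divide_eq_left add_divide_distrib[symmetric] by (simp_all only: nonzero_mult_div_cancel_right[OF det])
  qed
qed

text \<open>f_s and f_p take the places of s1 and p3. By nondegeneracy of the Hessian this is a
  chart near each critical point, in which the critical set is a coordinate plane.\<close>

definition straighten :: "real^7 \<Rightarrow> real^7"
  where "straighten u = (\<chi> i. if i = 1 then ff 3 u else if i = 4 then ff 4 u else u $ i)"

lemma smooth_straighten: "smooth_on U straighten"
proof (rule smooth_on_vecI[OF openU])
  show "smooth_on U (\<lambda>u. straighten u $ i)" for i
    using smooth_ff smooth_on_vec_nth[OF openU smooth_on_id[OF openU]]
    by (cases "i = 1"; cases "i = 4") (simp_all add: straighten_def)
qed

lemma straighten_chart:
  assumes u: "u \<in> critical" and O: "open O'" "u \<in> O'" "O' \<subseteq> U"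
  obtains V where "u \<in> V" "V \<subseteq> O'" "local_coordinates V straighten"
proof -
  have uU: "u \<in> U" using criticalD u by blast
  have "(straighten has_derivative (\<lambda>h. \<chi> i. if i = 1 then Dff 3 u h else if i = 4 then Dff 4 u h else h $ i)) (at u)"
  proof (rule has_derivative_vecI)
    show "((\<lambda>u. straighten u $ i) has_derivative (\<lambda>h. (\<chi> i. if i = 1 then Dff 3 u h else if i = 4 then Dff 4 u h else h $ i) $ i)) (at u)" for i
      using has_derivative_ff[OF uU] nth_has_derivative
      by (cases "i = 1"; cases "i = 4") (simp_all add: straighten_def)
  qed
  from fun_cong[OF frechet_derivative_at[OF this]]
  have D: "frechet_derivative straighten (at u) h = (\<chi> i. if i = 1 then Dff 3 u h else if i = 4 then Dff 4 u h else h $ i)" for h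
    by simp
  have "h = 0" if "frechet_derivative straighten (at u) h = 0" for h
  proof -
    have e: "Dff 3 u h = 0" "h $ 2 = 0" "h $ 3 = 0" "Dff 4 u h = 0" "h $ 5 = 0" "h $ 6 = 0" "h $ 7 = 0"
      using that unfolding D vec_eq_iff forall_7 by auto
    then show ?thesis using hessian_nondegenerate[OF u, of h] by (simp add: vec_eq_iff forall_7)
  qed
  then show thesis
    using local_coordinates_inverse_function[OF O(1) smooth_on_subset[OF smooth_straighten O(3)] O(2)] that by blast
qed

lemma critical_iff_straighten: "u \<in> U \<Longrightarrow> u \<in> critical \<longleftrightarrow> (\<forall>i\<in>{1, 4}. straighten u $ i = 0)"
  by (simp add: critical_def straighten_def)

lemma critical_submanifold: "smooth_submanifold 2 critical"
  unfolding smooth_submanifold_def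
proof
  fix u assume u: "u \<in> critical"
  obtain V where V: "u \<in> V" "V \<subseteq> U" "local_coordinates V straighten"
    using straighten_chart[OF u openU criticalD(1)[OF u] order_refl] .
  have "straighten ` (critical \<inter> V) = {y \<in> straighten ` V. \<forall>i\<in>{1, 4}. y $ i = 0}"
    using V(2) critical_iff_straighten by blast
  then show "\<exists>V \<phi> K. u \<in> V \<and> local_coordinates V \<phi> \<and> card K = 2 \<and> \<phi> ` (critical \<inter> V) = {y \<in> \<phi> ` V. \<forall>i\<in>K. y $ i = 0}"
    using V(1,3) by (intro exI[of _ V] exI[of _ straighten] exI[of _ "{1, 4}"]) simp
qed

text \<open>Hadamard's lemma in the straightening chart, pulled back: locally f_s and f_p generate
  the ideal of the critical set.\<close>

lemma vanishing_on_critical: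
  assumes u: "u \<in> critical" and O: "open O'" "u \<in> O'" "O' \<subseteq> U"
    and g: "smooth_on O' g" and vanish: "\<And>y. y \<in> O' \<Longrightarrow> y \<in> critical \<Longrightarrow> g y = 0"
  shows "\<exists>O'' a b. open O'' \<and> u \<in> O'' \<and> O'' \<subseteq> O' \<and> smooth_on O'' a \<and> smooth_on O'' b \<and>
    (\<forall>y\<in>O''. g y = ff 3 y * a y + ff 4 y * b y)"
proof -
  obtain V where V: "u \<in> V" "V \<subseteq> O'" and lc: "local_coordinates V straighten"
    using straighten_chart[OF u O] .
  let ?inv = "inv_into V straighten" and ?z = "straighten u"
  have lc': "open V" "inj_on straighten V" "open (straighten ` V)" "smooth_on (straighten ` V) ?inv"
    using lc by (auto simp: local_coordinates_def)
  obtain r where r: "0 < r" "ball ?z r \<subseteq> straighten ` V"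
    using lc'(3) V(1) open_contains_ball by blast
  have inv: "?inv z \<in> V" "straighten (?inv z) = z" if "z \<in> ball ?z r" for z
    using inv_into_into[OF subsetD[OF r(2) that]] f_inv_into_f[OF subsetD[OF r(2) that]] .
  have z0: "?z $ i = 0" if "i \<in> {1, 4}" for i
    using critical_iff_straighten[of u] u criticalD(1)[OF u] that by blast
  have "smooth_on (ball ?z r) (\<lambda>z. g (?inv z))"
    using inv(1) V(2) by (intro smooth_on_compose[OF open_ball O(1) _ smooth_on_subset[OF lc'(4) r(2)] g]) auto
  moreover have "g (?inv z) = 0" if "z \<in> ball ?z r" "\<And>i. i \<in> {1, 4} \<Longrightarrow> z $ i = 0" for z
  proof (rule vanish)
    show "?inv z \<in> O'" using inv(1)[OF that(1)] V(2) by blast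
    then show "?inv z \<in> critical"
      using critical_iff_straighten[of "?inv z"] inv(2)[OF that(1)] that(2) O(3) by auto
  qed
  ultimately obtain a where a: "\<And>i. smooth_on (ball ?z r) (a i)"
    "\<And>z. z \<in> ball ?z r \<Longrightarrow> g (?inv z) = (\<Sum>i\<in>{1, 4}. z $ i * a i z)"
    using Hadamard[of "{1, 4}" ?z r "\<lambda>z. g (?inv z)"] z0 by blast
  define O'' where "O'' = V \<inter> straighten -` ball ?z r"
  have sV: "smooth_on V straighten" using lc by (auto simp: local_coordinates_def)
  have "open O''"
    unfolding O''_def by (rule continuous_open_preimage[OF smooth_on_continuous_on[OF sV] lc'(1) open_ball])
  moreover have "u \<in> O''" using V r by (simp add: O''_def)
  moreover have "O'' \<subseteq> O'" using V by (auto simp: O''_def)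
  moreover have "smooth_on O'' (\<lambda>y. a i (straighten y))" for i
    by (rule smooth_on_compose[OF \<open>open O''\<close> open_ball _ smooth_on_subset[OF sV] a(1)]) (auto simp: O''_def)
  moreover have "g y = ff 3 y * a 1 (straighten y) + ff 4 y * a 4 (straighten y)" if "y \<in> O''" for y
    using a(2)[of "straighten y"] that lc'(2) by (simp add: O''_def) (simp add: straighten_def)
  ultimately show ?thesis by (intro exI[of _ O''] exI[of _ "\<lambda>y. a 1 (straighten y)"] exI[of _ "\<lambda>y. a 4 (straighten y)"]) simp
qed

text \<open>Differentiating the relation at u leaves only G1 u and G2 u as coefficients of the
  independent differentials of f_s and f_p. This allows comparing coefficients at a critical point
  in an identity linear in f_s and f_p.\<close>

lemma critical_independent:
  assumes u: "u \<in> critical" and O: "open O'" "u \<in> O'" "O' \<subseteq> U"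
    and G: "smooth_on O' G1" "smooth_on O' G2"
    and z: "\<And>y. y \<in> O' \<Longrightarrow> ff 3 y * G1 y + ff 4 y * G2 y = 0"
  shows "G1 u = 0" "G2 u = 0"
proof -
  have uU: "u \<in> U" and f0: "ff 3 u = 0" "ff 4 u = 0" using criticalD[OF u] by auto
  have 1: "((\<lambda>y. ff 3 y * G1 y + ff 4 y * G2 y) has_derivative
      (\<lambda>h. (ff 3 u * frechet_derivative G1 (at u) h + Dff 3 u h * G1 u) + (ff 4 u * frechet_derivative G2 (at u) h + Dff 4 u h * G2 u))) (at u)"
    by (intro has_derivative_add has_derivative_mult has_derivative_ff[OF uU] smooth_on_has_derivative[OF G(1) O(2)] smooth_on_has_derivative[OF G(2) O(2)])
  have 2: "((\<lambda>y. ff 3 y * G1 y + ff 4 y * G2 y) has_derivative (\<lambda>h. 0)) (at u)"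
    by (rule has_derivative_transform_within_open[OF has_derivative_const O(1,2)]) (simp add: z)
  have *: "Dff 3 u h * G1 u + Dff 4 u h * G2 u = 0" for h
    using fun_cong[OF has_derivative_unique[OF 1 2], of h] f0 by simp
  obtain h1 where "Dff 3 u h1 = 1" "Dff 4 u h1 = 0" using hessian_surjective[OF u] .
  then show "G1 u = 0" using *[of h1] by simp
  obtain h2 where "Dff 3 u h2 = 0" "Dff 4 u h2 = 1" using hessian_surjective[OF u] .
  then show "G2 u = 0" using *[of h2] by simp
qed

subsection \<open>The right projection\<close>

lemma submersion_with_folds_R: "submersion_with_folds U Rf"
proof -
  have normal_form: "\<exists>O' W \<phi> \<psi> l \<iota>.
        u \<in> O' \<and> O' \<subseteq> U \<and> Rf ` O' \<subseteq> W \<and> local_coordinates O' \<phi> \<and> local_coordinates W \<psi> \<and>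
        inj_on \<iota> (- {l}) \<and>
        (\<forall>y\<in>O'. \<forall>i. i \<noteq> l \<longrightarrow> \<psi> (Rf y) $ i = \<phi> y $ \<iota> i) \<and>
        (\<forall>y \<in> critical \<inter> O'.
           hessian_det (- \<iota> ` (- {l})) (\<lambda>z. \<psi> (Rf (inv_into O' \<phi> z)) $ l) (\<phi> y) \<noteq> 0)"
    if u: "u \<in> critical" for u
  proof -
    have uU: "u \<in> U" using criticalD[OF u] by blast
    \<comment> \<open>Source coordinates in which \<xi> replaces (\<alpha>, \<tau>). All components
      of the right projection except x3 = f then are coordinates, and s1 and p3 are the remaining
      variables.\<close>
    define \<phi> :: "real^7 \<Rightarrow> real^7" where "\<phi> y = vector [y $ 1, y $ 2, y $ 3, y $ 4, Rf y $ 4, Rf y $ 5, Rf y $ 6]" for y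
    \<comment> \<open>The final branch also assigns a default value at index 3, the component that
      plays the role of h1; only indices other than 3 count.\<close>
    define \<iota> :: "6 \<Rightarrow> 7" where "\<iota> i = (if i = 1 then 2 else if i = 2 then 3 else if i = 4 then 5 else if i = 5 then 6 else 7)" for i
    have "smooth_on U (\<lambda>y. \<phi> y $ i)" for i
      using exhaust_7[of i] smooth_on_vec_nth[OF openU smooth_on_id[OF openU]] smooth_on_vec_nth[OF openU smooth_R]
      by (auto simp: \<phi>_def)
    then have s\<phi>: "smooth_on U \<phi>" by (rule smooth_on_vecI[OF openU])
    have "(\<phi> has_derivative (\<lambda>h. vector [h $ 1, h $ 2, h $ 3, h $ 4, DR u h $ 4, DR u h $ 5, DR u h $ 6])) (at u)"
    proof (rule has_derivative_vecI)
      show "((\<lambda>y. \<phi> y $ i) has_derivative (\<lambda>h. vector [h $ 1, h $ 2, h $ 3, h $ 4, DR u h $ 4, DR u h $ 5, DR u h $ 6] $ i)) (at u)" for i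
        using exhaust_7[of i] nth_has_derivative has_derivative_R_nth[OF uU] by (auto simp: \<phi>_def)
    qed
    from fun_cong[OF frechet_derivative_at[OF this]]
    have D\<phi>: "frechet_derivative \<phi> (at u) h = vector [h $ 1, h $ 2, h $ 3, h $ 4, DR u h $ 4, DR u h $ 5, DR u h $ 6]" for h
      by simp
    have "h = 0" if "frechet_derivative \<phi> (at u) h = 0" for h
      using that fibre_directions(3)[OF uU, of h] unfolding D\<phi> by (simp add: vec_eq_iff forall_7 forall_3 Dxi_def)
    then obtain O' where O: "u \<in> O'" "O' \<subseteq> U" "local_coordinates O' \<phi>"
      using local_coordinates_inverse_function[OF openU s\<phi> uU] by blast
    have O': "inj_on \<phi> O'" "open (\<phi> ` O')" using O(3) by (auto simp: local_coordinates_def)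
    have id: "local_coordinates (UNIV :: (real^6) set) (\<lambda>z. z)"
    proof -
      have "inv_into UNIV (\<lambda>z. z) = (\<lambda>z. z :: real^6)" by (simp add: fun_eq_iff inv_f_eq)
      then show ?thesis by (simp add: local_coordinates_def smooth_on_id)
    qed
    have "inj_on \<iota> (- {3})"
    proof (rule inj_onI)
      fix i j assume "i \<in> - {3}" "j \<in> - {3}" "\<iota> i = \<iota> j"
      then show "i = j" using exhaust_6[of i] exhaust_6[of j] by (auto simp: \<iota>_def)
    qed
    moreover have K: "- \<iota> ` (- {3}) = {1, 4}"
    proof -
      have "\<iota> ` (- {3}) = {2, 3, 5, 6, 7}"
      proof -
        have "- {3 :: 6} = {1, 2, 4, 5, 6}" using UNIV_6 by auto
        then show ?thesis by (auto simp: \<iota>_def)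
      qed
      then show ?thesis using UNIV_7 by auto
    qed
    moreover have "Rf y $ i = \<phi> y $ \<iota> i" if "i \<noteq> 3" for y i
      using exhaust_6[of i] that by (auto simp: \<phi>_def \<iota>_def Rf_nth(1,2))
    moreover have "hessian_det {1, 4} (\<lambda>z. Rf (inv_into O' \<phi> z) $ 3) (\<phi> y) \<noteq> 0" if y: "y \<in> critical \<inter> O'" for y
    proof -
      let ?H = "\<lambda>z. Rf (inv_into O' \<phi> z) $ 3"
      have inc: "incident_part (\<phi> y) = incident_part y" for y by (simp add: \<phi>_def incident_part_def)
      have zD: "incident_part z \<in> D" if "z \<in> \<phi> ` O'" for z using that O(2) inD inc by auto
      have H: "?H z = f (incident_part z)" if "z \<in> \<phi> ` O'" for z
        using that O'(1) by (auto simp: Rf_nth inc)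
      have pd: "partial_deriv k ?H z = partial_deriv (if k = 1 then 3 else 4) f (incident_part z)" if "z \<in> \<phi> ` O'" "k \<in> {1, 4}" for z k
      proof -
        have "((\<lambda>z. f (incident_part z)) has_derivative (\<lambda>h. frechet_derivative f (at (incident_part z)) (incident_part h))) (at z)"
          by (rule has_derivative_compose[OF incident_part_has_derivative smooth_on_has_derivative[OF smooth_f zD[OF that(1)]]])
        then have "(?H has_derivative (\<lambda>h. frechet_derivative f (at (incident_part z)) (incident_part h))) (at z)"
          by (rule has_derivative_transform_within_open[OF _ O'(2) that(1)]) (simp only: H)
        from fun_cong[OF frechet_derivative_at[OF this], of "axis k 1"]
        have "partial_deriv k ?H z = frechet_derivative f (at (incident_part z)) (incident_part (axis k 1))"
          by (simp add: partial_deriv_def)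
        \<comment> \<open>\<open>incident_part\<close> reorders the variables: s1 and p3 have
          positions 1 and 4 in the parameters of C but 3 and 4 in the arguments of f.\<close>
        moreover have "incident_part (axis k 1) = axis (if k = 1 then 3 else 4) 1"
          using that(2) by (auto simp: incident_part_def axis_def vec_eq_iff forall_4)
        ultimately show ?thesis by (simp add: partial_deriv_def)
      qed
      have \<phi>y: "\<phi> y \<in> \<phi> ` O'" using y by blast
      have dpd: "(partial_deriv k ?H has_derivative Dff (if k = 1 then 3 else 4) y) (at (\<phi> y))" if k: "k \<in> {1, 4}" for k
      proof -
        have "((\<lambda>z. partial_deriv (if k = 1 then 3 else 4) f (incident_part z)) has_derivative Dff (if k = 1 then 3 else 4) y) (at (\<phi> y))"
          using has_derivative_compose[OF incident_part_has_derivative[of "at (\<phi> y)"]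
            smooth_on_has_derivative[OF smooth_on_partial_deriv[OF smooth_f] zD[OF \<phi>y]], of "if k = 1 then 3 else 4"]
          unfolding inc .
        then show ?thesis
          by (rule has_derivative_transform_within_open[OF _ O'(2) \<phi>y]) (simp only: pd[OF _ k])
      qed
      show ?thesis
      proof (rule hessian_det_nonzeroI)
        show "partial_deriv k ?H differentiable (at (\<phi> y))" if "k \<in> {1, 4}" for k
          using dpd[OF that] by (rule differentiableI)
        fix a :: "real^7"
        assume a: "\<And>i. i \<notin> {1, 4} \<Longrightarrow> a $ i = 0" "\<And>k. k \<in> {1, 4} \<Longrightarrow> frechet_derivative (partial_deriv k ?H) (at (\<phi> y)) a = 0"
        have "Dff 3 y a = 0" "Dff 4 y a = 0"
          using a(2)[of 1] a(2)[of 4] fun_cong[OF frechet_derivative_at[OF dpd[of 1]], of a] fun_cong[OF frechet_derivative_at[OF dpd[of 4]], of a] by auto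
        then have "a $ 1 = 0" "a $ 4 = 0"
          using hessian_nondegenerate[of y a] y a(1)[of 2] a(1)[of 3] by auto
        then show "a = 0" using a(1) unfolding vec_eq_iff by (metis empty_iff insert_iff zero_index)
      qed
    qed
    ultimately show ?thesis
      using O id by (intro exI[of _ O'] exI[of _ UNIV] exI[of _ \<phi>] exI[of _ "\<lambda>z. z"] exI[of _ 3] exI[of _ \<iota>]) simp
  qed
  then show ?thesis
    unfolding submersion_with_folds_def rank_drop_set_R
    using openU smooth_R rank_drops_R critical_submanifold by auto
qed

end

context marine_geometry
begin

subsection \<open>The left projection\<close>

definition column4 :: "real^8 \<Rightarrow> real^7 \<Rightarrow> real^7^8"
  where \<comment> \<open>the differential of the left projection with its \<open>p\<^sub>3\<close>-column replaced by \<open>c\<close>\<close>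
    "column4 c u = (\<chi> i j. if j = 4 then c $ i else jacobian Lf (at u) $ i $ j)"

definition column4_minor :: "(7 \<Rightarrow> 8) \<Rightarrow> real^8 \<Rightarrow> real^7 \<Rightarrow> real"
  where "column4_minor \<kappa> c u = det (\<chi> i j. column4 c u $ \<kappa> i $ j)"

text \<open>A determinant is linear in each single column; transposition turns the column into a
  row.\<close>

lemma column4_minor_linear:
  "column4_minor \<kappa> (s *\<^sub>R a + t *\<^sub>R b) u = s * column4_minor \<kappa> a u + t * column4_minor \<kappa> b u"
proof -
  define R :: "real^7 \<Rightarrow> real^7^7" where "R c = (\<chi> j. if j = 4 then c else (\<chi> i. jacobian Lf (at u) $ \<kappa> i $ j))" for c
  define sel :: "real^8 \<Rightarrow> real^7" where "sel c = (\<chi> i. c $ \<kappa> i)" for c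
  have m: "column4_minor \<kappa> c u = det (R (sel c))" for c
  proof -
    have "(\<chi> i j. column4 c u $ \<kappa> i $ j) = transpose (R (sel c))"
      by (simp add: R_def sel_def column4_def transpose_def vec_eq_iff)
    then show ?thesis by (simp add: column4_minor_def det_transpose)
  qed
  have sel: "sel (s *\<^sub>R a + t *\<^sub>R b) = s *s sel a + t *s sel b"
    by (simp add: sel_def vec_eq_iff)
  show ?thesis
    unfolding m R_def sel
    using det_row_add[of 4 "\<lambda>_. s *s sel a" "\<lambda>_. t *s sel b" "\<lambda>j. \<chi> i. jacobian Lf (at u) $ \<kappa> i $ j"]
      det_row_mul[of 4 s "\<lambda>_. sel a" "\<lambda>j. \<chi> i. jacobian Lf (at u) $ \<kappa> i $ j"]
      det_row_mul[of 4 t "\<lambda>_. sel b" "\<lambda>j. \<chi> i. jacobian Lf (at u) $ \<kappa> i $ j"]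
    by simp
qed

lemma maximal_minor_L: "u \<in> U \<Longrightarrow> maximal_minor Lf \<kappa> u = column4_minor \<kappa> (DL u (axis 4 1)) u"
proof -
  assume "u \<in> U"
  have "(\<chi> i j. jacobian Lf (at u) $ \<kappa> i $ j) = (\<chi> i j. column4 (DL u (axis 4 1)) u $ \<kappa> i $ j)"
    by (simp add: column4_def vec_eq_iff jacobian_nth)
  then show ?thesis by (simp add: maximal_minor_def column4_minor_def)
qed

lemma smooth_jacobian_L: "smooth_on U (\<lambda>u. jacobian Lf (at u) $ i $ j)"
  unfolding jacobian_nth by (intro smooth_on_vec_nth[OF openU] smooth_on_frechet_derivative smooth_L)

lemma smooth_maximal_minor_L: "smooth_on U (maximal_minor Lf \<kappa>)"
  unfolding maximal_minor_def[abs_def] by (intro smooth_on_det openU) (simp add: smooth_jacobian_L)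

lemma smooth_column4_minor:
  assumes "open O'" "O' \<subseteq> U" "smooth_on O' c"
  shows "smooth_on O' (\<lambda>u. column4_minor \<kappa> (c u) u)"
  unfolding column4_minor_def
proof (rule smooth_on_det[OF assms(1)])
  show "smooth_on O' (\<lambda>u. (\<chi> i j. column4 (c u) u $ \<kappa> i $ j) $ i $ j)" for i j
    using smooth_on_vec_nth[OF assms(1,3)] smooth_on_subset[OF smooth_jacobian_L assms(2)]
    by (cases "j = 4") (simp_all add: column4_def)
qed

text \<open>Writing the \<open>p\<^sub>3\<close>-column of the differential as \<open>f\<^sub>s a + f\<^sub>p b\<close> near a critical point, the symplectic
  form shows that \<open>a\<close> and \<open>b\<close> are independent modulo the remaining columns: the vectors \<open>dL(w)\<close> with
  \<open>w\<close> in the kernel of the differential of the right projection annihilate those columns and separate \<open>a\<close> from \<open>b\<close>.\<close>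

lemma column4_nonsingular:
  assumes u: "u \<in> critical" and O: "open O'" "u \<in> O'" "O' \<subseteq> U"
    and ab: "smooth_on O' a" "smooth_on O' b"
    and eq: "\<And>y. y \<in> O' \<Longrightarrow> DL y (axis 4 1) = ff 3 y *\<^sub>R a y + ff 4 y *\<^sub>R b y"
    and st: "s \<noteq> 0 \<or> t \<noteq> 0"
  shows "\<exists>\<kappa>. inj \<kappa> \<and> column4_minor \<kappa> (s *\<^sub>R a u + t *\<^sub>R b u) u \<noteq> 0"
proof -
  have uU: "u \<in> U" and f0: "ff 3 u = 0" "ff 4 u = 0" using criticalD[OF u] by auto
  let ?e = "axis 4 1 :: real^7"
  obtain k1 where k1: "k1 $ 1 = 0" "k1 $ 2 = 0" "k1 $ 3 = 0" "k1 $ 4 = 0" "Dxi u k1 = - Dxi u ?e"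
    using fibre_directions_surj[OF uU] .
  obtain k2 where k2: "k2 $ 1 = 0" "k2 $ 2 = 0" "k2 $ 3 = 0" "k2 $ 4 = 0" "Dxi u k2 = - Dxi u (axis 1 1)"
    using fibre_directions_surj[OF uU] .
  \<comment> \<open>The p3- and s1-directions corrected by fibre directions so that \<xi> is
    stationary at u. Both vectors are kept constant in y, since the identities below are needed near
    u.\<close>
  define w1 w2 where "w1 = ?e + k1" and "w2 = axis 1 1 + k2"
  have w1: "w1 $ 1 = 0" "w1 $ 2 = 0" "w1 $ 3 = 0" "w1 $ 4 = 1" and w2: "w2 $ 1 = 1" "w2 $ 2 = 0" "w2 $ 3 = 0" "w2 $ 4 = 0"
    using k1 k2 by (simp_all add: w1_def w2_def axis_def)
  have xi: "Dxi u w1 = 0" "Dxi u w2 = 0"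
    using k1 k2 by (simp_all add: w1_def w2_def linear_add[OF linear_Dxi[OF uU]])
  have Dx: "Dx y w1 = vector [0, 0, ff 4 y]" "Dx y w2 = vector [0, 0, ff 3 y]" "Dx y ?e = vector [0, 0, ff 4 y]" if "y \<in> U" for y
    using w1 w2 by (simp_all add: Dx_def Df_eq[OF that] axis_def)
  have p1: "pairing (DL y ?e) (DL y w1) = ff 4 y * (Dxi y ?e $ 3 - Dxi y w1 $ 3)"
    and p2: "pairing (DL y ?e) (DL y w2) = ff 3 y * Dxi y ?e $ 3 - ff 4 y * Dxi y w2 $ 3" if "y \<in> U" for y
    unfolding symplectic[OF that] Dx[OF that] by (simp_all add: inner_vec_def sum_3 algebra_simps)
  have sL: "smooth_on O' (\<lambda>y. DL y h)" for h
    by (rule smooth_on_subset[OF smooth_on_frechet_derivative[OF smooth_L] O(3)])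
  have sxi: "smooth_on O' (\<lambda>y. Dxi y h $ 3)" for h
    using smooth_on_subset[OF smooth_on_vec_nth[OF openU smooth_on_frechet_derivative[OF smooth_R]] O(3), of h 6]
    by (simp add: Dxi_def)
  have sp: "smooth_on O' (\<lambda>y. pairing (c y) (DL y h))" if "smooth_on O' c" for c h
    by (rule smooth_on_pairing[OF O(1) that sL])
  have xi_e: "Dxi u ?e $ 3 = - u $ 7" using Dxi_axis4[OF uU f0(2)] .
  \<comment> \<open>The pairing of the p3-column with \<open>DL y w1\<close> is known both through a
    and b and through the symplectic form. The difference is linear in f_s and f_p, so the
    coefficients at u can be read off.\<close>
  have "ff 3 y * pairing (a y) (DL y w1) + ff 4 y * (pairing (b y) (DL y w1) - (Dxi y ?e $ 3 - Dxi y w1 $ 3)) = 0"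
    if "y \<in> O'" for y
    using p1[of y] eq[OF that] that O(3) by (auto simp: pairing_bilinear algebra_simps)
  from critical_independent[OF u O sp[OF ab(1)] smooth_on_diff[OF O(1) sp[OF ab(2)] smooth_on_diff[OF O(1) sxi sxi]] this]
  have w1': "pairing (a u) (DL u w1) = 0" "pairing (b u) (DL u w1) = - u $ 7"
    using xi_e xi by auto
  have "ff 3 y * (pairing (a y) (DL y w2) - Dxi y ?e $ 3) + ff 4 y * (pairing (b y) (DL y w2) + Dxi y w2 $ 3) = 0"
    if "y \<in> O'" for y
    using p2[of y] eq[OF that] that O(3) by (auto simp: pairing_bilinear algebra_simps)
  from critical_independent[OF u O smooth_on_diff[OF O(1) sp[OF ab(1)] sxi] smooth_on_add[OF O(1) sp[OF ab(2)] sxi] this]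
  have w2': "pairing (a u) (DL u w2) = - u $ 7" "pairing (b u) (DL u w2) = 0"
    using xi_e xi by auto
  let ?M = "column4 (s *\<^sub>R a u + t *\<^sub>R b u) u"
  have "h = 0" if h: "?M *v h = 0" for h
  proof -
    define h' where "h' = h - h $ 4 *\<^sub>R ?e"
    let ?c = "s *\<^sub>R a u + t *\<^sub>R b u"
    have "?M *v h = jacobian Lf (at u) *v h' + h $ 4 *\<^sub>R ?c"
      by (simp add: vec_eq_iff matrix_vector_mult_def sum_7 column4_def h'_def axis_def)
    then have z: "DL u h' + h $ 4 *\<^sub>R ?c = 0" using h jacobian_L[OF uU] by simp
    \<comment> \<open>At u both x and \<xi> are stationary along \<open>w1\<close> and
      \<open>w2\<close>, so the symplectic form of the right factor vanishes on them.\<close>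
    have ann: "pairing (DL u h') (DL u w1) = 0" "pairing (DL u h') (DL u w2) = 0"
      unfolding symplectic[OF uU] xi using f0 Dx[OF uU] by (simp_all add: inner_vec_def sum_3)
    have "pairing (DL u h' + h $ 4 *\<^sub>R ?c) (DL u w1) = 0" "pairing (DL u h' + h $ 4 *\<^sub>R ?c) (DL u w2) = 0"
      unfolding z by (simp_all add: pairing_def)
    then have "h $ 4 * t = 0" "h $ 4 * s = 0"
      using ann w1' w2' tau[OF uU] by (simp_all add: pairing_bilinear)
    then have h4: "h $ 4 = 0" using st by auto
    then have "DL u h = 0" using z by (simp add: h'_def)
    then show "h = 0" using kernel_DL[OF uU, of h] h4 by simp
  qed
  then show ?thesis unfolding column4_minor_def by (rule nonzero_maximal_minor_exists)
qed

text \<open>The minors are f_s A + f_p B with smooth coefficient pairs (A, B) depending on \<kappa>.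
  Nonsingularity says that no nonzero functional vanishes on all pairs at u, so two of them are
  independent and the 2 x 2 system is solvable for f_s and f_p nearby.\<close>

lemma minors_generate_partial_derivatives:
  assumes u: "u \<in> critical"
  obtains O' \<kappa>1 \<kappa>2 a11 a12 a21 a22 where "open O'" "u \<in> O'" "O' \<subseteq> U" "inj \<kappa>1" "inj \<kappa>2"
    "smooth_on O' a11" "smooth_on O' a12" "smooth_on O' a21" "smooth_on O' a22"
    "\<forall>y\<in>O'. ff 3 y = a11 y * maximal_minor Lf \<kappa>1 y + a12 y * maximal_minor Lf \<kappa>2 y"
    "\<forall>y\<in>O'. ff 4 y = a21 y * maximal_minor Lf \<kappa>1 y + a22 y * maximal_minor Lf \<kappa>2 y"
proof -
  have uU: "u \<in> U" using criticalD[OF u] by auto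
  let ?e = "axis 4 1 :: real^7"
  have "\<exists>O' a b. open O' \<and> u \<in> O' \<and> O' \<subseteq> U \<and> smooth_on O' a \<and> smooth_on O' b \<and>
      (\<forall>y\<in>O'. DL y ?e $ i = ff 3 y * a y + ff 4 y * b y)" for i
    by (intro vanishing_on_critical[OF u openU uU order_refl] smooth_on_vec_nth[OF openU] smooth_on_frechet_derivative smooth_L)
       (simp add: DL_axis4[THEN iffD2])
  then have "\<forall>i. \<exists>O' a b. open O' \<and> u \<in> O' \<and> O' \<subseteq> U \<and> smooth_on O' a \<and> smooth_on O' b \<and>
      (\<forall>y\<in>O'. DL y ?e $ i = ff 3 y * a y + ff 4 y * b y)" by blast
  from choice[OF this] obtain Oi where "\<forall>i. \<exists>a b. open (Oi i) \<and> u \<in> Oi i \<and> Oi i \<subseteq> U \<and> smooth_on (Oi i) a \<and> smooth_on (Oi i) b \<and>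
      (\<forall>y\<in>Oi i. DL y ?e $ i = ff 3 y * a y + ff 4 y * b y)" by blast
  from choice[OF this] obtain ai where "\<forall>i. \<exists>b. open (Oi i) \<and> u \<in> Oi i \<and> Oi i \<subseteq> U \<and> smooth_on (Oi i) (ai i) \<and> smooth_on (Oi i) b \<and>
      (\<forall>y\<in>Oi i. DL y ?e $ i = ff 3 y * ai i y + ff 4 y * b y)" by blast
  from choice[OF this] obtain bi where i: "\<And>i. open (Oi i)" "\<And>i. u \<in> Oi i" "\<And>i. Oi i \<subseteq> U" "\<And>i. smooth_on (Oi i) (ai i)" "\<And>i. smooth_on (Oi i) (bi i)"
      "\<And>i y. y \<in> Oi i \<Longrightarrow> DL y ?e $ i = ff 3 y * ai i y + ff 4 y * bi i y" by blast
  define O1 where "O1 = (\<Inter>i. Oi i)"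
  have O1: "open O1" "u \<in> O1" "O1 \<subseteq> U" using i(1,2) i(3)[of 1] by (auto simp: O1_def intro!: open_INT)
  define a b :: "real^7 \<Rightarrow> real^8" where "a y = (\<chi> i. ai i y)" and "b y = (\<chi> i. bi i y)" for y
  have sub: "O1 \<subseteq> Oi i" for i by (auto simp: O1_def)
  have ab: "smooth_on O1 a" "smooth_on O1 b"
    by (rule smooth_on_vecI[OF O1(1)]; simp add: a_def b_def; rule smooth_on_subset[OF i(4) sub] smooth_on_subset[OF i(5) sub])+
  have eq: "DL y ?e = ff 3 y *\<^sub>R a y + ff 4 y *\<^sub>R b y" if "y \<in> O1" for y
    using i(6)[OF subsetD[OF sub that]] by (simp add: vec_eq_iff a_def b_def)
  define Am Bm where "Am \<kappa> y = column4_minor \<kappa> (a y) y" and "Bm \<kappa> y = column4_minor \<kappa> (b y) y" for \<kappa> y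
  have sm: "smooth_on O1 (Am \<kappa>)" "smooth_on O1 (Bm \<kappa>)" for \<kappa>
    unfolding Am_def[abs_def] Bm_def[abs_def] by (intro smooth_column4_minor O1 ab)+
  have m: "maximal_minor Lf \<kappa> y = ff 3 y * Am \<kappa> y + ff 4 y * Bm \<kappa> y" if "y \<in> O1" for \<kappa> y
    using maximal_minor_L[of y \<kappa>] that O1(3) by (auto simp: eq column4_minor_linear Am_def Bm_def)
  have ns: "\<exists>\<kappa>. inj \<kappa> \<and> s * Am \<kappa> u + t * Bm \<kappa> u \<noteq> 0" if "s \<noteq> 0 \<or> t \<noteq> 0" for s t
    using column4_nonsingular[OF u O1 ab eq that] by (simp add: column4_minor_linear Am_def Bm_def)
  \<comment> \<open>The functional (1, 0) selects a pair with A \<noteq> 0. The functional (B, -A)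
    vanishes on that pair, so the second selection is independent of it, which is \<Delta> u
    \<noteq> 0.\<close>
  obtain \<kappa>1 where \<kappa>1: "inj \<kappa>1" "Am \<kappa>1 u \<noteq> 0" using ns[of 1 0] by auto
  obtain \<kappa>2 where \<kappa>2: "inj \<kappa>2" "Bm \<kappa>1 u * Am \<kappa>2 u + (- Am \<kappa>1 u) * Bm \<kappa>2 u \<noteq> 0"
    using ns[of "Bm \<kappa>1 u" "- Am \<kappa>1 u"] \<kappa>1(2) by auto
  define \<Delta> where "\<Delta> y = Am \<kappa>1 y * Bm \<kappa>2 y - Am \<kappa>2 y * Bm \<kappa>1 y" for y
  have s\<Delta>: "smooth_on O1 \<Delta>"
    unfolding \<Delta>_def[abs_def] by (intro smooth_on_diff smooth_on_mult O1 sm)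
  define O2 where "O2 = O1 \<inter> \<Delta> -` (- {0})"
  have O2: "open O2" "u \<in> O2" "O2 \<subseteq> U"
    using continuous_open_preimage[OF smooth_on_continuous_on[OF s\<Delta>] O1(1), of "- {0}"] O1 \<kappa>2(2)
    by (auto simp: O2_def \<Delta>_def algebra_simps)
  have sO2: "smooth_on O2 g" if "smooth_on O1 g" for g :: "real^7 \<Rightarrow> real"
    by (rule smooth_on_subset[OF that]) (simp add: O2_def)
  have nz: "\<Delta> y \<noteq> 0" and yO1: "y \<in> O1" if "y \<in> O2" for y using that by (auto simp: O2_def)
  have e3: "ff 3 y = Bm \<kappa>2 y / \<Delta> y * maximal_minor Lf \<kappa>1 y + (- Bm \<kappa>1 y) / \<Delta> y * maximal_minor Lf \<kappa>2 y" if "y \<in> O2" for y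
  proof -
    have "Bm \<kappa>2 y * maximal_minor Lf \<kappa>1 y + (- Bm \<kappa>1 y) * maximal_minor Lf \<kappa>2 y = ff 3 y * \<Delta> y"
      unfolding m[OF yO1[OF that]] \<Delta>_def by (simp add: algebra_simps)
    then show ?thesis
      unfolding times_divide_eq_left add_divide_distrib[symmetric] by (simp only: nonzero_mult_div_cancel_right[OF nz[OF that]])
  qed
  have e4: "ff 4 y = (- Am \<kappa>2 y) / \<Delta> y * maximal_minor Lf \<kappa>1 y + Am \<kappa>1 y / \<Delta> y * maximal_minor Lf \<kappa>2 y" if "y \<in> O2" for y
  proof -
    have "(- Am \<kappa>2 y) * maximal_minor Lf \<kappa>1 y + Am \<kappa>1 y * maximal_minor Lf \<kappa>2 y = ff 4 y * \<Delta> y"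
      unfolding m[OF yO1[OF that]] \<Delta>_def by (simp add: algebra_simps)
    then show ?thesis
      unfolding times_divide_eq_left add_divide_distrib[symmetric] by (simp only: nonzero_mult_div_cancel_right[OF nz[OF that]])
  qed
  show thesis
    by (rule that[OF O2 \<kappa>1(1) \<kappa>2(1) _ _ _ _ ballI[OF e3] ballI[OF e4]])
       (intro smooth_on_divide smooth_on_minus O2(1) sO2 sm s\<Delta> nz; assumption)+
qed

lemma minors_generate_L: "minors_generate_ideal_of U Lf critical"
  unfolding minors_generate_ideal_of_def
proof (intro conjI allI impI ballI)
  fix \<kappa> :: "7 \<Rightarrow> 8" and u assume u: "u \<in> critical"
  then have "u \<in> U" by (rule criticalD)
  then have "jacobian Lf (at u) *v axis 4 1 = 0" using u DL_axis4 jacobian_L by simp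
  then show "maximal_minor Lf \<kappa> u = 0"
    unfolding maximal_minor_def by (intro maximal_minor_zero_if_kernel[of "axis 4 1"]) (simp_all add: axis_eq_0_iff)
next
  fix u O' and g :: "real^7 \<Rightarrow> real"
  assume u: "u \<in> U" and h: "open O' \<and> u \<in> O' \<and> O' \<subseteq> U \<and> smooth_on O' g \<and> (\<forall>y\<in>O' \<inter> critical. g y = 0)"
  show "\<exists>O'' a. open O'' \<and> u \<in> O'' \<and> O'' \<subseteq> O' \<and> (\<forall>\<kappa>. smooth_on O'' (a \<kappa>)) \<and>
      (\<forall>y\<in>O''. g y = (\<Sum>\<kappa> | inj \<kappa>. a \<kappa> y * maximal_minor Lf \<kappa> y))"
  proof (cases "u \<in> critical")
    case True
    obtain O1 a b where 1: "open O1" "u \<in> O1" "O1 \<subseteq> O'" "smooth_on O1 a" "smooth_on O1 b"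
      "\<And>y. y \<in> O1 \<Longrightarrow> g y = ff 3 y * a y + ff 4 y * b y"
      using vanishing_on_critical[OF True, of O' g] h by blast
    obtain O2 \<kappa>1 \<kappa>2 a11 a12 a21 a22 where 2: "open O2" "u \<in> O2" "O2 \<subseteq> U" "inj \<kappa>1" "inj \<kappa>2"
      "smooth_on O2 a11" "smooth_on O2 a12" "smooth_on O2 a21" "smooth_on O2 a22"
      and e3: "\<forall>y\<in>O2. ff 3 y = a11 y * maximal_minor Lf \<kappa>1 y + a12 y * maximal_minor Lf \<kappa>2 y"
      and e4: "\<forall>y\<in>O2. ff 4 y = a21 y * maximal_minor Lf \<kappa>1 y + a22 y * maximal_minor Lf \<kappa>2 y"
      using minors_generate_partial_derivatives[OF True] .
    define O3 where "O3 = O1 \<inter> O2"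
    have O3: "open O3" "u \<in> O3" "O3 \<subseteq> O'" using 1 2 by (auto simp: O3_def)
    have s1: "smooth_on O3 k" if "smooth_on O1 k" for k :: "real^7 \<Rightarrow> real"
      by (rule smooth_on_subset[OF that]) (simp add: O3_def)
    have s2: "smooth_on O3 k" if "smooth_on O2 k" for k :: "real^7 \<Rightarrow> real"
      by (rule smooth_on_subset[OF that]) (simp add: O3_def)
    define b1 where "b1 y = a11 y * a y + a21 y * b y" for y
    define b2 where "b2 y = a12 y * a y + a22 y * b y" for y
    have sb: "smooth_on O3 b1" "smooth_on O3 b2"
      unfolding b1_def[abs_def] b2_def[abs_def]
      by (intro smooth_on_add smooth_on_mult O3(1) s1[OF 1(4)] s1[OF 1(5)] s2[OF 2(6)] s2[OF 2(7)] s2[OF 2(8)] s2[OF 2(9)])+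
    \<comment> \<open>The sum of two conditional terms handles both selections without comparing
      \<kappa>1 with \<kappa>2.\<close>
    define c where "c \<kappa> y = (if \<kappa> = \<kappa>1 then b1 y else 0) + (if \<kappa> = \<kappa>2 then b2 y else 0)" for \<kappa> y
    have "smooth_on O3 (c \<kappa>)" for \<kappa>
      unfolding c_def[abs_def]
      by (intro smooth_on_add O3(1); cases "\<kappa> = \<kappa>1"; cases "\<kappa> = \<kappa>2") (simp_all add: sb smooth_on_const O3(1))
    moreover have "g y = (\<Sum>\<kappa> | inj \<kappa>. c \<kappa> y * maximal_minor Lf \<kappa> y)" if "y \<in> O3" for y
    proof -
      have fin: "finite {\<kappa> :: 7 \<Rightarrow> 8. inj \<kappa>}" by simp
      have "(\<Sum>\<kappa> | inj \<kappa>. c \<kappa> y * maximal_minor Lf \<kappa> y) =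
          (\<Sum>\<kappa> | inj \<kappa>. if \<kappa> = \<kappa>1 then b1 y * maximal_minor Lf \<kappa> y else 0) + (\<Sum>\<kappa> | inj \<kappa>. if \<kappa> = \<kappa>2 then b2 y * maximal_minor Lf \<kappa> y else 0)"
        unfolding sum.distrib[symmetric] by (intro sum.cong) (auto simp: c_def algebra_simps)
      also have "\<dots> = b1 y * maximal_minor Lf \<kappa>1 y + b2 y * maximal_minor Lf \<kappa>2 y"
        using 2(4,5) fin by simp
      also have "\<dots> = g y"
        using that 1(6)[of y] bspec[OF e3, of y] bspec[OF e4, of y] by (simp add: O3_def b1_def b2_def algebra_simps)
      finally show ?thesis by simp
    qed
    ultimately show ?thesis using O3 by blast
  next
    case False
    \<comment> \<open>Off the critical set the differential is injective, some maximal minor is a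
      unit nearby, and the ideal is everything: g is divided by that minor.\<close>
    have "w = 0" if w: "jacobian Lf (at u) *v w = 0" for w
    proof -
      have z: "DL u w = 0" using w jacobian_L[OF u] by simp
      then have e: "w = w $ 4 *\<^sub>R axis 4 1" using kernel_DL[OF u] by blast
      have "w $ 4 *\<^sub>R DL u (axis 4 1) = 0"
        using z arg_cong[OF e, of "DL u"] linear_cmul[OF linear_DL[OF u]] by simp
      then have "w $ 4 = 0" using False DL_axis4[OF u] by simp
      then show "w = 0" using e by simp
    qed
    then obtain \<kappa>0 where \<kappa>0: "inj \<kappa>0" "maximal_minor Lf \<kappa>0 u \<noteq> 0"
      using nonzero_maximal_minor_exists[of "jacobian Lf (at u)"] unfolding maximal_minor_def by blast
    define O'' where "O'' = O' \<inter> maximal_minor Lf \<kappa>0 -` (- {0})"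
    have sm: "smooth_on O' (maximal_minor Lf \<kappa>0)"
      by (rule smooth_on_subset[OF smooth_maximal_minor_L]) (use h in blast)
    have O'': "open O''" "u \<in> O''" "O'' \<subseteq> O'"
      using continuous_open_preimage[OF smooth_on_continuous_on[OF sm], of "- {0}"] h \<kappa>0(2) by (auto simp: O''_def)
    define c where "c \<kappa> y = (if \<kappa> = \<kappa>0 then g y / maximal_minor Lf \<kappa>0 y else 0)" for \<kappa> y
    have "smooth_on O'' (\<lambda>y. g y / maximal_minor Lf \<kappa>0 y)"
      using h smooth_on_subset[OF _ O''(3)] sm by (intro smooth_on_divide O''(1)) (auto simp: O''_def)
    then have "smooth_on O'' (c \<kappa>)" for \<kappa>
      unfolding c_def[abs_def] by (cases "\<kappa> = \<kappa>0") (simp_all add: smooth_on_const O''(1))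
    moreover have "g y = (\<Sum>\<kappa> | inj \<kappa>. c \<kappa> y * maximal_minor Lf \<kappa> y)" if "y \<in> O''" for y
    proof -
      have "(\<Sum>\<kappa> | inj \<kappa>. c \<kappa> y * maximal_minor Lf \<kappa> y) = (\<Sum>\<kappa> | inj \<kappa>. if \<kappa> = \<kappa>0 then g y else 0)"
        using that by (intro sum.cong) (auto simp: c_def O''_def)
      also have "\<dots> = g y" using \<kappa>0(1) by simp
      finally show ?thesis by simp
    qed
    ultimately show ?thesis using O'' by blast
  qed
qed

text \<open>f_s and f_p are constant along any curve in the critical set, so the chain rule gives
  the claim.\<close>

lemma tangent_space_critical:
  assumes "v \<in> tangent_space critical u" "u \<in> critical"
  shows "Dff 3 u v = 0" "Dff 4 u v = 0"
proof -
  obtain \<gamma> e where e: "0 < e" "\<gamma> ` {-e<..<e} \<subseteq> critical" "\<gamma> 0 = u" "(\<gamma> has_vector_derivative v) (at (0::real))"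
    using assms(1) by (auto simp: tangent_space_def)
  have "Dff i u v = 0" if i: "i \<in> {3, 4}" for i
  proof -
    have "(ff i has_derivative Dff i u) (at (\<gamma> 0))" using has_derivative_ff criticalD(1)[OF assms(2)] e(3) by simp
    from has_derivative_compose[OF e(4)[unfolded has_vector_derivative_def] this]
    have "((\<lambda>s. ff i (\<gamma> s)) has_derivative (\<lambda>s. Dff i u (s *\<^sub>R v))) (at 0)" .
    moreover have "((\<lambda>s. ff i (\<gamma> s)) has_derivative (\<lambda>s. 0)) (at 0)"
    proof (rule has_derivative_transform_within_open[OF has_derivative_const, of "{-e<..<e}"])
      show "0 = ff i (\<gamma> s)" if "s \<in> {-e<..<e}" for s
      proof -
        have "\<gamma> s \<in> critical" using e(2) that by blast
        then show ?thesis using criticalD(2,3) i by auto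
      qed
    qed (use e(1) in auto)
    ultimately have "(\<lambda>s. Dff i u (s *\<^sub>R v)) = (\<lambda>s. 0)" by (rule has_derivative_unique)
    from fun_cong[OF this, of 1] show ?thesis by simp
  qed
  then show "Dff 3 u v = 0" "Dff 4 u v = 0" by auto
qed

lemma cross_cap_L: "cross_cap U Lf"
proof -
  have "{v. DL u v = 0} \<inter> tangent_space critical u = {0}" if u: "u \<in> critical" for u
  proof -
    have uU: "u \<in> U" using criticalD[OF u] by blast
    have "v = 0" if v: "DL u v = 0" "v \<in> tangent_space critical u" for v
    proof -
      \<comment> \<open>The kernel is the p3-direction. If it were tangent to the critical set, the
        Hessian of f would annihilate it, contrary to the fold condition.\<close>
      have e: "v = v $ 4 *\<^sub>R axis 4 1" by (rule kernel_DL[OF uU v(1)])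
      have "v $ 2 = 0" "v $ 3 = 0" by (subst e, simp add: axis_def)+
      then have "v $ 4 = 0" using hessian_nondegenerate(2)[OF u _ _ tangent_space_critical[OF v(2) u]] by simp
      then show "v = 0" using e by simp
    qed
    moreover have "0 \<in> tangent_space critical u"
      using u unfolding tangent_space_def
      by (intro CollectI exI[of _ "\<lambda>_. u"] exI[of _ 1]) (auto intro: smooth_on_const)
    moreover have "DL u 0 = 0" by (rule linear_0[OF linear_DL[OF uU]])
    ultimately show ?thesis by blast
  qed
  moreover have "smooth_submanifold (CARD(8) - CARD(7) + 1) critical"
    using critical_submanifold by (simp add: numeral_2_eq_2)
  ultimately show ?thesis
    unfolding cross_cap_def rank_drop_set_L
    using openU smooth_L rank_drops_L minors_generate_L by simp
qed

section \<open>The images lie in the cotangent bundles without zero section\<close>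

lemma image_R: "Rf ` U \<subseteq> cotangent_space A"
proof
  fix w assume "w \<in> Rf ` U"
  then obtain u where u: "u \<in> U" "w = Rf u" by blast
  have "vector [w $ 1, w $ 2, w $ 3] = xx u"
    using u by (simp add: Rf_nth base_point_def incident_part_def)
  then have "original A (vector [w $ 1, w $ 2, w $ 3]) \<in> subsurface" using subsurface_x[OF u(1)] by simp
  moreover have "\<exists>i\<in>{4, 5, 6}. w $ i \<noteq> 0"
  proof (rule ccontr)
    assume "\<not> (\<exists>i\<in>{4, 5, 6}. w $ i \<noteq> 0)"
    then have "yy u = 0" using u tau[OF u(1)] by (auto simp: Rf_nth vec_eq_iff forall_3)
    then show False using yy_takeoff[OF u(1)] by simp
  qed
  ultimately show "w \<in> cotangent_space A" by (simp add: cotangent_space_def)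
qed

lemma image_L: "Lf ` U \<subseteq> cotangent_data Src Rec s2 T"
proof
  fix w assume "w \<in> Lf ` U"
  then obtain u where u: "u \<in> U" "w = Lf u" by blast
  have "0 < t_inc (incident_part u) + t_ref u"
    using travel_time_pos[OF c0 incident_ray[OF u(1)]] travel_time_pos[OF c0 reflected_ray[OF u(1)]] by simp
  then show "w \<in> cotangent_data Src Rec s2 T"
    using u sources[OF u(1)] receivers[OF u(1)] time_less[OF u(1)] tau[OF u(1)]
    by (simp add: cotangent_data_def Lf_nth)
qed

end

theorem mainTheorem2:
  fixes c0 :: "real^3 \<Rightarrow> real"
    and Src Rec :: "(real \<times> real) set"
    and T s2 br :: real
    and A :: "real^3^3"
    and D :: "(real^4) set" and U :: "(real^7) set"
    and f g1 g2 t_inc :: "real^4 \<Rightarrow> real" and p0 :: "real^4 \<Rightarrow> real^3"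
    and r1 r2 t_ref :: "real^7 \<Rightarrow> real" and q :: "real^7 \<Rightarrow> real^3"
    and \<Gamma> :: "real^7 \<Rightarrow> (real^8) \<times> (real^6)"
  assumes "sound_speed c0"
    and "open Src" "bounded Src" "open Rec" "bounded Rec"
    and "no_ray_connects c0 Src Rec"
    and "no_ray_grazes_surface c0"
    and "orthogonal_matrix A"
    and "incident_coordinates c0 Src s2 A D f g1 g2"
    and folds: "submersion_with_folds D (base_point f)"
    and "incident_data c0 s2 A D f g1 g2 t_inc p0"
    and "br = 1 \<or> br = -1"
    and "reflected_data c0 A br f U r1 r2 t_ref q"
    and \<Gamma>: "\<Gamma> = canonical_point c0 A br f g1 g2 t_inc p0 r1 r2 t_ref q"
    and "marine_parametrization T Rec D t_inc r1 r2 t_ref U \<Gamma>"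
  shows "(snd \<circ> \<Gamma>) ` U \<subseteq> cotangent_space A \<and> submersion_with_folds U (snd \<circ> \<Gamma>) \<and>
         (fst \<circ> \<Gamma>) ` U \<subseteq> cotangent_data Src Rec s2 T \<and> cross_cap U (fst \<circ> \<Gamma>)"
proof -
  interpret marine_geometry c0 Src Rec T s2 br A D U f g1 g2 t_inc p0 r1 r2 t_ref q
    using assms by unfold_locales auto
  have "fst \<circ> \<Gamma> = canonical_left t_inc p0 r1 r2 t_ref q" "snd \<circ> \<Gamma> = canonical_right c0 A br f g1 g2"
    by (simp_all add: \<Gamma> canonical_point_def fun_eq_iff)
  then show ?thesis
    using image_R submersion_with_folds_R image_L cross_cap_L by simp
qed

end
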